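(* Let $(\Gamma,\lambda)$ be a tree plan, let $S$ be a countably infinite set, and let $\mathcal{M}$ be a nil-interaction coordinatized (NIC) structure expanding $\Gamma(S)$. For each $\sigma\in I(\Gamma)$ let $T_\sigma$ be the complete theory of the $\mathcal{L}_\sigma$-structures $\mathcal{M}(e)$ with $\pi(e)=\sigma$. Suppose that for each $\sigma\in I(\Gamma)$, $T_\sigma$ is MS-measurable via $(\dim_\sigma,\mathrm{meas}_\sigma)$ (i.e. each $\mathcal{M}(e)$ with $\pi(e)=\sigma$ is MS-measurable via $(\dim_\sigma,\mathrm{meas}_\sigma)$) and $\dim_\sigma(x=x)=1$. Then $\mathcal{M}$ is MS-measurable via a function $(\dim,\mathrm{meas})$ such that for all $e\in\Gamma(S)$ with $\sigma=\pi(e)\in I(\Gamma)$ and all finite sets $B\subseteq\Gamma(S)$ with $\mathrm{tcl}(B)=B$, $$\dim(e/B)=\big|\{x\in\Gamma(S):\pi(x)\in I(\Gamma)\text{ and }[e\wedge B]<x\le e\}\big|$$ and $$\mathrm{meas}\big(e/B\cup\{\mathtt{pred}(e)\}\big)=\mathrm{meas}_\sigma\big(e/B\cap M(e)\big).$$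
   Context: A tree plan is a pair $(\Gamma,\lambda)$ where $\Gamma$ is a finite subset of $\omega^{<\omega}$ containing the empty sequence $\langle\rangle$ and closed under initial segments, and $\lambda:\Gamma\to\{1,\infty\}$ satisfies $\lambda(\langle\rangle)=1$; $I(\Gamma)=\lambda^{-1}(\infty)$ is the set of infinity-nodes. For a set $X$, $\Gamma(X)$ is the set of finite sequences $\langle (i_0,t_0),\dots,(i_n,t_n)\rangle$ (including the empty sequence) such that $\langle i_0,\dots,i_n\rangle\in\Gamma$ and, for each $k\le n$, $t_k=\star$ (a fixed symbol not in $X$) if $\lambda(\langle i_0,\dots,i_k\rangle)=1$ and $t_k\in X$ if $\lambda(\langle i_0,\dots,i_k\rangle)=\infty$; the map $\pi:\Gamma(X)\to\Gamma$ sends $\langle (i_0,t_0),\dots,(i_n,t_n)\rangle$ to $\langle i_0,\dots,i_n\rangle$. $\Gamma(X)$ is a structure in the language $\mathcal{L}_\Gamma$ consisting of: $\le$ (initial-segment order), a constant $\varepsilon$ (the empty sequence), a binary function $\sqcap$ (meet = longest common initial segment), a unary function $\mathtt{pred}$ (deleting the last entry; $\mathtt{pred}(\varepsilon)=\varepsilon$), and unary predicates $P_\sigma=\pi^{-1}(\sigma)$ for $\sigma\in\Gamma$. Types $\mathrm{tp}_\Gamma$ are computed in $\Gamma(S)$, types $\mathrm{tp}^\mathcal{M}$ in $\mathcal{M}$. Tree-closure: for $B\subseteq\Gamma(S)$, $\mathrm{tcl}_0(B)=\{\varepsilon\}\cup\{a:\exists b\in B,\ a\le b\}$, $\mathrm{tcl}_{n+1}(B)=\mathrm{tcl}_n(B)\cup\{a:\lambda(\pi(a))=1,\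 \mathtt{pred}(a)\in\mathrm{tcl}_n(B)\}$, $\mathrm{tcl}(B)=\bigcup_n\mathrm{tcl}_n(B)$. For $a\in\Gamma(S)$, $[a\wedge B]=\max\{e\in\mathrm{tcl}(B):e\le a\}$. For $a\in\Gamma(S)$, the component $M(a)=\{a':\mathtt{pred}(a')=\mathtt{pred}(a),\ \pi(a')=\pi(a)\}$. For an expansion $\mathcal{M}$ of $\Gamma(S)$ and $\sigma\in I(\Gamma)$, let $\mathcal{S}^\sigma_n$ be the set of types $\mathrm{tp}^\mathcal{M}(b,a_0,\dots,a_{n-1})$ with $\pi(a_0)=\sigma$, $b=\mathtt{pred}(a_0)$, $a_1,\dots,a_{n-1}\in M(a_0)$; $\mathcal{L}_\sigma$ has an $n$-ary relation symbol $R_p$ for each $n>0$ and $p(x,\bar y)\in\mathcal{S}^\sigma_n$. For $e$ with $\pi(e)=\sigma$, $\mathcal{M}(e)$ is the $\mathcal{L}_\sigma$-structure with universe $M(e)$ and $R_p^{\mathcal{M}(e)}=\{\bar a\in M(e)^n:\mathcal{M}\models p(\mathtt{pred}(e),\bar a)\}$. $\mathcal{M}$ is an NIC structure if: (N1) $\mathcal{M}$ is $\aleph_0$-categorical, eliminates quantifiers, and $\mathrm{acl}^\mathcal{M}=\mathrm{tcl}$; (N2) for every $e\in\Gamma(S)$, $\mathrm{tp}_\Gamma(e)\models\mathrm{tp}^\mathcal{M}(e)$ (every $e'$ with $\mathrm{tp}_\Gamma(e')=\mathrm{tp}_\Gamma(e)$ has $\mathrm{tp}^\mathcal{M}(e')=\mathrm{tp}^\mathcal{M}(e)$);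 (N3) for finite $C\subseteq\Gamma(S)$ and $e$ with $\pi(e)\in I(\Gamma)$, $\mathrm{tp}_\Gamma(e/C)\cup\mathrm{tp}^{\mathcal{M}(e)}(e/\mathrm{tcl}(C)\cap M(e))\models\mathrm{tp}^\mathcal{M}(e/C)$ (i.e. every $e'\in M(e)$ realizing both $\mathrm{tp}_\Gamma(e/C)$ and $\mathrm{tp}^{\mathcal{M}(e)}(e/\mathrm{tcl}(C)\cap M(e))$ realizes $\mathrm{tp}^\mathcal{M}(e/C)$). MS-measurability: for a structure $\mathcal{N}$, $\mathsf{Def}(\mathcal{N})$ is the set of all subsets of powers $N^n$ definable with parameters. An infinite $\mathcal{L}$-structure $\mathcal{N}$ is MS-measurable via $h=(\dim,\mathrm{meas}):\mathsf{Def}(\mathcal{N})\to(\mathbb{N}\times\mathbb{R}^{>0})\cup\{(0,0)\}$ if: (MS1) for each $\mathcal{L}$-formula $\phi(\bar x,\bar y)$ there is a finite set $D$ with $h(\phi(\mathcal{N},\bar a))\in D$ for all $\bar a$; (MS2) if $\phi(\mathcal{N},\bar a)$ is finite then $h(\phi(\mathcal{N},\bar a))=(0,|\phi(\mathcal{N},\bar a)|)$; (MS3) for each $\phi(\bar x,\bar y)$ and each $(d,\mu)$, $\{\bar a:h(\phi(\mathcal{N},\bar a))=(d,\mu)\}$ is $\emptyset$-definable; (MS4) for every definable surjection $f:X\to Y$ with $X,Y\in\mathsf{Def}(\mathcal{N})$, letting $D=\{h(f^{-1}[\bar b]):\bar b\in Y\}$ and $Y(d,\mu)=\{\bar b\in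 Y:h(f^{-1}[\bar b])=(d,\mu)\}$, we have $\dim(X)=\max\{d+\dim(Y(d,\mu)):(d,\mu)\in D\}$ and $\mathrm{meas}(X)=\sum\{\mu\cdot\mathrm{meas}(Y(d,\mu)):(d,\mu)\in D,\ d+\dim(Y(d,\mu))=\dim(X)\}$. In an $\aleph_0$-categorical structure, for a tuple $\bar a$ and finite $C$, $\dim(\bar a/C)$ and $\mathrm{meas}(\bar a/C)$ denote $\dim$ and $\mathrm{meas}$ of the set defined by a formula isolating $\mathrm{tp}(\bar a/C)$; $\dim_\sigma(x=x)$ is the dimension of the whole universe.
   Formalization: "T_σ is MS-measurable via (dim_σ, meas_σ)" is read as: each M(e) with π(e)=σ is, and the formula defining {a : h_σ(φ(M(e),a))=(d,μ)} is the same for all such e; otherwise measures could vary with e and the claim fails. *)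

theory Defs
  imports Complex_Main "HOL-Library.Sublist" "HOL-Library.Extended_Nat"
begin

section \<open>First-order logic\<close>

text \<open>The symbols of a language are the elements of the domains of its two arity maps.\<close>

record ('f, 'r) lang =
  farity :: "'f \<rightharpoonup> nat"
  rarity :: "'r \<rightharpoonup> nat"

record ('f, 'r, 'a) struc =
  univ :: "'a set"
  fn :: "'f \<Rightarrow> 'a list \<Rightarrow> 'a"
  rl :: "'r \<Rightarrow> 'a list \<Rightarrow> bool"

datatype 'f tm = Var nat | App 'f "'f tm list"

datatype ('f, 'r) fm =
    Fls
  | Eq "'f tm" "'f tm"
  | Rel 'r "'f tm list"
  | Neg "('f, 'r) fm"
  | Conj "('f, 'r) fm" "('f, 'r) fm"
  | Exi nat "('f, 'r) fm"

definition tuples :: "'a set \<Rightarrow> nat \<Rightarrow> 'a list set" where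
  "tuples A n = {xs. length xs = n \<and> set xs \<subseteq> A}"

definition is_struct :: "('f, 'r) lang \<Rightarrow> ('f, 'r, 'a) struc \<Rightarrow> bool" where
  "is_struct L N \<longleftrightarrow> univ N \<noteq> {} \<and>
     (\<forall>f k. farity L f = Some k \<longrightarrow> (\<forall>xs\<in>tuples (univ N) k. fn N f xs \<in> univ N))"

fun wf_tm :: "('f, 'r) lang \<Rightarrow> 'f tm \<Rightarrow> bool" where
  "wf_tm L (Var i) \<longleftrightarrow> True"
| "wf_tm L (App f ts) \<longleftrightarrow> farity L f = Some (length ts) \<and> (\<forall>t\<in>set ts. wf_tm L t)"

fun wf_fm :: "('f, 'r) lang \<Rightarrow> ('f, 'r) fm \<Rightarrow> bool" where
  "wf_fm L Fls \<longleftrightarrow> True"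
| "wf_fm L (Eq s t) \<longleftrightarrow> wf_tm L s \<and> wf_tm L t"
| "wf_fm L (Rel r ts) \<longleftrightarrow> rarity L r = Some (length ts) \<and> (\<forall>t\<in>set ts. wf_tm L t)"
| "wf_fm L (Neg \<phi>) \<longleftrightarrow> wf_fm L \<phi>"
| "wf_fm L (Conj \<phi> \<psi>) \<longleftrightarrow> wf_fm L \<phi> \<and> wf_fm L \<psi>"
| "wf_fm L (Exi i \<phi>) \<longleftrightarrow> wf_fm L \<phi>"

fun fv_tm :: "'f tm \<Rightarrow> nat set" where
  "fv_tm (Var i) = {i}"
| "fv_tm (App f ts) = (\<Union>t\<in>set ts. fv_tm t)"

fun fv :: "('f, 'r) fm \<Rightarrow> nat set" where
  "fv Fls = {}"
| "fv (Eq s t) = fv_tm s \<union> fv_tm t"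
| "fv (Rel r ts) = (\<Union>t\<in>set ts. fv_tm t)"
| "fv (Neg \<phi>) = fv \<phi>"
| "fv (Conj \<phi> \<psi>) = fv \<phi> \<union> fv \<psi>"
| "fv (Exi i \<phi>) = fv \<phi> - {i}"

fun qfree :: "('f, 'r) fm \<Rightarrow> bool" where
  "qfree (Neg \<phi>) \<longleftrightarrow> qfree \<phi>"
| "qfree (Conj \<phi> \<psi>) \<longleftrightarrow> qfree \<phi> \<and> qfree \<psi>"
| "qfree (Exi i \<phi>) \<longleftrightarrow> False"
| "qfree _ \<longleftrightarrow> True"

fun eval_tm :: "('f, 'r, 'a) struc \<Rightarrow> (nat \<Rightarrow> 'a) \<Rightarrow> 'f tm \<Rightarrow> 'a" where
  "eval_tm N v (Var i) = v i"
| "eval_tm N v (App f ts) = fn N f (map (eval_tm N v) ts)"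

fun sat :: "('f, 'r, 'a) struc \<Rightarrow> (nat \<Rightarrow> 'a) \<Rightarrow> ('f, 'r) fm \<Rightarrow> bool" where
  "sat N v Fls \<longleftrightarrow> False"
| "sat N v (Eq s t) \<longleftrightarrow> eval_tm N v s = eval_tm N v t"
| "sat N v (Rel r ts) \<longleftrightarrow> rl N r (map (eval_tm N v) ts)"
| "sat N v (Neg \<phi>) \<longleftrightarrow> \<not> sat N v \<phi>"
| "sat N v (Conj \<phi> \<psi>) \<longleftrightarrow> sat N v \<phi> \<and> sat N v \<psi>"
| "sat N v (Exi i \<phi>) \<longleftrightarrow> (\<exists>a\<in>univ N. sat N (v(i := a)) \<phi>)"

text \<open>Formulas in the free variables \<open>0, \<dots>, k - 1\<close>. A formula \<open>\<phi>(x, y)\<close> with \<open>|x| = n\<close> and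
  \<open>|y| = m\<close> is an element of \<open>formulas L (n + m)\<close>: the first \<open>n\<close> variables form \<open>x\<close>. Tuples are
  evaluated through the assignment \<open>nth xs\<close>, whose values beyond \<open>length xs\<close> are irrelevant.\<close>

definition formulas :: "('f, 'r) lang \<Rightarrow> nat \<Rightarrow> ('f, 'r) fm set" where
  "formulas L k = {\<phi>. wf_fm L \<phi> \<and> fv \<phi> \<subseteq> {..<k}}"

text \<open>The set \<open>\<phi>(N, cs) \<subseteq> N\<^sup>n\<close>.\<close>

definition solset :: "('f, 'r, 'a) struc \<Rightarrow> nat \<Rightarrow> ('f, 'r) fm \<Rightarrow> 'a list \<Rightarrow> 'a list set" where
  "solset N n \<phi> cs = {xs \<in> tuples (univ N) n. sat N (nth (xs @ cs)) \<phi>}"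

definition elem_equiv ::
    "('f, 'r) lang \<Rightarrow> ('f, 'r, 'a) struc \<Rightarrow> ('f, 'r, 'b) struc \<Rightarrow> bool" where
  "elem_equiv L N N' \<longleftrightarrow>
     (\<forall>\<phi>\<in>formulas L 0. sat N (nth []) \<phi> \<longleftrightarrow> sat N' (nth []) \<phi>)"

definition isomorphic ::
    "('f, 'r) lang \<Rightarrow> ('f, 'r, 'a) struc \<Rightarrow> ('f, 'r, 'b) struc \<Rightarrow> bool" where
  "isomorphic L N N' \<longleftrightarrow> (\<exists>g. bij_betw g (univ N) (univ N') \<and>
     (\<forall>f k. farity L f = Some k \<longrightarrow>
        (\<forall>xs\<in>tuples (univ N) k. g (fn N f xs) = fn N' f (map g xs))) \<and>
     (\<forall>r k. rarity L r = Some k \<longrightarrow>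
        (\<forall>xs\<in>tuples (univ N) k. rl N r xs \<longleftrightarrow> rl N' r (map g xs))))"

text \<open>The usual convention that languages are countable is part of the notion. Every countably
  infinite structure is isomorphic to one whose universe is a set of natural numbers.\<close>

definition aleph0_categorical :: "('f, 'r) lang \<Rightarrow> ('f, 'r, 'a) struc \<Rightarrow> bool" where
  "aleph0_categorical L N \<longleftrightarrow>
     countable (dom (farity L)) \<and> countable (dom (rarity L)) \<and>
     countable (univ N) \<and> infinite (univ N) \<and>
     (\<forall>N' :: ('f, 'r, nat) struc.
        is_struct L N' \<and> infinite (univ N') \<and> elem_equiv L N N' \<longrightarrow> isomorphic L N N')"

definition eliminates_quantifiers :: "('f, 'r) lang \<Rightarrow> ('f, 'r, 'a) struc \<Rightarrow> bool" where
  "eliminates_quantifiers L N \<longleftrightarrow>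
     (\<forall>\<phi>. wf_fm L \<phi> \<longrightarrow> (\<exists>\<psi>. wf_fm L \<psi> \<and> qfree \<psi> \<and> fv \<psi> \<subseteq> fv \<phi> \<and>
        (\<forall>v. range v \<subseteq> univ N \<longrightarrow> (sat N v \<phi> \<longleftrightarrow> sat N v \<psi>))))"

definition acl :: "('f, 'r) lang \<Rightarrow> ('f, 'r, 'a) struc \<Rightarrow> 'a set \<Rightarrow> 'a set" where
  "acl L N B = {a. \<exists>m. \<exists>\<phi>\<in>formulas L (1 + m). \<exists>cs\<in>tuples B m.
     [a] \<in> solset N 1 \<phi> cs \<and> finite (solset N 1 \<phi> cs)}"

definition tp :: "('f, 'r) lang \<Rightarrow> ('f, 'r, 'a) struc \<Rightarrow> 'a list \<Rightarrow> ('f, 'r) fm set" where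
  "tp L N as = {\<phi> \<in> formulas L (length as). sat N (nth as) \<phi>}"

text \<open>The type of \<open>as\<close> over \<open>C\<close>; a pair \<open>(\<phi>, cs)\<close> stands for the formula \<open>\<phi>(x, cs)\<close>.\<close>

definition tp_over :: "('f, 'r) lang \<Rightarrow> ('f, 'r, 'a) struc \<Rightarrow> 'a list \<Rightarrow> 'a set \<Rightarrow>
    (('f, 'r) fm \<times> 'a list) set" where
  "tp_over L N as C = {(\<phi>, cs). set cs \<subseteq> C \<and> \<phi> \<in> formulas L (length as + length cs) \<and>
     sat N (nth (as @ cs)) \<phi>}"

definition isolates :: "('f, 'r) lang \<Rightarrow> ('f, 'r, 'a) struc \<Rightarrow> ('f, 'r) fm \<Rightarrow> 'a list \<Rightarrow>
    'a list \<Rightarrow> 'a set \<Rightarrow> bool" where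
  "isolates L N \<phi> cs as C \<longleftrightarrow> (\<phi>, cs) \<in> tp_over L N as C \<and>
     (\<forall>(\<psi>, ds)\<in>tp_over L N as C. solset N (length as) \<phi> cs \<subseteq> solset N (length as) \<psi> ds)"

text \<open>All isolating formulas define the same set.\<close>

definition isolated_set :: "('f, 'r) lang \<Rightarrow> ('f, 'r, 'a) struc \<Rightarrow> 'a list \<Rightarrow> 'a set \<Rightarrow>
    'a list set" where
  "isolated_set L N as C =
     (THE X. \<exists>\<phi> cs. isolates L N \<phi> cs as C \<and> X = solset N (length as) \<phi> cs)"

text \<open>\<open>N\<close> is an expansion of \<open>N0\<close>; the symbols of the smaller language are tagged by \<open>Inl\<close>.\<close>

definition is_expansion :: "('f0, 'r0) lang \<Rightarrow> ('f0, 'r0, 'a) struc \<Rightarrow>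
    ('f0 + 'f, 'r0 + 'r) lang \<Rightarrow> ('f0 + 'f, 'r0 + 'r, 'a) struc \<Rightarrow> bool" where
  "is_expansion L0 N0 L N \<longleftrightarrow> is_struct L N \<and>
     (\<forall>f. farity L (Inl f) = farity L0 f) \<and> (\<forall>r. rarity L (Inl r) = rarity L0 r) \<and>
     univ N = univ N0 \<and>
     (\<forall>f k. farity L0 f = Some k \<longrightarrow> (\<forall>xs\<in>tuples (univ N0) k. fn N (Inl f) xs = fn N0 f xs)) \<and>
     (\<forall>r k. rarity L0 r = Some k \<longrightarrow> (\<forall>xs\<in>tuples (univ N0) k. rl N (Inl r) xs \<longleftrightarrow> rl N0 r xs))"


section \<open>MS-measurability\<close>

definition Def_sets :: "('f, 'r) lang \<Rightarrow> ('f, 'r, 'a) struc \<Rightarrow> nat \<Rightarrow> 'a list set set" where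
  "Def_sets L N n = {solset N n \<phi> cs | \<phi> cs m. \<phi> \<in> formulas L (n + m) \<and> cs \<in> tuples (univ N) m}"

text \<open>The requirement \<open>X \<noteq> {}\<close> in the last clause avoids the maximum of the empty set; for \<open>X = {}\<close>
  the value \<open>(0, 0)\<close> is prescribed by the clause for finite sets.\<close>

definition MS_measurable ::
    "('f, 'r) lang \<Rightarrow> ('f, 'r, 'a) struc \<Rightarrow> ('a list set \<Rightarrow> nat \<times> real) \<Rightarrow> bool" where
  "MS_measurable L N h \<longleftrightarrow> infinite (univ N) \<and>
     (\<forall>n. \<forall>X\<in>Def_sets L N n. h X = (0, 0) \<or> snd (h X) > 0) \<and>
     (\<forall>n m. \<forall>\<phi>\<in>formulas L (n + m). \<exists>D. finite D \<and>
        (\<forall>as\<in>tuples (univ N) m. h (solset N n \<phi> as) \<in> D)) \<and>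
     (\<forall>n m. \<forall>\<phi>\<in>formulas L (n + m). \<forall>as\<in>tuples (univ N) m. finite (solset N n \<phi> as) \<longrightarrow>
        h (solset N n \<phi> as) = (0, real (card (solset N n \<phi> as)))) \<and>
     (\<forall>n m. \<forall>\<phi>\<in>formulas L (n + m). \<forall>d \<mu>. \<exists>\<psi>\<in>formulas L m.
        {as \<in> tuples (univ N) m. h (solset N n \<phi> as) = (d, \<mu>)} = solset N m \<psi> []) \<and>
     (\<forall>n k. \<forall>X\<in>Def_sets L N n. \<forall>Y\<in>Def_sets L N k. \<forall>f.
        X \<noteq> {} \<and> f ` X = Y \<and> {x @ f x | x. x \<in> X} \<in> Def_sets L N (n + k) \<longrightarrow>
        (let fib = (\<lambda>b. {x \<in> X. f x = b});
             D = (\<lambda>b. h (fib b)) ` Y;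
             Yd = (\<lambda>p. {b \<in> Y. h (fib b) = p})
         in fst (h X) = Max {fst p + fst (h (Yd p)) | p. p \<in> D} \<and>
            snd (h X) = (\<Sum>p | p \<in> D \<and> fst p + fst (h (Yd p)) = fst (h X).
                           snd p * snd (h (Yd p)))))"

text \<open>MS-measurability, via one function \<open>h\<close>, of the common complete theory of a class \<open>K\<close> of
  elementarily equivalent structures: each member is MS-measurable via \<open>h\<close>, and, as \<open>h\<close> belongs to
  the theory, the formula defining \<open>{a. h (\<phi>(N, a)) = (d, \<mu>)}\<close> depends only on \<open>\<phi>, d, \<mu>\<close>, not on
  \<open>N\<close>. One \<open>h\<close> can serve distinct members when their universes are disjoint: the only raw sets
  definable in two of them are \<open>{}\<close> and \<open>{[]}\<close>, where \<open>h\<close> is prescribed anyway.\<close>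

definition MS_measurable_theory ::
    "('f, 'r) lang \<Rightarrow> ('f, 'r, 'a) struc set \<Rightarrow> ('a list set \<Rightarrow> nat \<times> real) \<Rightarrow> bool" where
  "MS_measurable_theory L K h \<longleftrightarrow> (\<forall>N\<in>K. MS_measurable L N h) \<and>
     (\<forall>n m. \<forall>\<phi>\<in>formulas L (n + m). \<forall>d \<mu>. \<exists>\<psi>\<in>formulas L m. \<forall>N\<in>K.
        {as \<in> tuples (univ N) m. h (solset N n \<phi> as) = (d, \<mu>)} = solset N m \<psi> [])"

definition type_dim :: "('f, 'r) lang \<Rightarrow> ('f, 'r, 'a) struc \<Rightarrow> ('a list set \<Rightarrow> nat \<times> real) \<Rightarrow>
    'a list \<Rightarrow> 'a set \<Rightarrow> nat" where
  "type_dim L N h as C = fst (h (isolated_set L N as C))"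

definition type_meas :: "('f, 'r) lang \<Rightarrow> ('f, 'r, 'a) struc \<Rightarrow> ('a list set \<Rightarrow> nat \<times> real) \<Rightarrow>
    'a list \<Rightarrow> 'a set \<Rightarrow> real" where
  "type_meas L N h as C = snd (h (isolated_set L N as C))"


section \<open>Tree plans\<close>

definition tree_plan :: "nat list set \<Rightarrow> (nat list \<Rightarrow> enat) \<Rightarrow> bool" where
  "tree_plan \<Gamma> lam \<longleftrightarrow> finite \<Gamma> \<and> [] \<in> \<Gamma> \<and> (\<forall>\<sigma>\<in>\<Gamma>. \<forall>\<tau>. prefix \<tau> \<sigma> \<longrightarrow> \<tau> \<in> \<Gamma>) \<and>
     (\<forall>\<sigma>\<in>\<Gamma>. lam \<sigma> = 1 \<or> lam \<sigma> = \<infinity>) \<and> lam [] = 1"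

definition inf_nodes :: "nat list set \<Rightarrow> (nat list \<Rightarrow> enat) \<Rightarrow> nat list set" where
  "inf_nodes \<Gamma> lam = {\<sigma> \<in> \<Gamma>. lam \<sigma> = \<infinity>}"

text \<open>In an element of \<open>\<Gamma>(X)\<close> the symbol \<open>\<star>\<close> is \<open>None\<close>, and \<open>t \<in> X\<close> is \<open>Some t\<close>.\<close>

type_synonym 's node = "(nat \<times> 's option) list"

definition proj :: "'s node \<Rightarrow> nat list" where
  "proj a = map fst a"

definition nodes :: "nat list set \<Rightarrow> (nat list \<Rightarrow> enat) \<Rightarrow> 's set \<Rightarrow> 's node set" where
  "nodes \<Gamma> lam X = {a. proj a \<in> \<Gamma> \<and> (\<forall>k<length a.
     (lam (proj (take (Suc k) a)) = 1 \<longrightarrow> snd (a ! k) = None) \<and>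
     (lam (proj (take (Suc k) a)) = \<infinity> \<longrightarrow> snd (a ! k) \<in> Some ` X))}"

datatype tree_fun = Root | Meet | Pred
datatype tree_rel = Leq | At "nat list"

definition tree_lang :: "nat list set \<Rightarrow> (tree_fun, tree_rel) lang" where
  "tree_lang \<Gamma> = \<lparr>
     farity = (\<lambda>f. case f of Root \<Rightarrow> Some 0 | Meet \<Rightarrow> Some 2 | Pred \<Rightarrow> Some 1),
     rarity = (\<lambda>r. case r of Leq \<Rightarrow> Some 2 | At \<sigma> \<Rightarrow> if \<sigma> \<in> \<Gamma> then Some 1 else None)\<rparr>"

text \<open>Note \<open>butlast [] = []\<close>.\<close>

definition tree_struc :: "nat list set \<Rightarrow> (nat list \<Rightarrow> enat) \<Rightarrow> 's set \<Rightarrow>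
    (tree_fun, tree_rel, 's node) struc" where
  "tree_struc \<Gamma> lam X = \<lparr>
     univ = nodes \<Gamma> lam X,
     fn = (\<lambda>f xs. case f of Root \<Rightarrow> []
                    | Meet \<Rightarrow> longest_common_prefix (xs ! 0) (xs ! 1)
                    | Pred \<Rightarrow> butlast (xs ! 0)),
     rl = (\<lambda>r xs. case r of Leq \<Rightarrow> prefix (xs ! 0) (xs ! 1)
                    | At \<sigma> \<Rightarrow> proj (xs ! 0) = \<sigma>)\<rparr>"

primrec tcl_step :: "nat list set \<Rightarrow> (nat list \<Rightarrow> enat) \<Rightarrow> 's set \<Rightarrow> 's node set \<Rightarrow> nat \<Rightarrow>
    's node set" where
  "tcl_step \<Gamma> lam S B 0 = {[]} \<union> {a \<in> nodes \<Gamma> lam S. \<exists>b\<in>B. prefix a b}"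
| "tcl_step \<Gamma> lam S B (Suc n) = tcl_step \<Gamma> lam S B n \<union>
     {a \<in> nodes \<Gamma> lam S. lam (proj a) = 1 \<and> butlast a \<in> tcl_step \<Gamma> lam S B n}"

definition tcl :: "nat list set \<Rightarrow> (nat list \<Rightarrow> enat) \<Rightarrow> 's set \<Rightarrow> 's node set \<Rightarrow> 's node set" where
  "tcl \<Gamma> lam S B = (\<Union>n. tcl_step \<Gamma> lam S B n)"

text \<open>\<open>[a \<and> B]\<close>, the maximum being taken with respect to the initial-segment order.\<close>

definition branch :: "nat list set \<Rightarrow> (nat list \<Rightarrow> enat) \<Rightarrow> 's set \<Rightarrow> 's node \<Rightarrow> 's node set \<Rightarrow>
    's node" where
  "branch \<Gamma> lam S a B = (THE e. e \<in> tcl \<Gamma> lam S B \<and> prefix e a \<and>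
     (\<forall>e'\<in>tcl \<Gamma> lam S B. prefix e' a \<longrightarrow> prefix e' e))"

definition component :: "nat list set \<Rightarrow> (nat list \<Rightarrow> enat) \<Rightarrow> 's set \<Rightarrow> 's node \<Rightarrow> 's node set" where
  "component \<Gamma> lam S a = {a' \<in> nodes \<Gamma> lam S. butlast a' = butlast a \<and> proj a' = proj a}"


section \<open>Component structures and NIC structures\<close>

text \<open>\<open>comp_types\<close> is \<open>\<S>\<^sup>\<sigma>\<^sub>n\<close>, for \<open>n > 0\<close>; in a type \<open>p(x, y)\<close> the variable \<open>x\<close> is variable \<open>0\<close>.
  The relation symbol \<open>R\<^sub>p\<close>, for \<open>p \<in> \<S>\<^sup>\<sigma>\<^sub>n\<close>, is the pair \<open>(n, p)\<close>. The language \<open>\<L>\<^sub>\<sigma>\<close> has no function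
  symbols, so the type \<open>unit\<close> is only a placeholder.\<close>

definition comp_types :: "nat list set \<Rightarrow> (nat list \<Rightarrow> enat) \<Rightarrow> 's set \<Rightarrow>
    ('f, 'r) lang \<Rightarrow> ('f, 'r, 's node) struc \<Rightarrow> nat list \<Rightarrow> nat \<Rightarrow> ('f, 'r) fm set set" where
  "comp_types \<Gamma> lam S L M \<sigma> n = {tp L M (butlast a0 # a0 # as) | a0 as.
     a0 \<in> nodes \<Gamma> lam S \<and> proj a0 = \<sigma> \<and> set as \<subseteq> component \<Gamma> lam S a0 \<and> Suc (length as) = n}"

definition comp_lang :: "nat list set \<Rightarrow> (nat list \<Rightarrow> enat) \<Rightarrow> 's set \<Rightarrow>
    ('f, 'r) lang \<Rightarrow> ('f, 'r, 's node) struc \<Rightarrow> nat list \<Rightarrow>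
    (unit, nat \<times> ('f, 'r) fm set) lang" where
  "comp_lang \<Gamma> lam S L M \<sigma> = \<lparr>
     farity = (\<lambda>_. None),
     rarity = (\<lambda>(n, p). if n > 0 \<and> p \<in> comp_types \<Gamma> lam S L M \<sigma> n then Some n else None)\<rparr>"

definition comp_struc :: "nat list set \<Rightarrow> (nat list \<Rightarrow> enat) \<Rightarrow> 's set \<Rightarrow>
    ('f, 'r, 's node) struc \<Rightarrow> 's node \<Rightarrow>
    (unit, nat \<times> ('f, 'r) fm set, 's node) struc" where
  "comp_struc \<Gamma> lam S M e = \<lparr>
     univ = component \<Gamma> lam S e,
     fn = (\<lambda>_ _. undefined),
     rl = (\<lambda>(n, p) as. as \<in> tuples (component \<Gamma> lam S e) n \<and>
             (\<forall>\<phi>\<in>p. sat M (nth (butlast e # as)) \<phi>))\<rparr>"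

definition NIC :: "nat list set \<Rightarrow> (nat list \<Rightarrow> enat) \<Rightarrow> 's set \<Rightarrow>
    (tree_fun + 'f, tree_rel + 'r) lang \<Rightarrow>
    (tree_fun + 'f, tree_rel + 'r, 's node) struc \<Rightarrow> bool" where
  "NIC \<Gamma> lam S L M \<longleftrightarrow>
     is_expansion (tree_lang \<Gamma>) (tree_struc \<Gamma> lam S) L M \<and>
     (aleph0_categorical L M \<and> eliminates_quantifiers L M \<and>
        (\<forall>B\<subseteq>nodes \<Gamma> lam S. acl L M B = tcl \<Gamma> lam S B)) \<and>
     (\<forall>e\<in>nodes \<Gamma> lam S. \<forall>e'\<in>nodes \<Gamma> lam S.
        tp (tree_lang \<Gamma>) (tree_struc \<Gamma> lam S) [e'] = tp (tree_lang \<Gamma>) (tree_struc \<Gamma> lam S) [e] \<longrightarrow>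
        tp L M [e'] = tp L M [e]) \<and>
     (\<forall>C. finite C \<and> C \<subseteq> nodes \<Gamma> lam S \<longrightarrow>
        (\<forall>e\<in>nodes \<Gamma> lam S. proj e \<in> inf_nodes \<Gamma> lam \<longrightarrow>
           (\<forall>e'\<in>component \<Gamma> lam S e.
              tp_over (tree_lang \<Gamma>) (tree_struc \<Gamma> lam S) [e'] C
                = tp_over (tree_lang \<Gamma>) (tree_struc \<Gamma> lam S) [e] C \<and>
              tp_over (comp_lang \<Gamma> lam S L M (proj e)) (comp_struc \<Gamma> lam S M e) [e']
                  (tcl \<Gamma> lam S C \<inter> component \<Gamma> lam S e)
                = tp_over (comp_lang \<Gamma> lam S L M (proj e)) (comp_struc \<Gamma> lam S M e) [e]
                  (tcl \<Gamma> lam S C \<inter> component \<Gamma> lam S e) \<longrightarrow>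
              tp_over L M [e'] C = tp_over L M [e] C)))"

end

(* Proof idea. A Henkin construction gives the Ryll-Nardzewski theorem, so for M and for each of its
   components, types are orbits of an automorphism group and the definable sets are those invariant
   under the stabilizer of a finite set; formulas disappear from the argument from then on.
   For finite closed sets A <= B, let the value of B over A be the product, over all components K,
   of the (dimension, measure) pair of the type of B Int K over A Int K in K: dimensions add and
   measures multiply. Fubini inside each component makes this value multiplicative in towers
   A <= B <= C. Adding the infinity-nodes one at a time, nil interaction reduces the behaviour under
   enlarging the base A to finite additivity inside one component. Hence the sum of the leading terms
   of the values of the orbits in a definable set does not depend on the base over which the orbits
   are taken, and Fubini for this sum is distributivity of the leading-term semiring. *)

theory Submission
  imports Defs "HOL-Library.Countable_Set"
begin

section \<open>Isomorphisms, renaming of variables and definable sets\<close>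

text \<open>The group acting on the component of \<open>e\<close> is not the automorphism group of
  that component but the stabilizer of \<open>butlast e\<close> in the automorphisms of
  \<open>M\<close>. The relation symbols of a component are the types of tuples headed by
  \<open>butlast e\<close>, so they name exactly the orbits of this stabilizer; all groups thus sit
  inside one group, and nil interaction becomes an equality of two orbits of \<open>[e]\<close>.
  Automorphisms of \<open>M\<close> also carry components to one another. The measure respects this
  because the formulas that recognize its values are uniform over all components of one projection.
  Closed sets are the right arguments for values because a node with \<open>lam\<close> value 1 is
  determined by its predecessor and projection: a closed set grows only through infinity-nodes, each
  affecting one component. An infinite definable subset of a component of dimension 1 has dimension
  1 itself, so every new infinity-node counts 1, which is the dimension formula. The delicate point
  is a larger base, over which an orbit breaks into pieces of different dimensions, possibly single
  points. Additivity is proved for one node and carried to tuples by concatenation and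
  interdefinability.\<close>

definition iso ::
    "('f, 'r) lang \<Rightarrow> ('f, 'r, 'a) struc \<Rightarrow> ('f, 'r, 'b) struc \<Rightarrow> ('a \<Rightarrow> 'b) \<Rightarrow> bool" where
  "iso L N N' g \<longleftrightarrow> bij_betw g (univ N) (univ N') \<and>
     (\<forall>f k. farity L f = Some k \<longrightarrow>
        (\<forall>xs\<in>tuples (univ N) k. g (fn N f xs) = fn N' f (map g xs))) \<and>
     (\<forall>r k. rarity L r = Some k \<longrightarrow>
        (\<forall>xs\<in>tuples (univ N) k. rl N r xs \<longleftrightarrow> rl N' r (map g xs)))"

lemma tuples_Suc: "tuples A (Suc n) = {xs @ [a] | xs a. xs \<in> tuples A n \<and> a \<in> A}"
  by (auto simp: tuples_def length_Suc_conv_rev)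

lemma eval_tm_cong: "(\<And>i. i \<in> fv_tm t \<Longrightarrow> v i = w i) \<Longrightarrow> eval_tm N v t = eval_tm N w t"
proof (induction t)
  case (App f ts)
  have "map (eval_tm N v) ts = map (eval_tm N w) ts"
    using App by auto
  then show ?case by (metis eval_tm.simps(2))
qed auto

lemma sat_cong: "(\<And>i. i \<in> fv \<phi> \<Longrightarrow> v i = w i) \<Longrightarrow> sat N v \<phi> \<longleftrightarrow> sat N w \<phi>"
proof (induction \<phi> arbitrary: v w)
  case (Eq s t)
  then show ?case using eval_tm_cong[of s v w N] eval_tm_cong[of t v w N] by auto
next
  case (Rel r ts)
  have "map (eval_tm N v) ts = map (eval_tm N w) ts"
    using Rel by (auto intro!: eval_tm_cong)
  then show ?case by (metis sat.simps(3))
next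
  case (Conj \<phi> \<psi>)
  have "sat N v \<phi> = sat N w \<phi>"
    by (rule Conj.IH) (use Conj.prems in simp)
  moreover have "sat N v \<psi> = sat N w \<psi>"
    by (rule Conj.IH) (use Conj.prems in simp)
  ultimately show ?case by simp
next
  case (Exi i \<phi>)
  have "sat N (v(i := a)) \<phi> = sat N (w(i := a)) \<phi>" for a
    by (rule Exi.IH) (use Exi.prems in auto)
  then show ?case by simp
next
  case (Neg \<phi>)
  have "sat N v \<phi> = sat N w \<phi>"
    by (rule Neg.IH) (use Neg.prems in simp)
  then show ?case by simp
qed auto

lemma finite_fv_tm [simp]: "finite (fv_tm t)"
  by (induction t) auto

lemma finite_fv [simp]: "finite (fv \<phi>)"
  by (induction \<phi>) auto

text \<open>Only the values at free variables are constrained, here and for isomorphisms below,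
  because assignments \<open>nth xs\<close> are arbitrary beyond the length of
  \<open>xs\<close>.\<close>

lemma eval_tm_closed:
  assumes "is_struct L N"
  shows "wf_tm L t \<Longrightarrow> (\<And>i. i \<in> fv_tm t \<Longrightarrow> v i \<in> univ N) \<Longrightarrow> eval_tm N v t \<in> univ N"
proof (induction t)
  case (App f ts)
  have "map (eval_tm N v) ts \<in> tuples (univ N) (length ts)"
    using App by (auto simp: tuples_def)
  then show ?case using assms App.prems(1) by (auto simp: is_struct_def)
qed auto

lemma iso_eval_tm:
  assumes "is_struct L N" "iso L N N' g"
  shows "wf_tm L t \<Longrightarrow> (\<And>i. i \<in> fv_tm t \<Longrightarrow> v i \<in> univ N) \<Longrightarrow>
    eval_tm N' (\<lambda>j. g (v j)) t = g (eval_tm N v t)"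
proof (induction t)
  case (App f ts)
  have "eval_tm N v t \<in> univ N" if "t \<in> set ts" for t
    using App.prems that by (intro eval_tm_closed[OF assms(1)]) auto
  then have *: "map (eval_tm N v) ts \<in> tuples (univ N) (length ts)"
    by (auto simp: tuples_def)
  have "eval_tm N' (\<lambda>j. g (v j)) t = g (eval_tm N v t)" if "t \<in> set ts" for t
    by (rule App.IH[OF that]) (use App.prems that in auto)
  then have "map (eval_tm N' (\<lambda>j. g (v j))) ts = map g (map (eval_tm N v) ts)"
    by auto
  moreover have "g (fn N f (map (eval_tm N v) ts)) = fn N' f (map g (map (eval_tm N v) ts))"
    using * assms(2) App.prems(1) by (simp add: iso_def del: map_map)
  ultimately show ?case by (simp only: eval_tm.simps)
qed auto

lemma iso_sat:
  assumes N: "is_struct L N" and g: "iso L N N' g"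
  shows "wf_fm L \<phi> \<Longrightarrow> (\<And>i. i \<in> fv \<phi> \<Longrightarrow> v i \<in> univ N) \<Longrightarrow> sat N' (\<lambda>j. g (v j)) \<phi> \<longleftrightarrow> sat N v \<phi>"
proof (induction \<phi> arbitrary: v)
  case (Eq s t)
  have inj: "inj_on g (univ N)" using g by (auto simp: iso_def bij_betw_def)
  have "eval_tm N v s \<in> univ N" "eval_tm N v t \<in> univ N"
    using Eq by (auto intro!: eval_tm_closed[OF N])
  then show ?case
    using Eq iso_eval_tm[OF N g, of s v] iso_eval_tm[OF N g, of t v] inj
    by (simp add: inj_on_eq_iff)
next
  case (Rel r ts)
  have "eval_tm N v t \<in> univ N" if "t \<in> set ts" for t
    using Rel.prems that by (intro eval_tm_closed[OF N]) auto
  then have *: "map (eval_tm N v) ts \<in> tuples (univ N) (length ts)"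
    by (auto simp: tuples_def)
  have "eval_tm N' (\<lambda>j. g (v j)) t = g (eval_tm N v t)" if "t \<in> set ts" for t
    by (rule iso_eval_tm[OF N g]) (use Rel.prems that in auto)
  then have "map (eval_tm N' (\<lambda>j. g (v j))) ts = map g (map (eval_tm N v) ts)"
    by auto
  moreover have "rl N r (map (eval_tm N v) ts) = rl N' r (map g (map (eval_tm N v) ts))"
    using * g Rel.prems(1) by (simp add: iso_def del: map_map)
  ultimately show ?case by (simp only: sat.simps)
next
  case (Exi i \<phi>)
  have img: "g ` univ N = univ N'" using g by (auto simp: iso_def bij_betw_def)
  have "sat N' ((\<lambda>j. g (v j))(i := g a)) \<phi> = sat N (v(i := a)) \<phi>" if "a \<in> univ N" for a
  proof -
    have "(\<lambda>j. g (v j))(i := g a) = (\<lambda>j. g ((v(i := a)) j))" by auto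
    moreover have "sat N' (\<lambda>j. g ((v(i := a)) j)) \<phi> = sat N (v(i := a)) \<phi>"
      by (rule Exi.IH) (use Exi.prems that in auto)
    ultimately show ?thesis by simp
  qed
  then show ?case by (auto simp flip: img)
qed auto

lemma iso_sat_nth:
  assumes "is_struct L N" "iso L N N' g" "\<phi> \<in> formulas L n" "length xs = n" "set xs \<subseteq> univ N"
  shows "sat N' (nth (map g xs)) \<phi> \<longleftrightarrow> sat N (nth xs) \<phi>"
proof -
  have "sat N' (nth (map g xs)) \<phi> \<longleftrightarrow> sat N' (\<lambda>j. g (xs ! j)) \<phi>"
    using assms(3,4) by (intro sat_cong) (auto simp: formulas_def)
  also have "\<dots> \<longleftrightarrow> sat N (nth xs) \<phi>"
  proof (rule iso_sat[OF assms(1,2)])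
    show "wf_fm L \<phi>" using assms(3) by (auto simp: formulas_def)
    show "xs ! i \<in> univ N" if "i \<in> fv \<phi>" for i
      using that assms(3-5) by (force simp: formulas_def)
  qed
  finally show ?thesis .
qed

section \<open>Capture-avoiding substitution of variables, finite conjunctions and blocks of
  quantifiers\<close>

fun ren_tm :: "(nat \<Rightarrow> nat) \<Rightarrow> 'f tm \<Rightarrow> 'f tm" where
  "ren_tm s (Var i) = Var (s i)"
| "ren_tm s (App f ts) = App f (map (ren_tm s) ts)"

text \<open>The map \<open>s\<close> may identify variables, so a bound variable cannot simply be
  kept: it moves to one outside the images of the remaining free variables, which prevents
  capture.\<close>

fun ren :: "(nat \<Rightarrow> nat) \<Rightarrow> ('f, 'r) fm \<Rightarrow> ('f, 'r) fm" where
  "ren s Fls = Fls"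
| "ren s (Eq t u) = Eq (ren_tm s t) (ren_tm s u)"
| "ren s (Rel r ts) = Rel r (map (ren_tm s) ts)"
| "ren s (Neg \<phi>) = Neg (ren s \<phi>)"
| "ren s (Conj \<phi> \<psi>) = Conj (ren s \<phi>) (ren s \<psi>)"
| "ren s (Exi i \<phi>) = (let j = (SOME j. j \<notin> s ` (fv \<phi> - {i})) in Exi j (ren (s(i := j)) \<phi>))"

lemma fv_ren_tm [simp]: "fv_tm (ren_tm s t) = s ` fv_tm t"
  by (induction t) auto

lemma wf_ren_tm [simp]: "wf_tm L (ren_tm s t) = wf_tm L t"
  by (induction t) auto

lemma eval_ren_tm: "eval_tm N v (ren_tm s t) = eval_tm N (\<lambda>k. v (s k)) t"
proof (induction t)
  case (App f ts)
  then have "map (eval_tm N v) (map (ren_tm s) ts) = map (eval_tm N (\<lambda>k. v (s k))) ts"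
    by simp
  then show ?case by (simp only: ren_tm.simps eval_tm.simps)
qed auto

lemma fresh_var:
  fixes A :: "nat set"
  assumes "finite A"
  shows "(SOME j. j \<notin> A) \<notin> A"
  by (rule someI_ex[OF ex_new_if_finite[OF infinite_UNIV_nat assms]])

lemma fv_ren [simp]: "fv (ren s \<phi>) = s ` fv \<phi>"
proof (induction \<phi> arbitrary: s)
  case (Exi i \<phi>)
  define j where "j = (SOME j. j \<notin> s ` (fv \<phi> - {i}))"
  have "j \<notin> s ` (fv \<phi> - {i})" unfolding j_def by (rule fresh_var) simp
  then show ?case by (auto simp: Exi Let_def simp flip: j_def split: if_splits)
qed auto

lemma wf_ren [simp]: "wf_fm L (ren s \<phi>) = wf_fm L \<phi>"
  by (induction \<phi> arbitrary: s) (auto simp: Let_def)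

lemma sat_ren: "sat N v (ren s \<phi>) \<longleftrightarrow> sat N (\<lambda>k. v (s k)) \<phi>"
proof (induction \<phi> arbitrary: s v)
  case (Rel r ts)
  have "map (eval_tm N v) (map (ren_tm s) ts) = map (eval_tm N (\<lambda>k. v (s k))) ts"
    by (simp add: eval_ren_tm)
  then show ?case by (simp only: ren.simps sat.simps)
next
  case (Exi i \<phi>)
  define j where "j = (SOME j. j \<notin> s ` (fv \<phi> - {i}))"
  have j: "j \<notin> s ` (fv \<phi> - {i})" unfolding j_def by (rule fresh_var) simp
  have "sat N (\<lambda>k. (v(j := a)) ((s(i := j)) k)) \<phi> = sat N ((\<lambda>k. v (s k))(i := a)) \<phi>" for a
    by (rule sat_cong) (use j in auto)
  moreover have "sat N v (ren s (Exi i \<phi>)) \<longleftrightarrow> (\<exists>a\<in>univ N. sat N (\<lambda>k. (v(j := a)) ((s(i := j)) k)) \<phi>)"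
    by (simp only: ren.simps Let_def sat.simps Exi.IH flip: j_def)
  ultimately show ?case by (simp only: sat.simps)
qed (auto simp: eval_ren_tm)

fun conjs :: "('f, 'r) fm list \<Rightarrow> ('f, 'r) fm" where
  "conjs [] = Neg Fls"
| "conjs (\<phi> # \<phi>s) = Conj \<phi> (conjs \<phi>s)"

lemma sat_conjs [simp]: "sat N v (conjs \<phi>s) \<longleftrightarrow> (\<forall>\<phi>\<in>set \<phi>s. sat N v \<phi>)"
  by (induction \<phi>s) auto

lemma fv_conjs [simp]: "fv (conjs \<phi>s) = (\<Union>\<phi>\<in>set \<phi>s. fv \<phi>)"
  by (induction \<phi>s) auto

lemma wf_conjs [simp]: "wf_fm L (conjs \<phi>s) \<longleftrightarrow> (\<forall>\<phi>\<in>set \<phi>s. wf_fm L \<phi>)"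
  by (induction \<phi>s) auto

definition exis :: "nat list \<Rightarrow> ('f, 'r) fm \<Rightarrow> ('f, 'r) fm" where
  "exis is \<phi> = foldr Exi is \<phi>"

lemma fv_exis [simp]: "fv (exis is \<phi>) = fv \<phi> - set is"
  by (induction "is") (auto simp: exis_def)

lemma wf_exis [simp]: "wf_fm L (exis is \<phi>) = wf_fm L \<phi>"
  by (induction "is") (auto simp: exis_def)

lemma sat_exis:
  "sat N v (exis is \<phi>) \<longleftrightarrow>
    (\<exists>w. (\<forall>i. i \<notin> set is \<longrightarrow> w i = v i) \<and> w ` set is \<subseteq> univ N \<and> sat N w \<phi>)"
proof (induction "is" arbitrary: v)
  case Nil
  have "w = v" if "\<forall>i. w i = v i" for w using that by auto
  then show ?case by (auto simp: exis_def)
next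
  case (Cons i "is")
  have *: "sat N v (exis (i # is) \<phi>) \<longleftrightarrow> (\<exists>a\<in>univ N. sat N (v(i := a)) (exis is \<phi>))"
    by (simp add: exis_def)
  show ?case unfolding * Cons.IH
  proof safe
    fix a w
    assume *: "a \<in> univ N" "\<forall>j. j \<notin> set is \<longrightarrow> w j = (v(i := a)) j" "w ` set is \<subseteq> univ N" "sat N w \<phi>"
    \<comment> \<open>The variable \<open>i\<close> may occur again in \<open>is\<close>; then
      \<open>w i\<close> is the inner value and not \<open>a\<close>.\<close>
    have "w i \<in> univ N" using * by (cases "i \<in> set is") auto
    then show "\<exists>w. (\<forall>j. j \<notin> set (i # is) \<longrightarrow> w j = v j) \<and> w ` set (i # is) \<subseteq> univ N \<and> sat N w \<phi>"
      using * by (intro exI[of _ w]) auto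
  next
    fix w
    assume *: "\<forall>j. j \<notin> set (i # is) \<longrightarrow> w j = v j" "w ` set (i # is) \<subseteq> univ N" "sat N w \<phi>"
    show "\<exists>a\<in>univ N. \<exists>w. (\<forall>j. j \<notin> set is \<longrightarrow> w j = (v(i := a)) j) \<and> w ` set is \<subseteq> univ N \<and> sat N w \<phi>"
      using * by (intro bexI[of _ "w i"] exI[of _ w]) auto
  qed
qed

section \<open>Boolean operations and projections of sets definable without parameters\<close>

definition definable0 :: "('f, 'r) lang \<Rightarrow> ('f, 'r, 'a) struc \<Rightarrow> nat \<Rightarrow> 'a list set \<Rightarrow> bool" where
  "definable0 L N n X \<longleftrightarrow> (\<exists>\<phi>\<in>formulas L n. X = solset N n \<phi> [])"

lemma definable0_sub: "definable0 L N n X \<Longrightarrow> X \<subseteq> tuples (univ N) n"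
  by (auto simp: definable0_def solset_def)

lemma definable0_empty: "definable0 L N n {}"
  unfolding definable0_def by (rule bexI[of _ Fls]) (auto simp: solset_def formulas_def)

lemma definable0_compl: "definable0 L N n X \<Longrightarrow> definable0 L N n (tuples (univ N) n - X)"
  unfolding definable0_def
proof safe
  fix \<phi> assume "\<phi> \<in> formulas L n"
  then show "\<exists>\<phi>'\<in>formulas L n. tuples (univ N) n - solset N n \<phi> [] = solset N n \<phi>' []"
    by (intro bexI[of _ "Neg \<phi>"]) (auto simp: solset_def formulas_def)
qed

lemma definable0_Int: "definable0 L N n X \<Longrightarrow> definable0 L N n Y \<Longrightarrow> definable0 L N n (X \<inter> Y)"
  unfolding definable0_def
proof safe
  fix \<phi> \<psi> assume "\<phi> \<in> formulas L n" "\<psi> \<in> formulas L n"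
  then show "\<exists>\<phi>'\<in>formulas L n. solset N n \<phi> [] \<inter> solset N n \<psi> [] = solset N n \<phi>' []"
    by (intro bexI[of _ "Conj \<phi> \<psi>"]) (auto simp: solset_def formulas_def)
qed

lemma definable0_Un:
  assumes "definable0 L N n X" "definable0 L N n Y"
  shows "definable0 L N n (X \<union> Y)"
proof -
  have "X \<union> Y = tuples (univ N) n - (tuples (univ N) n - X) \<inter> (tuples (univ N) n - Y)"
    using assms[THEN definable0_sub] by auto
  then show ?thesis using assms by (metis definable0_Int definable0_compl)
qed

lemma definable0_Union:
  "finite Q \<Longrightarrow> (\<And>X. X \<in> Q \<Longrightarrow> definable0 L N n X) \<Longrightarrow> definable0 L N n (\<Union>Q)"
  by (induction rule: finite_induct) (auto intro: definable0_empty definable0_Un)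

text \<open>This becomes the extension step of back-and-forth: whether a tuple can be prolonged into
  a definable set is again a definable property.\<close>

lemma definable0_project:
  assumes "definable0 L N (Suc n) X"
  shows "definable0 L N n {xs \<in> tuples (univ N) n. \<exists>a\<in>univ N. xs @ [a] \<in> X}"
proof -
  obtain \<phi> where \<phi>: "\<phi> \<in> formulas L (Suc n)" "X = solset N (Suc n) \<phi> []"
    using assms by (auto simp: definable0_def)
  have "Exi n \<phi> \<in> formulas L n" using \<phi>(1) by (auto simp: formulas_def less_Suc_eq)
  moreover have "{xs \<in> tuples (univ N) n. \<exists>a\<in>univ N. xs @ [a] \<in> X} = solset N n (Exi n \<phi>) []"
  proof -
    have "sat N ((nth xs)(n := a)) \<phi> = sat N (nth (xs @ [a])) \<phi>"
      if "xs \<in> tuples (univ N) n" for xs a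
      using that \<phi>(1) by (intro sat_cong) (auto simp: formulas_def tuples_def nth_append less_Suc_eq)
    then show ?thesis by (auto simp: solset_def \<phi>(2) tuples_Suc)
  qed
  ultimately show ?thesis by (auto simp: definable0_def)
qed

section \<open>The Ryll-Nardzewski theorem\<close>

instance tm :: (countable) countable
  by countable_datatype

instance fm :: (countable, countable) countable
  by countable_datatype

lemma wf_tm_set: "wf_tm L t \<Longrightarrow> set_tm t \<subseteq> dom (farity L)"
  by (induction t) auto

lemma wf_fm_set: "wf_fm L \<phi> \<Longrightarrow> set1_fm \<phi> \<subseteq> dom (farity L) \<and> set2_fm \<phi> \<subseteq> dom (rarity L)"
  by (induction \<phi>) (use wf_tm_set in fastforce)+

text \<open>The symbol types may be uncountable; only the symbols with an arity are countably many.
  Every formula is therefore recovered from its translation into formulas over \<open>nat\<close>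
  symbols, which form a countable type.\<close>

lemma countable_wf_fm:
  assumes "countable (dom (farity L))" "countable (dom (rarity L))"
  shows "countable {\<phi>. wf_fm L \<phi>}"
proof -
  let ?F = "dom (farity L)" and ?R = "dom (rarity L)"
  let ?c = "map_fm (to_nat_on ?F) (to_nat_on ?R)" and ?d = "map_fm (from_nat_into ?F) (from_nat_into ?R)"
  have "\<phi> \<in> range ?d" if "wf_fm L \<phi>" for \<phi>
  proof -
    have "?d (?c \<phi>) = map_fm id id \<phi>"
      unfolding fm.map_comp
      by (rule fm.map_cong0) (use wf_fm_set[OF that] assms in
          \<open>auto simp: from_nat_into_to_nat_on subset_iff simp del: dom_def domIff\<close>)
    then have "\<phi> = ?d (?c \<phi>)" by (simp add: fm.map_id)
    then show ?thesis by blast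
  qed
  then have "{\<phi>. wf_fm L \<phi>} \<subseteq> range ?d" by blast
  then show ?thesis by (rule countable_subset) simp
qed

text \<open>The Rasiowa-Sikorski argument: step number \<open>k\<close> enters the
  \<open>k\<close>-th dense set of an enumeration. It serves twice, for the Henkin filter and for
  back-and-forth.\<close>

lemma generic_sequence:
  assumes "countable DD"
    and refl: "\<And>p. R p p" and trans: "\<And>p q r. R p q \<Longrightarrow> R q r \<Longrightarrow> R p r"
    and dense: "\<And>D p. D \<in> DD \<Longrightarrow> P p \<Longrightarrow> \<exists>q. P q \<and> R p q \<and> q \<in> D"
    and "P p0"
  obtains q :: "nat \<Rightarrow> 'p" where
    "\<And>k. P (q k)" "\<And>j k. j \<le> k \<Longrightarrow> R (q j) (q k)" "\<And>D. D \<in> DD \<Longrightarrow> \<exists>k. q k \<in> D"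
proof (cases "DD = {}")
  case True
  then show ?thesis using that[of "\<lambda>_. p0"] refl \<open>P p0\<close> by auto
next
  case False
  have "\<exists>q. P (q (0::nat)) \<and> (\<forall>k. P (q (Suc k)) \<and> (R (q k) (q (Suc k)) \<and> q (Suc k) \<in> from_nat_into DD k))"
    using dependent_nat_choice[of "\<lambda>_. P" "\<lambda>k p q. R p q \<and> q \<in> from_nat_into DD k"]
      dense[OF from_nat_into[OF False]] \<open>P p0\<close> by metis
  then obtain q where q: "P (q 0)" "\<And>k. P (q (Suc k))" "\<And>k. R (q k) (q (Suc k))"
    "\<And>k. q (Suc k) \<in> from_nat_into DD k" by auto
  have P: "P (q k)" for k using q(1,2) by (cases k) auto
  have R: "R (q j) (q k)" if "j \<le> k" for j k
    using that by (induction rule: dec_induct) (auto intro: refl trans q(3))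
  have "\<exists>k. q k \<in> D" if "D \<in> DD" for D
    using q(4) from_nat_into_surj[OF assms(1) that] by metis
  with P R that show ?thesis by blast
qed

text \<open>A Henkin construction in which the finitely many variables of the formulas chosen so far
  play the role of the constants: the truth values are the limits of the truth values in \<open>N\<close>
  along a filter of assignments.\<close>

definition henkin_filter ::
    "('f, 'r) lang \<Rightarrow> ('f, 'r, 'a) struc \<Rightarrow> (nat \<Rightarrow> 'a) filter \<Rightarrow> bool" where
  "henkin_filter L N F \<longleftrightarrow> F \<noteq> bot \<and> eventually (\<lambda>v. range v \<subseteq> univ N) F \<and>
     (\<forall>\<phi> s. wf_fm L \<phi> \<longrightarrow> eventually (\<lambda>v. sat N (\<lambda>i. v (s i)) \<phi>) F \<or>
        eventually (\<lambda>v. \<not> sat N (\<lambda>i. v (s i)) \<phi>) F) \<and>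
     (\<forall>\<phi> i s. wf_fm L \<phi> \<longrightarrow> eventually (\<lambda>v. sat N (\<lambda>i. v (s i)) (Exi i \<phi>)) F \<longrightarrow>
        (\<exists>j. eventually (\<lambda>v. sat N (\<lambda>k. v ((s(i := j)) k)) \<phi>) F))"

text \<open>The term model whose terms are just variables, two of them being identified if they
  eventually agree. The filter decides formulas and has witnesses, so truth is proved by an
  induction in the manner of the Los theorem.\<close>

lemma henkin_model:
  fixes N :: "('f, 'r, 'a) struc"
  assumes N: "is_struct L N" and F: "henkin_filter L N F"
  obtains N' :: "('f, 'r, nat) struc" and e :: "nat \<Rightarrow> nat" where
    "is_struct L N'" "univ N' = range e"
    "\<And>\<phi> s. wf_fm L \<phi> \<Longrightarrow> sat N' (\<lambda>i. e (s i)) \<phi> \<longleftrightarrow> eventually (\<lambda>v. sat N (\<lambda>i. v (s i)) \<phi>) F"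
proof -
  have bot: "F \<noteq> bot" and ran: "eventually (\<lambda>v. range v \<subseteq> univ N) F"
    and dec: "\<And>\<phi> s. wf_fm L \<phi> \<Longrightarrow> eventually (\<lambda>v. sat N (\<lambda>i. v (s i)) \<phi>) F \<or>
        eventually (\<lambda>v. \<not> sat N (\<lambda>i. v (s i)) \<phi>) F"
    and wit: "\<And>\<phi> i s. wf_fm L \<phi> \<Longrightarrow> eventually (\<lambda>v. sat N (\<lambda>i. v (s i)) (Exi i \<phi>)) F \<Longrightarrow>
        \<exists>j. eventually (\<lambda>v. sat N (\<lambda>k. v ((s(i := j)) k)) \<phi>) F"
    using F by (auto simp: henkin_filter_def)
  define E where "E i j \<longleftrightarrow> eventually (\<lambda>v. v i = v j) F" for i j
  have E_refl: "E i i" for i by (simp add: E_def)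
  have E_trans: "E i k" if "E i j" "E j k" for i j k
    using that unfolding E_def by eventually_elim simp
  have E_sym: "E j i" if "E i j" for i j
    using that unfolding E_def by eventually_elim simp
  \<comment> \<open>Each class is represented by its least variable, so the universe is a set of
    natural numbers, as \<open>aleph0_categorical\<close> demands.\<close>
  define e where "e i = (LEAST j. E i j)" for i
  have E_e: "E i (e i)" for i unfolding e_def by (rule LeastI[of _ i]) (rule E_refl)
  have e_eq: "e i = e j \<longleftrightarrow> E i j" for i j
  proof
    assume "e i = e j" then show "E i j" using E_e[of i] E_e[of j] E_sym E_trans by metis
  next
    assume "E i j" then have "E i = E j" using E_sym E_trans by blast
    then show "e i = e j" by (simp add: e_def)
  qed
  have e_e: "e (e i) = e i" for i using E_e[of i] E_sym by (simp add: e_eq)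
  define N' :: "('f, 'r, nat) struc" where "N' = \<lparr>univ = range e,
     fn = (\<lambda>f xs. e (SOME j. eventually (\<lambda>v. v j = fn N f (map v xs)) F)),
     rl = (\<lambda>r xs. eventually (\<lambda>v. rl N r (map v xs)) F)\<rparr>"
  have univ': "univ N' = range e" by (simp add: N'_def)
  have struct: "is_struct L N'"
    by (auto simp: is_struct_def N'_def)
  \<comment> \<open>The model must be closed under functions: the witness property for the formula
    saying that some element equals \<open>f\<close> of the arguments names the value by a
    variable.\<close>
  have fn_wit: "eventually (\<lambda>v. v (fn N' f xs) = fn N f (map v xs)) F"
    if f: "farity L f = Some (length xs)" for f xs
  proof -
    let ?n = "length xs" and ?s = "(nth xs)(length xs := 0)"
    let ?\<phi> = "Eq (Var ?n) (App f (map Var [0..<?n])) :: ('f, 'r) fm"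
    have arg: "map (eval_tm N (\<lambda>k. v ((s(?n := j)) k))) (map Var [0..<?n]) = map v xs"
      if "\<And>k. k < ?n \<Longrightarrow> s k = xs ! k" for v :: "nat \<Rightarrow> 'a" and s :: "nat \<Rightarrow> nat" and j
      by (rule nth_equalityI) (use that in auto)
    have "eventually (\<lambda>v. sat N (\<lambda>i. v (?s i)) (Exi ?n ?\<phi>)) F"
      using ran
    proof eventually_elim
      case (elim v)
      have arg': "map (eval_tm N ((\<lambda>i. v (?s i))(?n := a))) (map Var [0..<?n]) = map v xs" for a
        by (rule nth_equalityI) auto
      have "map v xs \<in> tuples (univ N) ?n" using elim by (auto simp: tuples_def)
      then have "fn N f (map v xs) \<in> univ N" using N f by (auto simp: is_struct_def)
      then show ?case
        by (simp only: sat.simps eval_tm.simps arg') auto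
    qed
    moreover have "wf_fm L ?\<phi>" using f by simp
    ultimately obtain j where "eventually (\<lambda>v. sat N (\<lambda>k. v ((?s(?n := j)) k)) ?\<phi>) F"
      using wit by blast
    then have "eventually (\<lambda>v. v j = fn N f (map v xs)) F"
    proof eventually_elim
      case (elim v)
      have "map (eval_tm N (\<lambda>k. v ((?s(?n := j)) k))) (map Var [0..<?n]) = map v xs"
        by (rule arg) auto
      with elim show ?case by (simp only: sat.simps eval_tm.simps) simp
    qed
    define j0 where "j0 = (SOME j. eventually (\<lambda>v. v j = fn N f (map v xs)) F)"
    have "eventually (\<lambda>v. v j0 = fn N f (map v xs)) F"
      unfolding j0_def by (rule someI) fact
    with E_e[of j0, unfolded E_def] have "eventually (\<lambda>v. v (e j0) = fn N f (map v xs)) F"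
      by eventually_elim simp
    then show ?thesis by (simp add: N'_def flip: j0_def)
  qed
  have ev_tm: "eventually (\<lambda>v. v (eval_tm N' (\<lambda>i. e (s i)) t) = eval_tm N (\<lambda>i. v (s i)) t) F"
    if "wf_tm L t" for s t
    using that
  proof (induction t)
    case (Var i)
    then show ?case using E_e[of "s i", unfolded E_def] by (simp add: eq_commute)
  next
    case (App f ts)
    have "eventually (\<lambda>v. \<forall>t\<in>set ts. v (eval_tm N' (\<lambda>i. e (s i)) t) = eval_tm N (\<lambda>i. v (s i)) t) F"
      using App by (intro eventually_ball_finite) auto
    with fn_wit[of f "map (eval_tm N' (\<lambda>i. e (s i))) ts"] App.prems
    have "eventually (\<lambda>v. (\<forall>t\<in>set ts. v (eval_tm N' (\<lambda>i. e (s i)) t) = eval_tm N (\<lambda>i. v (s i)) t) \<and>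
      v (fn N' f (map (eval_tm N' (\<lambda>i. e (s i))) ts)) =
        fn N f (map v (map (eval_tm N' (\<lambda>i. e (s i))) ts))) F"
      by (intro eventually_conj) simp_all
    then show ?case
    proof eventually_elim
      case (elim v)
      have "map v (map (eval_tm N' (\<lambda>i. e (s i))) ts) = map (eval_tm N (\<lambda>i. v (s i))) ts"
        using elim by simp
      with elim show ?case by (simp only: eval_tm.simps)
    qed
  qed
  have tm_range: "eval_tm N' (\<lambda>i. e (s i)) t \<in> range e" if "wf_tm L t" for s t
    using eval_tm_closed[OF struct that] univ' by auto
  have truth: "sat N' (\<lambda>i. e (s i)) \<phi> \<longleftrightarrow> eventually (\<lambda>v. sat N (\<lambda>i. v (s i)) \<phi>) F"
    if "wf_fm L \<phi>" for \<phi> s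
    using that
  proof (induction \<phi> arbitrary: s)
    case Fls
    then show ?case using bot by (simp add: eventually_False)
  next
    case (Eq t u)
    let ?t = "eval_tm N' (\<lambda>i. e (s i)) t" and ?u = "eval_tm N' (\<lambda>i. e (s i)) u"
    have "?t = ?u \<longleftrightarrow> E ?t ?u"
      using tm_range[of t s] tm_range[of u s] Eq by (auto simp: e_e simp flip: e_eq)
    also have "\<dots> \<longleftrightarrow> eventually (\<lambda>v. sat N (\<lambda>i. v (s i)) (Eq t u)) F"
      unfolding E_def using ev_tm[of t s] ev_tm[of u s] Eq
      by (intro eventually_subst) (auto elim: eventually_elim2)
    finally show ?case by simp
  next
    case (Rel r ts)
    have "eventually (\<lambda>v. \<forall>t\<in>set ts. v (eval_tm N' (\<lambda>i. e (s i)) t) = eval_tm N (\<lambda>i. v (s i)) t) F"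
      using Rel ev_tm by (intro eventually_ball_finite) auto
    then have "eventually (\<lambda>v. rl N r (map v (map (eval_tm N' (\<lambda>i. e (s i))) ts)) \<longleftrightarrow>
        sat N (\<lambda>i. v (s i)) (Rel r ts)) F"
    proof eventually_elim
      case (elim v)
      have "map v (map (eval_tm N' (\<lambda>i. e (s i))) ts) = map (eval_tm N (\<lambda>i. v (s i))) ts"
        using elim by simp
      then show ?case by (simp only: sat.simps)
    qed
    then have "eventually (\<lambda>v. rl N r (map v (map (eval_tm N' (\<lambda>i. e (s i))) ts))) F \<longleftrightarrow>
        eventually (\<lambda>v. sat N (\<lambda>i. v (s i)) (Rel r ts)) F"
      by (rule eventually_subst)
    then show ?case by (simp add: N'_def del: map_map)
  next
    case (Neg \<phi>)
    \<comment> \<open>Decidedness gives one direction and properness of the filter the other; this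
      is the ultrafilter step.\<close>
    have "\<not> eventually (\<lambda>v. sat N (\<lambda>i. v (s i)) \<phi>) F \<longleftrightarrow> eventually (\<lambda>v. \<not> sat N (\<lambda>i. v (s i)) \<phi>) F"
    proof
      assume 1: "eventually (\<lambda>v. \<not> sat N (\<lambda>i. v (s i)) \<phi>) F"
      show "\<not> eventually (\<lambda>v. sat N (\<lambda>i. v (s i)) \<phi>) F"
      proof
        assume "eventually (\<lambda>v. sat N (\<lambda>i. v (s i)) \<phi>) F"
        with 1 have "eventually (\<lambda>_. False) F" by eventually_elim simp
        with bot show False by (simp add: eventually_False)
      qed
    qed (use dec Neg.prems in auto)
    with Neg show ?case by simp
  next
    case (Conj \<phi> \<psi>)
    then show ?case by (simp add: eventually_conj_iff)
  next
    case (Exi i \<phi>)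
    have upd: "(\<lambda>k. g (s k))(i := g j) = (\<lambda>k. g ((s(i := j)) k))" for g :: "nat \<Rightarrow> 'b" and j
      by auto
    have "sat N' (\<lambda>k. e (s k)) (Exi i \<phi>) \<longleftrightarrow> (\<exists>j. sat N' (\<lambda>k. e ((s(i := j)) k)) \<phi>)"
    proof -
      have "sat N' ((\<lambda>k. e (s k))(i := e j)) \<phi> = sat N' (\<lambda>k. e ((s(i := j)) k)) \<phi>" for j
        by (rule arg_cong[where f = "\<lambda>v. sat N' v \<phi>"]) auto
      then show ?thesis by (simp add: univ' del: fun_upd_apply)
    qed
    also have "\<dots> \<longleftrightarrow> (\<exists>j. eventually (\<lambda>v. sat N (\<lambda>k. v ((s(i := j)) k)) \<phi>) F)"
      using Exi by (simp del: fun_upd_apply)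
    also have "\<dots> \<longleftrightarrow> eventually (\<lambda>v. sat N (\<lambda>k. v (s k)) (Exi i \<phi>)) F"
    proof safe
      fix j assume "eventually (\<lambda>v. sat N (\<lambda>k. v ((s(i := j)) k)) \<phi>) F"
      with ran show "eventually (\<lambda>v. sat N (\<lambda>k. v (s k)) (Exi i \<phi>)) F"
      proof eventually_elim
        case (elim v)
        have "(\<lambda>k. v (s k))(i := v j) = (\<lambda>k. v ((s(i := j)) k))" by auto
        with elim have "sat N ((\<lambda>k. v (s k))(i := v j)) \<phi>" "v j \<in> univ N" by (auto simp del: fun_upd_apply)
        then show ?case unfolding sat.simps by (rule bexI)
      qed
    next
      assume "eventually (\<lambda>v. sat N (\<lambda>k. v (s k)) (Exi i \<phi>)) F"
      then show "\<exists>j. eventually (\<lambda>v. sat N (\<lambda>k. v ((s(i := j)) k)) \<phi>) F"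
        using wit Exi.prems by auto
    qed
    finally show ?case .
  qed
  show ?thesis by (rule that[OF struct univ' truth])
qed

section \<open>Construction of the Henkin filter by forcing with formulas\<close>

definition asgs :: "('f, 'r, 'a) struc \<Rightarrow> ('f, 'r) fm \<Rightarrow> (nat \<Rightarrow> 'a) set" where
  "asgs N \<theta> = {v. range v \<subseteq> univ N \<and> sat N v \<theta>}"

text \<open>These are the forcing conditions, finite approximations to the filter that keep all of
  \<open>\<Sigma>\<close> possible. A condition is stronger when its \<open>asgs\<close> is
  smaller.\<close>

definition compat :: "('f, 'r) lang \<Rightarrow> ('f, 'r, 'a) struc \<Rightarrow> ('f, 'r) fm set \<Rightarrow> ('f, 'r) fm \<Rightarrow> bool" where
  "compat L N \<Sigma> \<theta> \<longleftrightarrow> wf_fm L \<theta> \<and>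
     (\<forall>Fs. finite Fs \<and> Fs \<subseteq> \<Sigma> \<longrightarrow> (\<exists>v\<in>asgs N \<theta>. \<forall>\<phi>\<in>Fs. sat N v \<phi>))"

text \<open>Substitutions coded by finite lists, so that there are only countably many requirements.
  On the finitely many free variables of a formula every substitution agrees with one of these; the
  value 0 beyond the list is a filler.\<close>

definition sub :: "nat list \<Rightarrow> nat \<Rightarrow> nat" where
  "sub l i = (if i < length l then l ! i else 0)"

text \<open>If both extensions fail, the union of the two refuting finite parts of
  \<open>\<Sigma>\<close> refutes \<open>\<theta>\<close> itself.\<close>

lemma compat_decide:
  assumes "compat L N \<Sigma> \<theta>" "wf_fm L \<psi>"
  shows "compat L N \<Sigma> (Conj \<theta> \<psi>) \<or> compat L N \<Sigma> (Conj \<theta> (Neg \<psi>))"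
proof (rule ccontr)
  assume "\<not> ?thesis"
  then obtain F1 F2 where F: "finite F1" "F1 \<subseteq> \<Sigma>" "finite F2" "F2 \<subseteq> \<Sigma>"
    "\<not> (\<exists>v\<in>asgs N (Conj \<theta> \<psi>). \<forall>\<phi>\<in>F1. sat N v \<phi>)"
    "\<not> (\<exists>v\<in>asgs N (Conj \<theta> (Neg \<psi>)). \<forall>\<phi>\<in>F2. sat N v \<phi>)"
    using assms by (auto simp: compat_def)
  moreover have "finite (F1 \<union> F2) \<and> F1 \<union> F2 \<subseteq> \<Sigma>" using F by auto
  then obtain v where "v \<in> asgs N \<theta>" "\<forall>\<phi>\<in>F1 \<union> F2. sat N v \<phi>"
    using assms(1) unfolding compat_def by blast
  ultimately show False by (cases "sat N v \<psi>") (auto simp: asgs_def)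
qed

text \<open>The variable \<open>j\<close> is chosen fresh for \<open>\<theta>\<close>, for the
  substituted \<open>\<phi>\<close> and for \<open>\<Sigma>\<close>, whose variables are below
  \<open>n\<close>; an assignment can then be changed at \<open>j\<close> to the witness without
  disturbing anything else.\<close>

lemma compat_witness:
  assumes "compat L N \<Sigma> \<theta>" "wf_fm L \<phi>" "\<Sigma> \<subseteq> formulas L n"
    and "asgs N \<theta> \<subseteq> {v. sat N (\<lambda>k. v (s k)) (Exi i \<phi>)}"
  shows "\<exists>j. compat L N \<Sigma> (Conj \<theta> (ren (s(i := j)) \<phi>))"
proof -
  define A where "A = fv \<theta> \<union> s ` fv \<phi> \<union> {..<n}"
  have "finite A" by (simp add: A_def)
  then obtain j where j: "j \<notin> A" using ex_new_if_finite[OF infinite_UNIV_nat] by blast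
  have "\<exists>v\<in>asgs N (Conj \<theta> (ren (s(i := j)) \<phi>)). \<forall>\<psi>\<in>Fs. sat N v \<psi>"
    if Fs: "finite Fs" "Fs \<subseteq> \<Sigma>" for Fs
  proof -
    obtain v where v: "v \<in> asgs N \<theta>" "\<forall>\<psi>\<in>Fs. sat N v \<psi>"
      using assms(1) Fs unfolding compat_def by blast
    then obtain a where a: "a \<in> univ N" "sat N ((\<lambda>k. v (s k))(i := a)) \<phi>"
      using assms(4) by (auto simp del: fun_upd_apply)
    let ?v = "v(j := a)"
    have "sat N ?v \<theta> = sat N v \<theta>" by (rule sat_cong) (use j in \<open>auto simp: A_def\<close>)
    moreover have "sat N ?v \<psi> = sat N v \<psi>" if "\<psi> \<in> Fs" for \<psi>
    proof (rule sat_cong)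
      fix k assume "k \<in> fv \<psi>"
      then have "k < n" using that Fs assms(3) by (auto simp: formulas_def)
      then show "?v k = v k" using j by (auto simp: A_def)
    qed
    moreover have "sat N (\<lambda>k. ?v ((s(i := j)) k)) \<phi> = sat N ((\<lambda>k. v (s k))(i := a)) \<phi>"
      by (rule sat_cong) (use j in \<open>auto simp: A_def\<close>)
    moreover have "range ?v \<subseteq> univ N" using v(1) a(1) by (auto simp: asgs_def)
    ultimately have "?v \<in> asgs N (Conj \<theta> (ren (s(i := j)) \<phi>))" "\<forall>\<psi>\<in>Fs. sat N ?v \<psi>"
      using v a by (auto simp: asgs_def sat_ren simp del: fun_upd_apply)
    then show ?thesis by blast
  qed
  then show ?thesis using assms(1,2) by (auto simp: compat_def)
qed

text \<open>A generic chain of conditions meets three kinds of dense sets: deciding a formula,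
  providing a witness, and the members of the extra family \<open>EE\<close>. The last kind is the
  room left for omitting a type. The filter is generated by the sets \<open>asgs\<close> along the
  chain.\<close>

lemma henkin_filter_exists:
  assumes N: "is_struct L N"
    and count: "countable (dom (farity L))" "countable (dom (rarity L))"
    and \<Sigma>: "\<Sigma> \<subseteq> formulas L n"
      "\<And>Fs. finite Fs \<Longrightarrow> Fs \<subseteq> \<Sigma> \<Longrightarrow> \<exists>xs\<in>tuples (univ N) n. \<forall>\<phi>\<in>Fs. sat N (nth xs) \<phi>"
    and EE: "countable EE"
      "\<And>E \<theta>. E \<in> EE \<Longrightarrow> compat L N \<Sigma> \<theta> \<Longrightarrow> \<exists>\<theta>'\<in>E. compat L N \<Sigma> \<theta>' \<and> asgs N \<theta>' \<subseteq> asgs N \<theta>"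
  obtains F where "henkin_filter L N F" "\<And>\<phi>. \<phi> \<in> \<Sigma> \<Longrightarrow> eventually (\<lambda>v. sat N v \<phi>) F"
    "\<And>E. E \<in> EE \<Longrightarrow> \<exists>\<theta>\<in>E. eventually (\<lambda>v. v \<in> asgs N \<theta>) F"
proof -
  define Dec where "Dec = (\<lambda>(\<phi>, l). {\<theta>. asgs N \<theta> \<subseteq> {v. sat N (\<lambda>i. v (sub l i)) \<phi>} \<or>
     asgs N \<theta> \<subseteq> {v. \<not> sat N (\<lambda>i. v (sub l i)) \<phi>}})"
  define Wit where "Wit = (\<lambda>(\<phi>, i, l). {\<theta>. asgs N \<theta> \<subseteq> {v. \<not> sat N (\<lambda>i. v (sub l i)) (Exi i \<phi>)} \<or>
     (\<exists>j. asgs N \<theta> \<subseteq> {v. sat N (\<lambda>k. v (((sub l)(i := j)) k)) \<phi>})})"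
  let ?W = "{\<phi>. wf_fm L \<phi>}"
  define DD where "DD = Dec ` (?W \<times> UNIV) \<union> Wit ` (?W \<times> UNIV \<times> UNIV) \<union> EE"
  have cDD: "countable DD"
    unfolding DD_def using EE(1) countable_wf_fm[OF count]
    by (intro countable_Un countable_image countable_SIGMA) auto
  define R where "R \<theta> \<theta>' \<longleftrightarrow> asgs N \<theta>' \<subseteq> asgs N \<theta>" for \<theta> \<theta>'
  have dec: "\<exists>\<theta>'. compat L N \<Sigma> \<theta>' \<and> R \<theta> \<theta>' \<and> \<theta>' \<in> Dec (\<phi>, l)"
    if "compat L N \<Sigma> \<theta>" "wf_fm L \<phi>" for \<theta> \<phi> l
    using compat_decide[OF that(1), of "ren (sub l) \<phi>"] that(2)
    by (auto simp: R_def Dec_def asgs_def sat_ren simp del: fun_upd_apply)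
  have dense: "\<exists>\<theta>'. compat L N \<Sigma> \<theta>' \<and> R \<theta> \<theta>' \<and> \<theta>' \<in> D"
    if "D \<in> DD" and \<theta>: "compat L N \<Sigma> \<theta>" for D \<theta>
  proof -
    consider \<phi> l where "wf_fm L \<phi>" "D = Dec (\<phi>, l)"
      | \<phi> i l where "wf_fm L \<phi>" "D = Wit (\<phi>, i, l)" | "D \<in> EE"
      using \<open>D \<in> DD\<close> by (auto simp: DD_def)
    then show ?thesis
    proof cases
      case 1
      then show ?thesis using dec \<theta> by blast
    next
      case 2
      \<comment> \<open>The existential formula is decided first; a witness must be added only after
        a positive decision.\<close>
      obtain \<theta>' where \<theta>': "compat L N \<Sigma> \<theta>'" "R \<theta> \<theta>'" "\<theta>' \<in> Dec (Exi i \<phi>, l)"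
        using dec[OF \<theta>, of "Exi i \<phi>" l] 2(1) by auto
      show ?thesis
      proof (cases "asgs N \<theta>' \<subseteq> {v. sat N (\<lambda>k. v (sub l k)) (Exi i \<phi>)}")
        case True
        then obtain j where j: "compat L N \<Sigma> (Conj \<theta>' (ren ((sub l)(i := j)) \<phi>))"
          using compat_witness[OF \<theta>'(1) 2(1) \<Sigma>(1)] by blast
        moreover have "asgs N (Conj \<theta>' (ren ((sub l)(i := j)) \<phi>)) \<subseteq> asgs N \<theta>'"
          "asgs N (Conj \<theta>' (ren ((sub l)(i := j)) \<phi>)) \<subseteq> {v. sat N (\<lambda>k. v (((sub l)(i := j)) k)) \<phi>}"
          by (auto simp: asgs_def sat_ren simp del: fun_upd_apply)
        ultimately show ?thesis
          unfolding 2(2) Wit_def using \<theta>'(2) by (auto simp: R_def simp del: fun_upd_apply)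
      next
        case False
        then have "asgs N \<theta>' \<subseteq> {v. \<not> sat N (\<lambda>k. v (sub l k)) (Exi i \<phi>)}"
          using \<theta>'(3) by (auto simp: Dec_def simp del: sat.simps)
        then have "\<theta>' \<in> D" unfolding 2(2) Wit_def by (simp del: sat.simps)
        then show ?thesis using \<theta>' by blast
      qed
    next
      case 3
      then show ?thesis using EE(2)[OF _ \<theta>] unfolding R_def by blast
    qed
  qed
  \<comment> \<open>A padding value that turns a tuple into a total assignment with values in the
    universe.\<close>
  obtain u0 where u0: "u0 \<in> univ N" using N by (auto simp: is_struct_def)
  have ext: "sat N (nth xs) \<phi> = sat N (\<lambda>i. if i < n then xs ! i else u0) \<phi>" if "\<phi> \<in> \<Sigma>" for xs \<phi>
    by (rule sat_cong) (use that \<Sigma>(1) in \<open>auto simp: formulas_def\<close>)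
  have c0: "compat L N \<Sigma> (Neg Fls)"
    unfolding compat_def
  proof (intro conjI allI impI)
    fix Fs assume Fs: "finite Fs \<and> Fs \<subseteq> \<Sigma>"
    then obtain xs where xs: "xs \<in> tuples (univ N) n" "\<forall>\<phi>\<in>Fs. sat N (nth xs) \<phi>"
      using \<Sigma>(2) by blast
    then show "\<exists>v\<in>asgs N (Neg Fls). \<forall>\<phi>\<in>Fs. sat N v \<phi>"
      using ext Fs u0
      by (intro bexI[of _ "\<lambda>i. if i < n then xs ! i else u0"]) (auto simp: asgs_def tuples_def subset_iff)
  qed auto
  obtain q :: "nat \<Rightarrow> _" where q: "\<And>k. compat L N \<Sigma> (q k)" "\<And>j k. j \<le> k \<Longrightarrow> R (q j) (q k)"
    "\<And>D. D \<in> DD \<Longrightarrow> \<exists>k. q k \<in> D"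
  proof (rule generic_sequence[of DD R "compat L N \<Sigma>" "Neg Fls"])
    show "R p r" if "R p q" "R q r" for p q r using that by (auto simp: R_def)
  qed (use cDD dense c0 in \<open>auto simp: R_def\<close>)
  define F where "F = (INF k. principal (asgs N (q k)))"
  have ev: "eventually Q F \<longleftrightarrow> (\<exists>k. asgs N (q k) \<subseteq> {v. Q v})" for Q
  proof -
    have "\<exists>x\<in>UNIV. principal (asgs N (q x)) \<le> inf (principal (asgs N (q a))) (principal (asgs N (q b)))"
      for a b
      using q(2)[of a "max a b"] q(2)[of b "max a b"] by (intro bexI[of _ "max a b"]) (auto simp: R_def)
    then show ?thesis
      unfolding F_def by (subst eventually_INF_base) (auto simp: eventually_principal)
  qed
  have subs: "\<exists>l. \<forall>i\<in>fv \<phi>. s i = sub l i" for s and \<phi> :: "('a, 'b) fm"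
  proof -
    obtain m where m: "fv \<phi> \<subseteq> {..<m}" using finite_nat_iff_bounded[of "fv \<phi>"] by auto
    then show ?thesis by (intro exI[of _ "map s [0..<m]"]) (auto simp: sub_def)
  qed
  have ne: "asgs N (q k) \<noteq> {}" for k using q(1)[of k] by (auto simp: compat_def)
  have D: "eventually (\<lambda>v. sat N (\<lambda>i. v (s i)) \<phi>) F \<or> eventually (\<lambda>v. \<not> sat N (\<lambda>i. v (s i)) \<phi>) F"
    if "wf_fm L \<phi>" for \<phi> s
  proof -
    obtain l where l: "\<forall>i\<in>fv \<phi>. s i = sub l i" using subs by blast
    have "Dec (\<phi>, l) \<in> DD" using that by (auto simp: DD_def)
    then obtain k where "q k \<in> Dec (\<phi>, l)" using q(3) by blast
    moreover have "sat N (\<lambda>i. v (s i)) \<phi> = sat N (\<lambda>i. v (sub l i)) \<phi>" for v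
      by (rule sat_cong) (use l in auto)
    ultimately show ?thesis by (auto simp: ev Dec_def)
  qed
  have W: "\<exists>j. eventually (\<lambda>v. sat N (\<lambda>k. v ((s(i := j)) k)) \<phi>) F"
    if "wf_fm L \<phi>" and E: "eventually (\<lambda>v. sat N (\<lambda>i. v (s i)) (Exi i \<phi>)) F" for \<phi> i s
  proof -
    obtain l where l: "\<forall>i\<in>fv \<phi>. s i = sub l i" using subs by blast
    have "Wit (\<phi>, i, l) \<in> DD" using that by (auto simp: DD_def)
    then obtain k where k: "q k \<in> Wit (\<phi>, i, l)" using q(3) by blast
    have "sat N (\<lambda>i. v (s i)) (Exi i \<phi>) = sat N (\<lambda>i. v (sub l i)) (Exi i \<phi>)" for v
      by (rule sat_cong) (use l in auto)
    with E obtain k' where k': "asgs N (q k') \<subseteq> {v. sat N (\<lambda>i. v (sub l i)) (Exi i \<phi>)}"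
      by (auto simp: ev simp del: sat.simps)
    \<comment> \<open>A common refinement of \<open>q k\<close> and \<open>q k'\<close> is
      satisfiable, which rules out the negative alternative in \<open>Wit\<close>.\<close>
    obtain v where "v \<in> asgs N (q (max k k'))" using ne by blast
    then have "v \<in> asgs N (q k)" "v \<in> asgs N (q k')"
      using q(2)[of k "max k k'"] q(2)[of k' "max k k'"] by (auto simp: R_def)
    with k k' obtain j where "asgs N (q k) \<subseteq> {v. sat N (\<lambda>k. v (((sub l)(i := j)) k)) \<phi>}"
      unfolding Wit_def by (auto simp del: sat.simps fun_upd_apply)
    moreover have "sat N (\<lambda>k. v ((s(i := j)) k)) \<phi> = sat N (\<lambda>k. v (((sub l)(i := j)) k)) \<phi>" for v
      by (rule sat_cong) (use l in auto)
    ultimately show ?thesis by (auto simp: ev simp del: fun_upd_apply)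
  qed
  have hf: "henkin_filter L N F"
    unfolding henkin_filter_def
  proof (intro conjI allI impI)
    show "F \<noteq> bot" using ne by (auto simp: ev simp flip: eventually_False)
    show "eventually (\<lambda>v. range v \<subseteq> univ N) F" by (auto simp: ev asgs_def)
  qed (use D W in blast)+
  have "eventually (\<lambda>v. sat N v \<phi>) F" if "\<phi> \<in> \<Sigma>" for \<phi>
  proof (rule ccontr)
    assume "\<not> ?thesis"
    moreover have "wf_fm L \<phi>" using that \<Sigma>(1) by (auto simp: formulas_def)
    ultimately have "eventually (\<lambda>v. \<not> sat N v \<phi>) F" using D[of \<phi> "\<lambda>i. i"] by auto
    then obtain k where "asgs N (q k) \<subseteq> {v. \<not> sat N v \<phi>}" by (auto simp: ev)
    moreover have "\<exists>v\<in>asgs N (q k). \<forall>\<psi>\<in>{\<phi>}. sat N v \<psi>"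
      using q(1)[of k] that unfolding compat_def by blast
    ultimately show False by auto
  qed
  moreover have "\<exists>\<theta>\<in>E. eventually (\<lambda>v. v \<in> asgs N \<theta>) F" if "E \<in> EE" for E
    using q(3)[of E] that by (auto simp: DD_def ev)
  ultimately show ?thesis using that hf by blast
qed

text \<open>Categoricity enters here: the term model is elementarily equivalent to \<open>N\<close>
  and infinite, hence a copy of \<open>N\<close>, and in this copy every element is named by a
  variable.\<close>

lemma henkin_copy:
  assumes cat: "aleph0_categorical L N" and N: "is_struct L N" and F: "henkin_filter L N F"
  obtains N' :: "('f, 'r, nat) struc" and e g where
    "iso L N N' g" "univ N' = range e"
    "\<And>\<phi> s. wf_fm L \<phi> \<Longrightarrow> sat N' (\<lambda>i. e (s i)) \<phi> \<longleftrightarrow> eventually (\<lambda>v. sat N (\<lambda>i. v (s i)) \<phi>) F"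
proof -
  obtain N' :: "('f, 'r, nat) struc" and e where N': "is_struct L N'" "univ N' = range e"
    and truth: "\<And>\<phi> s. wf_fm L \<phi> \<Longrightarrow> sat N' (\<lambda>i. e (s i)) \<phi> \<longleftrightarrow> eventually (\<lambda>v. sat N (\<lambda>i. v (s i)) \<phi>) F"
    using henkin_model[OF N F] by metis
  have "F \<noteq> bot" using F by (auto simp: henkin_filter_def)
  have sent: "sat N' (nth []) \<phi> \<longleftrightarrow> sat N (nth []) \<phi>" if "\<phi> \<in> formulas L 0" for \<phi>
  proof -
    have "sat N' (nth []) \<phi> \<longleftrightarrow> sat N' (\<lambda>i. e ((\<lambda>_. 0) i)) \<phi>"
      by (rule sat_cong) (use that in \<open>auto simp: formulas_def\<close>)
    also have "\<dots> \<longleftrightarrow> eventually (\<lambda>v. sat N (\<lambda>i. v ((\<lambda>_. 0) i)) \<phi>) F"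
      using that by (intro truth) (auto simp: formulas_def)
    also have "(\<lambda>v. sat N (\<lambda>i. v ((\<lambda>_. 0) i)) \<phi>) = (\<lambda>v. sat N (nth []) \<phi>)"
      by (rule ext, rule sat_cong) (use that in \<open>auto simp: formulas_def\<close>)
    also have "eventually \<dots> F \<longleftrightarrow> sat N (nth []) \<phi>" using \<open>F \<noteq> bot\<close> by simp
    finally show ?thesis .
  qed
  have "infinite (univ N')"
  proof
    assume fin: "finite (univ N')"
    \<comment> \<open>One more than the supposed finite size; the sentence \<open>\<phi>\<close>
      below asserts that there are at least \<open>k\<close> distinct elements and holds in
      \<open>N\<close>.\<close>
    define k where "k = Suc (card (univ N'))"
    define \<phi> :: "('f, 'r) fm" where "\<phi> = exis [0..<k]
      (conjs [Neg (Eq (Var i) (Var j)). i \<leftarrow> [0..<k], j \<leftarrow> [0..<i]])"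
    have \<phi>: "\<phi> \<in> formulas L 0" by (auto simp: \<phi>_def formulas_def)
    have sat_\<phi>: "sat K v \<phi> \<longleftrightarrow> (\<exists>w. (\<forall>i\<ge>k. w i = v i) \<and> w ` {0..<k} \<subseteq> univ K \<and> inj_on w {0..<k})"
      for K :: "('f, 'r, 'c) struc" and v
    proof -
      have "inj_on w {0..<k} \<longleftrightarrow> (\<forall>i\<in>{0..<k}. \<forall>j\<in>{0..<i}. w i \<noteq> w j)" for w :: "nat \<Rightarrow> 'c"
      proof
        assume *: "\<forall>i\<in>{0..<k}. \<forall>j\<in>{0..<i}. w i \<noteq> w j"
        have "w i \<noteq> w j" if "i < j" "j < k" for i j using *[rule_format, of j i] that by auto
        then show "inj_on w {0..<k}" by (intro linorder_inj_onI) auto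
      next
        assume "inj_on w {0..<k}"
        then show "\<forall>i\<in>{0..<k}. \<forall>j\<in>{0..<i}. w i \<noteq> w j"
          by (metis atLeastLessThan_iff inj_onD less_irrefl less_trans zero_le)
      qed
      then show ?thesis by (auto simp: \<phi>_def sat_exis not_less)
    qed
    obtain T where T: "T \<subseteq> univ N" "card T = k" "finite T"
      using cat infinite_arbitrarily_large[of "univ N" k] by (auto simp: aleph0_categorical_def)
    then obtain f where f: "bij_betw f {0..<k} T" using ex_bij_betw_nat_finite by metis
    have "sat N (nth []) \<phi>"
      unfolding sat_\<phi>
      \<comment> \<open>Outside the quantified variables the assignment has to agree literally with
        \<open>nth []\<close>.\<close>
      by (rule exI[of _ "\<lambda>i. if i < k then f i else [] ! i"])
        (use f T in \<open>auto simp: bij_betw_def inj_on_def\<close>)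
    then have "sat N' (nth []) \<phi>" using sent \<phi> by simp
    then obtain w where "w ` {0..<k} \<subseteq> univ N'" "inj_on w {0..<k}" by (auto simp: sat_\<phi>)
    then have "card {0..<k} \<le> card (univ N')" by (intro card_inj_on_le[OF _ _ fin])
    then show False by (simp add: k_def)
  qed
  then have "isomorphic L N N'"
    using cat N'(1) sent unfolding aleph0_categorical_def elem_equiv_def by blast
  then obtain g where "iso L N N' g" by (auto simp: isomorphic_def iso_def)
  with N'(2) truth that show ?thesis by blast
qed

text \<open>The core of omitting types: a condition that forces all of \<open>\<Sigma>\<close> at
  the variables \<open>l\<close> yields one formula below all of \<open>\<Sigma>\<close>, by
  quantifying away everything but those variables.\<close>

lemma omitting_step:
  assumes N: "is_struct L N" and \<Sigma>: "\<Sigma> \<subseteq> formulas L n" and l: "length l = n"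
    and \<theta>: "wf_fm L \<theta>" "asgs N \<theta> \<noteq> {}"
    and all: "\<And>\<phi>. \<phi> \<in> \<Sigma> \<Longrightarrow> asgs N \<theta> \<subseteq> {v. sat N (\<lambda>i. v (sub l i)) \<phi>}"
  shows "\<exists>\<chi>\<in>formulas L n. solset N n \<chi> [] \<noteq> {} \<and> (\<forall>\<phi>\<in>\<Sigma>. solset N n \<chi> [] \<subseteq> solset N n \<phi> [])"
proof -
  obtain u0 where u0: "u0 \<in> univ N" using N by (auto simp: is_struct_def)
  have "finite (fv \<theta> \<union> set l)" by simp
  then obtain K where K: "fv \<theta> \<union> set l \<subseteq> {..<K}" using finite_nat_iff_bounded by blast
  have lK: "l ! i < K" if "i < n" for i using that K l nth_mem by fastforce
  \<comment> \<open>The variables of \<open>\<theta>\<close> are shifted past \<open>n\<close>, tied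
    to the entries of the tuple by equations, and then quantified.\<close>
  define \<chi> where "\<chi> = exis [n..<n + K] (Conj (ren (\<lambda>i. n + i) \<theta>)
    (conjs (map (\<lambda>i. Eq (Var i) (Var (n + l ! i))) [0..<n])))"
  have \<chi>: "\<chi> \<in> formulas L n"
    using \<theta>(1) K lK by (auto simp: \<chi>_def formulas_def subset_iff)
  have sat_\<chi>: "sat N x \<chi> \<longleftrightarrow> (\<exists>w. (\<forall>i. i \<notin> {n..<n + K} \<longrightarrow> w i = x i) \<and> w ` {n..<n + K} \<subseteq> univ N \<and>
      sat N (\<lambda>i. w (n + i)) \<theta> \<and> (\<forall>i<n. w i = w (n + l ! i)))" for x
    by (auto simp: \<chi>_def sat_exis sat_ren)
  have "solset N n \<chi> [] \<subseteq> solset N n \<phi> []" if \<phi>: "\<phi> \<in> \<Sigma>" for \<phi>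
  proof
    fix xs assume "xs \<in> solset N n \<chi> []"
    then have xs: "xs \<in> tuples (univ N) n" "sat N (nth xs) \<chi>" by (auto simp: solset_def)
    then obtain w where w: "\<forall>i. i \<notin> {n..<n + K} \<longrightarrow> w i = xs ! i" "w ` {n..<n + K} \<subseteq> univ N"
      "sat N (\<lambda>i. w (n + i)) \<theta>" "\<forall>i<n. w i = w (n + l ! i)" by (auto simp: sat_\<chi>)
    define v where "v i = (if i < K then w (n + i) else u0)" for i
    have "sat N v \<theta> = sat N (\<lambda>i. w (n + i)) \<theta>"
      by (rule sat_cong) (use K in \<open>auto simp: v_def\<close>)
    moreover have "range v \<subseteq> univ N" using w(2) u0 by (auto simp: v_def)
    ultimately have "v \<in> asgs N \<theta>" using w(3) by (simp add: asgs_def)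
    then have "sat N (\<lambda>i. v (sub l i)) \<phi>" using all[OF \<phi>] by blast
    moreover have "sat N (\<lambda>i. v (sub l i)) \<phi> = sat N (nth xs) \<phi>"
    proof (rule sat_cong)
      fix i assume "i \<in> fv \<phi>"
      then have "i < n" using \<phi> \<Sigma> by (auto simp: formulas_def)
      then have "v (sub l i) = w (n + l ! i)" using lK l by (simp add: v_def sub_def)
      also have "\<dots> = w i" using w(4) \<open>i < n\<close> by simp
      also have "\<dots> = xs ! i" using w(1) \<open>i < n\<close> by simp
      finally show "v (sub l i) = xs ! i" .
    qed
    ultimately show "xs \<in> solset N n \<phi> []" using xs(1) by (simp add: solset_def)
  qed
  moreover have "solset N n \<chi> [] \<noteq> {}"
  proof -
    obtain v where v: "range v \<subseteq> univ N" "sat N v \<theta>" using \<theta>(2) by (auto simp: asgs_def)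
    let ?xs = "map (\<lambda>i. v (l ! i)) [0..<n]"
    let ?w = "\<lambda>i. if n \<le> i \<and> i < n + K then v (i - n) else ?xs ! i"
    have "sat N (\<lambda>i. ?w (n + i)) \<theta> = sat N v \<theta>"
      by (rule sat_cong) (use K in auto)
    then have "sat N (nth ?xs) \<chi>"
      unfolding sat_\<chi> using v lK by (intro exI[of _ ?w]) auto
    then have "?xs \<in> solset N n \<chi> []" using v(1) by (auto simp: solset_def tuples_def)
    then show ?thesis by blast
  qed
  ultimately show ?thesis using \<chi> by blast
qed

text \<open>Realizing against omitting: finite satisfiability gives a Henkin copy of
  \<open>N\<close> that realizes \<open>\<Sigma>\<close>, and without a formula below
  \<open>\<Sigma>\<close> a second copy omits it. Both copies are isomorphic to \<open>N\<close>, a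
  contradiction.\<close>

lemma rn_lower_bound:
  assumes cat: "aleph0_categorical L N" and N: "is_struct L N"
    and \<Sigma>: "\<Sigma> \<subseteq> formulas L n"
      "\<And>Fs. finite Fs \<Longrightarrow> Fs \<subseteq> \<Sigma> \<Longrightarrow> \<exists>xs\<in>tuples (univ N) n. \<forall>\<phi>\<in>Fs. sat N (nth xs) \<phi>"
  shows "\<exists>\<chi>\<in>formulas L n. solset N n \<chi> [] \<noteq> {} \<and> (\<forall>\<phi>\<in>\<Sigma>. solset N n \<chi> [] \<subseteq> solset N n \<phi> [])"
proof (rule ccontr)
  assume no: "\<not> ?thesis"
  have count: "countable (dom (farity L))" "countable (dom (rarity L))"
    using cat by (auto simp: aleph0_categorical_def)
  obtain a where a: "a \<in> tuples (univ N) n" "\<And>\<phi>. \<phi> \<in> \<Sigma> \<Longrightarrow> sat N (nth a) \<phi>"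
  proof -
    obtain F where F: "henkin_filter L N F" "\<And>\<phi>. \<phi> \<in> \<Sigma> \<Longrightarrow> eventually (\<lambda>v. sat N v \<phi>) F"
      using henkin_filter_exists[OF N count \<Sigma>, of "{}"] by auto
    obtain N1 :: "('a, 'b, nat) struc" and e g where g: "iso L N N1 g" "univ N1 = range e"
      and truth: "\<And>\<phi> s. wf_fm L \<phi> \<Longrightarrow> sat N1 (\<lambda>i. e (s i)) \<phi> \<longleftrightarrow> eventually (\<lambda>v. sat N (\<lambda>i. v (s i)) \<phi>) F"
      by (rule henkin_copy[OF cat N F(1)]) (rule that)
    have bij: "bij_betw g (univ N) (range e)" using g by (auto simp: iso_def)
    define a where "a = map (\<lambda>i. inv_into (univ N) g (e i)) [0..<n]"
    have "inv_into (univ N) g (e i) \<in> univ N" "g (inv_into (univ N) g (e i)) = e i" for i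
      using bij by (auto simp: bij_betw_def inv_into_into f_inv_into_f)
    then have a: "a \<in> tuples (univ N) n" "map g a = map e [0..<n]"
      by (auto simp: a_def tuples_def)
    have "sat N (nth a) \<phi>" if "\<phi> \<in> \<Sigma>" for \<phi>
    proof -
      have \<phi>: "\<phi> \<in> formulas L n" using that \<Sigma>(1) by blast
      have "sat N (nth a) \<phi> = sat N1 (nth (map g a)) \<phi>"
        using iso_sat_nth[OF N g(1) \<phi>] a(1) by (auto simp: tuples_def)
      also have "\<dots> = sat N1 (\<lambda>i. e ((\<lambda>i. i) i)) \<phi>"
        unfolding a(2) by (rule sat_cong) (use \<phi> in \<open>auto simp: formulas_def\<close>)
      also have "\<dots>" using truth[of \<phi> "\<lambda>i. i"] F(2)[OF that] \<phi> by (auto simp: formulas_def)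
      finally show ?thesis by simp
    qed
    with a(1) that show ?thesis by blast
  qed
  \<comment> \<open>The conditions that prevent the tuple named by \<open>l\<close> from realizing
    \<open>\<Sigma>\<close>. They are dense by \<open>omitting_step\<close>, and there are countably
    many lists \<open>l\<close>.\<close>
  define E where "E l = {\<theta> :: ('a, 'b) fm. \<exists>\<phi>\<in>\<Sigma>. asgs N \<theta> \<inter> {v. sat N (\<lambda>i. v (sub l i)) \<phi>} = {}}" for l
  have dense: "\<exists>\<theta>'\<in>E l. compat L N {} \<theta>' \<and> asgs N \<theta>' \<subseteq> asgs N \<theta>"
    if l: "length l = n" and c: "compat L N {} \<theta>" for l \<theta>
  proof -
    have \<theta>: "wf_fm L \<theta>" "asgs N \<theta> \<noteq> {}" using c by (auto simp: compat_def)
    then obtain \<phi> where \<phi>: "\<phi> \<in> \<Sigma>" "\<not> asgs N \<theta> \<subseteq> {v. sat N (\<lambda>i. v (sub l i)) \<phi>}"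
      using omitting_step[OF N \<Sigma>(1) l \<theta>] no by blast
    let ?\<theta> = "Conj \<theta> (Neg (ren (sub l) \<phi>))"
    have "asgs N ?\<theta> = asgs N \<theta> - {v. sat N (\<lambda>i. v (sub l i)) \<phi>}"
      by (auto simp: asgs_def sat_ren)
    moreover have "wf_fm L ?\<theta>" using \<theta> \<phi>(1) \<Sigma>(1) by (auto simp: formulas_def)
    ultimately show ?thesis using \<phi> by (intro bexI[of _ ?\<theta>]) (auto simp: compat_def E_def)
  qed
  obtain F where F: "henkin_filter L N F"
    "\<And>l. length l = n \<Longrightarrow> \<exists>\<theta>\<in>E l. eventually (\<lambda>v. v \<in> asgs N \<theta>) F"
  proof (rule henkin_filter_exists[OF N count, of "{}" n "E ` {l. length l = n}"])
    show "\<exists>xs\<in>tuples (univ N) n. \<forall>\<phi>\<in>Fs. sat N (nth xs) \<phi>" if "Fs \<subseteq> {}" for Fs :: "('a, 'b) fm set"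
      using a(1) that by blast
  qed (use dense in auto)
  obtain N2 :: "('a, 'b, nat) struc" and e g where g: "iso L N N2 g" "univ N2 = range e"
    and truth: "\<And>\<phi> s. wf_fm L \<phi> \<Longrightarrow> sat N2 (\<lambda>i. e (s i)) \<phi> \<longleftrightarrow> eventually (\<lambda>v. sat N (\<lambda>i. v (s i)) \<phi>) F"
    by (rule henkin_copy[OF cat N F(1)]) (rule that)
  \<comment> \<open>All elements of the copy are named, so the realization \<open>a\<close> is
    carried to a tuple named by some list, at which the filter has refuted a formula of
    \<open>\<Sigma>\<close>.\<close>
  have "\<exists>j. g (a ! i) = e j" if "i < n" for i
  proof -
    have "a ! i \<in> univ N" using a(1) that by (auto simp: tuples_def)
    then have "g (a ! i) \<in> range e" using g by (auto simp: iso_def bij_betw_def)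
    then show ?thesis by auto
  qed
  then obtain l' where l': "\<And>i. i < n \<Longrightarrow> g (a ! i) = e (l' i)" by metis
  define l where "l = map l' [0..<n]"
  obtain \<theta> where \<theta>: "\<theta> \<in> E l" "eventually (\<lambda>v. v \<in> asgs N \<theta>) F" using F(2)[of l] by (auto simp: l_def)
  then obtain \<phi> where \<phi>: "\<phi> \<in> \<Sigma>" "asgs N \<theta> \<inter> {v. sat N (\<lambda>i. v (sub l i)) \<phi>} = {}" by (auto simp: E_def)
  have \<phi>': "\<phi> \<in> formulas L n" using \<phi>(1) \<Sigma>(1) by blast
  have "sat N2 (nth (map g a)) \<phi>"
    using iso_sat_nth[OF N g(1) \<phi>'] a(1) a(2)[OF \<phi>(1)] by (auto simp: tuples_def)
  moreover have "sat N2 (nth (map g a)) \<phi> = sat N2 (\<lambda>i. e (sub l i)) \<phi>"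
    by (rule sat_cong) (use \<phi>' l' a(1) in \<open>auto simp: formulas_def l_def sub_def tuples_def\<close>)
  ultimately have "eventually (\<lambda>v. sat N (\<lambda>i. v (sub l i)) \<phi>) F"
    using truth[of \<phi> "sub l"] \<phi>' by (auto simp: formulas_def)
  with \<theta>(2) have "eventually (\<lambda>_. False) F"
    by eventually_elim (use \<phi>(2) in blast)
  with F(1) show False by (auto simp: henkin_filter_def eventually_False)
qed

section \<open>Finitely many types, each isolated\<close>

definition atom :: "('f, 'r) lang \<Rightarrow> ('f, 'r, 'a) struc \<Rightarrow> nat \<Rightarrow> 'a list set \<Rightarrow> bool" where
  "atom L N n X \<longleftrightarrow> definable0 L N n X \<and> X \<noteq> {} \<and>
     (\<forall>Y. definable0 L N n Y \<and> Y \<subseteq> X \<longrightarrow> Y = {} \<or> Y = X)"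

lemma solset_definable0: "\<phi> \<in> formulas L n \<Longrightarrow> definable0 L N n (solset N n \<phi> [])"
  by (auto simp: definable0_def)

text \<open>If no finite family of atoms covers all tuples, the complements of their finite unions
  are finitely satisfiable and so have a common nonempty definable lower bound. A point of it lies
  in an atom of its own, and the complement of that atom is one of the sets that should contain the
  point.\<close>

lemma rn_finite_atoms:
  assumes cat: "aleph0_categorical L N" and N: "is_struct L N"
  shows "\<exists>Q. finite Q \<and> (\<forall>X\<in>Q. atom L N n X) \<and> \<Union>Q = tuples (univ N) n"
proof (rule ccontr)
  assume no: "\<not> ?thesis"
  let ?U = "tuples (univ N) n"
  let ?Q = "\<lambda>Q. finite Q \<and> (\<forall>X\<in>Q. atom L N n X)"
  define \<Sigma> where "\<Sigma> = {\<phi> \<in> formulas L n. \<exists>Q. ?Q Q \<and> solset N n \<phi> [] = ?U - \<Union>Q}"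
  have sub: "\<Union>Q \<subseteq> ?U" if "?Q Q" for Q
    using that definable0_sub unfolding atom_def by blast
  have "\<exists>\<chi>\<in>formulas L n. solset N n \<chi> [] \<noteq> {} \<and> (\<forall>\<phi>\<in>\<Sigma>. solset N n \<chi> [] \<subseteq> solset N n \<phi> [])"
  proof (rule rn_lower_bound[OF cat N])
    fix Fs assume Fs: "finite Fs" "Fs \<subseteq> \<Sigma>"
    then have "\<forall>\<phi>\<in>Fs. \<exists>Q. ?Q Q \<and> solset N n \<phi> [] = ?U - \<Union>Q" by (auto simp: \<Sigma>_def)
    then obtain q where q: "\<And>\<phi>. \<phi> \<in> Fs \<Longrightarrow> ?Q (q \<phi>)" "\<And>\<phi>. \<phi> \<in> Fs \<Longrightarrow> solset N n \<phi> [] = ?U - \<Union>(q \<phi>)"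
      by metis
    have Q: "?Q (\<Union>(q ` Fs))" using Fs q(1) by auto
    then have "\<Union>(\<Union>(q ` Fs)) \<noteq> ?U" using no by blast
    with sub[OF Q] obtain x where x: "x \<in> ?U" "x \<notin> \<Union>(\<Union>(q ` Fs))" by blast
    have "sat N (nth x) \<phi>" if "\<phi> \<in> Fs" for \<phi>
    proof -
      have "x \<in> solset N n \<phi> []" using q(2)[OF that] x that by blast
      then show ?thesis by (simp add: solset_def)
    qed
    with x(1) show "\<exists>xs\<in>?U. \<forall>\<phi>\<in>Fs. sat N (nth xs) \<phi>" by blast
  qed (auto simp: \<Sigma>_def)
  then obtain \<chi> where \<chi>: "\<chi> \<in> formulas L n" "solset N n \<chi> [] \<noteq> {}"
    "\<And>\<phi>. \<phi> \<in> \<Sigma> \<Longrightarrow> solset N n \<chi> [] \<subseteq> solset N n \<phi> []" by blast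
  then obtain a where a: "a \<in> solset N n \<chi> []" by blast
  then have aU: "a \<in> ?U" by (simp add: solset_def)
  \<comment> \<open>The complete type of \<open>a\<close>, satisfied by \<open>a\<close> itself; its
    lower bound turns out to be an atom containing \<open>a\<close>.\<close>
  define \<Sigma>' where "\<Sigma>' = {\<phi> \<in> formulas L n. sat N (nth a) \<phi>}"
  have "\<exists>\<chi>\<in>formulas L n. solset N n \<chi> [] \<noteq> {} \<and> (\<forall>\<phi>\<in>\<Sigma>'. solset N n \<chi> [] \<subseteq> solset N n \<phi> [])"
    by (rule rn_lower_bound[OF cat N]) (use aU in \<open>auto simp: \<Sigma>'_def\<close>)
  then obtain \<chi>' where \<chi>': "\<chi>' \<in> formulas L n" "solset N n \<chi>' [] \<noteq> {}"
    "\<And>\<phi>. \<phi> \<in> \<Sigma>' \<Longrightarrow> solset N n \<chi>' [] \<subseteq> solset N n \<phi> []" by blast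
  have min: "solset N n \<chi>' [] \<subseteq> Y" if Y: "definable0 L N n Y" "a \<in> Y" for Y
  proof -
    obtain \<phi> where "\<phi> \<in> formulas L n" "Y = solset N n \<phi> []" using Y(1) by (auto simp: definable0_def)
    with Y(2) \<chi>'(3)[of \<phi>] show ?thesis by (auto simp: \<Sigma>'_def solset_def)
  qed
  have aD: "a \<in> solset N n \<chi>' []"
  proof (rule ccontr)
    assume "a \<notin> solset N n \<chi>' []"
    then have "solset N n \<chi>' [] \<subseteq> ?U - solset N n \<chi>' []"
      by (intro min definable0_compl solset_definable0 \<chi>') (use aU in auto)
    then show False using \<chi>'(2) by blast
  qed
  have "atom L N n (solset N n \<chi>' [])"
    unfolding atom_def
  proof (intro conjI allI impI)
    fix Y assume Y: "definable0 L N n Y \<and> Y \<subseteq> solset N n \<chi>' []"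
    show "Y = {} \<or> Y = solset N n \<chi>' []"
    proof (cases "a \<in> Y")
      case True
      then show ?thesis using min[of Y] Y by blast
    next
      case False
      then have "solset N n \<chi>' [] \<subseteq> ?U - Y"
        using Y aU by (intro min definable0_compl) auto
      then show ?thesis using Y by blast
    qed
  qed (use \<chi>' in \<open>auto intro: solset_definable0\<close>)
  moreover obtain \<phi> where \<phi>: "\<phi> \<in> formulas L n" "solset N n \<phi> [] = ?U - solset N n \<chi>' []"
    using definable0_compl[OF solset_definable0[OF \<chi>'(1), of N]] by (auto simp: definable0_def)
  ultimately have "\<phi> \<in> \<Sigma>"
    unfolding \<Sigma>_def by (auto intro!: exI[of _ "{solset N n \<chi>' []}"])
  then show False using \<chi>(3) a aD \<phi>(2) by blast
qed

lemma tp_eq_iff: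
  assumes "xs \<in> tuples (univ N) n" "ys \<in> tuples (univ N) n"
  shows "tp L N xs = tp L N ys \<longleftrightarrow> (\<forall>X. definable0 L N n X \<longrightarrow> (xs \<in> X \<longleftrightarrow> ys \<in> X))"
proof -
  have "tp L N xs = tp L N ys \<longleftrightarrow> (\<forall>\<phi>\<in>formulas L n. xs \<in> solset N n \<phi> [] \<longleftrightarrow> ys \<in> solset N n \<phi> [])"
    using assms by (auto simp: tp_def tuples_def solset_def)
  then show ?thesis by (auto simp: definable0_def)
qed

text \<open>No definable set splits an atom, and distinct types are separated by definable sets, so
  the atom through \<open>xs\<close> is the class of its type.\<close>

lemma rn_tp_class:
  assumes "aleph0_categorical L N" "is_struct L N" "xs \<in> tuples (univ N) n"
  shows "atom L N n {ys \<in> tuples (univ N) n. tp L N ys = tp L N xs}"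
proof -
  obtain Q where Q: "\<forall>X\<in>Q. atom L N n X" "\<Union>Q = tuples (univ N) n"
    using rn_finite_atoms[OF assms(1,2), of n] by metis
  then obtain X where X: "X \<in> Q" "xs \<in> X" using assms(3) by blast
  then have at: "atom L N n X" using Q by blast
  then have d: "definable0 L N n X" by (simp add: atom_def)
  have "X = {ys \<in> tuples (univ N) n. tp L N ys = tp L N xs}"
  proof (intro equalityI subsetI)
    fix ys assume ys: "ys \<in> X"
    then have ysU: "ys \<in> tuples (univ N) n" using definable0_sub[OF d] by blast
    have "ys \<in> Y \<longleftrightarrow> xs \<in> Y" if "definable0 L N n Y" for Y
    proof -
      have "X \<inter> Y = {} \<or> X \<inter> Y = X" using at definable0_Int[OF d that] unfolding atom_def by blast
      then show ?thesis using ys X(2) by blast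
    qed
    then show "ys \<in> {ys \<in> tuples (univ N) n. tp L N ys = tp L N xs}"
      using ysU assms(3) by (simp add: tp_eq_iff)
  next
    fix ys assume "ys \<in> {ys \<in> tuples (univ N) n. tp L N ys = tp L N xs}"
    then show "ys \<in> X" using tp_eq_iff[of ys N n xs L] d X(2) assms(3) by blast
  qed
  with at show ?thesis by simp
qed

lemma rn_finite_tps:
  assumes "aleph0_categorical L N" "is_struct L N"
  shows "finite (tp L N ` tuples (univ N) n)"
proof -
  obtain Q where Q: "finite Q" "\<forall>X\<in>Q. atom L N n X" "\<Union>Q = tuples (univ N) n"
    using rn_finite_atoms[OF assms, of n] by metis
  have "finite (tp L N ` X)" if "X \<in> Q" for X
  proof -
    have "tp L N xs = tp L N ys" if "xs \<in> X" "ys \<in> X" for xs ys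
    proof -
      have U: "xs \<in> tuples (univ N) n" "ys \<in> tuples (univ N) n" using that Q(3) \<open>X \<in> Q\<close> by auto
      have at: "atom L N n X" using Q \<open>X \<in> Q\<close> by blast
      have "xs \<in> Y \<longleftrightarrow> ys \<in> Y" if "definable0 L N n Y" for Y
      proof -
        have "X \<inter> Y = {} \<or> X \<inter> Y = X"
          using at definable0_Int[of L N n X Y] that unfolding atom_def by blast
        then show ?thesis using \<open>xs \<in> X\<close> \<open>ys \<in> X\<close> by blast
      qed
      then show ?thesis using tp_eq_iff[OF U] by blast
    qed
    then have "tp L N ` X \<subseteq> {tp L N (SOME x. x \<in> X)}"
      by (metis (mono_tags, lifting) image_subsetI singletonI someI)
    then show ?thesis by (rule finite_subset) simp
  qed
  then have "finite (\<Union>X\<in>Q. tp L N ` X)" using Q(1) by blast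
  then show ?thesis by (simp add: Q(3)[symmetric] image_Union)
qed

section \<open>Automorphisms\<close>

text \<open>Entries may be repeated, dropped or permuted, so equality of types passes from the long
  tuples of a back-and-forth chain to any finite part of the limit.\<close>

lemma tp_reindex:
  assumes "tp L N xs = tp L N ys" "length xs = length ys" "set is \<subseteq> {..<length xs}"
  shows "tp L N (map (nth xs) is) = tp L N (map (nth ys) is)"
proof -
  have *: "sat N (nth (map (nth zs) is)) \<phi> \<longleftrightarrow> ren (sub is) \<phi> \<in> tp L N zs"
    if \<phi>: "\<phi> \<in> formulas L (length is)" and zs: "length zs = length xs" for \<phi> zs
  proof -
    have "sub is i < length xs" if "i < length is" for i
      using that assms(3) nth_mem unfolding sub_def by fastforce
    then have "ren (sub is) \<phi> \<in> formulas L (length zs)"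
      using \<phi> zs by (auto simp: formulas_def subset_iff)
    moreover have "sat N (\<lambda>i. zs ! (sub is i)) \<phi> \<longleftrightarrow> sat N (nth (map (nth zs) is)) \<phi>"
      by (rule sat_cong) (use \<phi> in \<open>auto simp: formulas_def sub_def subset_iff\<close>)
    ultimately show ?thesis by (auto simp: tp_def sat_ren)
  qed
  show ?thesis
    using *[of _ xs] *[of _ ys] assms(1,2) by (auto simp: tp_def)
qed

text \<open>The class of \<open>xs @ [a]\<close> is an atom, hence definable; its projection is
  definable too and therefore contains \<open>ys\<close> together with \<open>xs\<close>.\<close>

lemma tp_extend:
  assumes "aleph0_categorical L N" "is_struct L N"
    and "xs \<in> tuples (univ N) n" "ys \<in> tuples (univ N) n" "tp L N xs = tp L N ys" "a \<in> univ N"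
  shows "\<exists>b\<in>univ N. tp L N (xs @ [a]) = tp L N (ys @ [b])"
proof -
  let ?X = "{zs \<in> tuples (univ N) (Suc n). tp L N zs = tp L N (xs @ [a])}"
  have "xs @ [a] \<in> tuples (univ N) (Suc n)" using assms(3,6) by (auto simp: tuples_def)
  then have "atom L N (Suc n) ?X" and xa: "xs @ [a] \<in> ?X"
    using rn_tp_class[OF assms(1,2), of "xs @ [a]" "Suc n"] by auto
  then have "definable0 L N n {xs \<in> tuples (univ N) n. \<exists>a\<in>univ N. xs @ [a] \<in> ?X}"
    by (intro definable0_project) (simp add: atom_def)
  moreover have "xs \<in> {xs \<in> tuples (univ N) n. \<exists>a\<in>univ N. xs @ [a] \<in> ?X}"
    using xa assms(3,6) by blast
  ultimately have "ys \<in> {xs \<in> tuples (univ N) n. \<exists>a\<in>univ N. xs @ [a] \<in> ?X}"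
    using assms(3,4,5) tp_eq_iff[of xs N n ys L] by blast
  then show ?thesis by auto
qed

text \<open>Extending automorphisms by the identity makes them bijections of the whole type, so that
  \<open>inv\<close> is the group inverse.\<close>

definition autos :: "('f, 'r) lang \<Rightarrow> ('f, 'r, 'a) struc \<Rightarrow> ('a \<Rightarrow> 'a) set" where
  "autos L N = {g. bij g \<and> (\<forall>x. x \<notin> univ N \<longrightarrow> g x = x) \<and> iso L N N g}"

lemma iso_if_tp_eq:
  assumes N: "is_struct L N" and g: "bij_betw g (univ N) (univ N)"
    and tp: "\<And>xs. set xs \<subseteq> univ N \<Longrightarrow> tp L N (map g xs) = tp L N xs"
  shows "iso L N N g"
proof -
  have *: "sat N (nth (map g xs)) \<phi> \<longleftrightarrow> sat N (nth xs) \<phi>"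
    if "set xs \<subseteq> univ N" "\<phi> \<in> formulas L (length xs)" for xs \<phi>
    using tp[OF that(1)] that(2) by (auto simp: tp_def)
  have "g (fn N f xs) = fn N f (map g xs)"
    if f: "farity L f = Some k" and xs: "xs \<in> tuples (univ N) k" for f k xs
  proof -
    let ?\<phi> = "Eq (Var k) (App f (map Var [0..<k])) :: ('a, 'b) fm"
    have ev: "map (eval_tm N (nth (zs @ [c]))) (map Var [0..<k]) = zs" if "length zs = k" for zs :: "'c list" and c
      by (rule nth_equalityI) (use that in \<open>auto simp: nth_append\<close>)
    have len: "length xs = k" using xs by (simp add: tuples_def)
    have "sat N (nth (xs @ [fn N f xs])) ?\<phi>"
      using len by (simp only: sat.simps eval_tm.simps ev) (simp add: nth_append)
    moreover have "fn N f xs \<in> univ N" using N f xs by (auto simp: is_struct_def)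
    ultimately have "sat N (nth (map g (xs @ [fn N f xs]))) ?\<phi>"
      using f xs by (subst *) (auto simp: tuples_def formulas_def)
    then have "sat N (nth (map g xs @ [g (fn N f xs)])) ?\<phi>" by simp
    then show ?thesis using len by (simp only: sat.simps eval_tm.simps ev length_map) (simp add: nth_append)
  qed
  moreover have "rl N r xs \<longleftrightarrow> rl N r (map g xs)"
    if r: "rarity L r = Some k" and xs: "xs \<in> tuples (univ N) k" for r k xs
  proof -
    let ?\<phi> = "Rel r (map Var [0..<k]) :: ('a, 'b) fm"
    have ev: "map (eval_tm N (nth zs)) (map Var [0..<k]) = zs" if "length zs = k" for zs :: "'c list"
      by (rule nth_equalityI) (use that in auto)
    have "sat N (nth xs) ?\<phi> = rl N r xs" "sat N (nth (map g xs)) ?\<phi> = rl N r (map g xs)"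
      using xs ev[of xs] ev[of "map g xs"] by (simp_all only: sat.simps tuples_def mem_Collect_eq length_map)
    moreover have "?\<phi> \<in> formulas L (length xs)" "set xs \<subseteq> univ N"
      using r xs by (auto simp: tuples_def formulas_def)
    ultimately show ?thesis using *[of xs ?\<phi>] by simp
  qed
  ultimately show ?thesis using g by (simp add: iso_def)
qed

text \<open>The conditions are pairs of finite tuples of equal type, ordered by prolongation.
  Meeting \<open>D u\<close> puts \<open>u\<close> into both the domain and the range of the limit
  map.\<close>

lemma back_and_forth:
  assumes cat: "aleph0_categorical L N" and N: "is_struct L N"
    and xs0: "xs0 \<in> tuples (univ N) n" "ys0 \<in> tuples (univ N) n" "tp L N xs0 = tp L N ys0"
  shows "\<exists>g\<in>autos L N. map g xs0 = ys0"
proof -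
  let ?U = "univ N"
  define P where "P p \<longleftrightarrow> (case p of (xs, ys) \<Rightarrow> set xs \<subseteq> ?U \<and> set ys \<subseteq> ?U \<and> length xs = length ys \<and>
      tp L N xs = tp L N ys)" for p
  define R where "R p q \<longleftrightarrow> prefix (fst p) (fst q) \<and> prefix (snd p) (snd q)" for p q :: "'c list \<times> 'c list"
  define D where "D u = {p. u \<in> set (fst p) \<and> u \<in> set (snd p)}" for u :: 'c
  have forth: "\<exists>b\<in>?U. P (xs @ [a], ys @ [b])" if "P (xs, ys)" "a \<in> ?U" for xs ys a
    using tp_extend[OF cat N, of xs "length xs" ys a] that by (auto simp: P_def tuples_def)
  have sym: "P (ys, xs)" if "P (xs, ys)" for xs ys using that by (auto simp: P_def)
  have dense: "\<exists>q. P q \<and> R p q \<and> q \<in> D u" if u: "u \<in> ?U" and p': "P p" for u p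
  proof -
    obtain xs ys where p: "p = (xs, ys)" by (cases p)
    obtain b where b: "b \<in> ?U" "P (xs @ [u], ys @ [b])" using forth[OF p'[unfolded p] u] by blast
    obtain a where a: "a \<in> ?U" "P ((ys @ [b]) @ [u], (xs @ [u]) @ [a])" using forth[OF sym[OF b(2)] u] by blast
    have "P ((xs @ [u]) @ [a], (ys @ [b]) @ [u])" using sym[OF a(2)] .
    then show ?thesis by (rule_tac x = "((xs @ [u]) @ [a], (ys @ [b]) @ [u])" in exI) (auto simp: R_def D_def p)
  qed
  obtain q :: "nat \<Rightarrow> _" where q: "\<And>k. P (q k)" "\<And>j k. j \<le> k \<Longrightarrow> R (q j) (q k)"
    "\<And>E. E \<in> insert {p. R (xs0, ys0) p} (D ` ?U) \<Longrightarrow> \<exists>k. q k \<in> E"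
  proof (rule generic_sequence[of "insert {p. R (xs0, ys0) p} (D ` ?U)" R "\<lambda>p. P p \<and> R (xs0, ys0) p" "(xs0, ys0)"])
    show "countable (insert {p. R (xs0, ys0) p} (D ` ?U))" using cat by (auto simp: aleph0_categorical_def)
    show "R p p" for p by (simp add: R_def)
    show R_trans: "R p q \<Longrightarrow> R q r \<Longrightarrow> R p r" for p q r by (auto simp: R_def)
    show "\<exists>q. (P q \<and> R (xs0, ys0) q) \<and> R p q \<and> q \<in> E"
      if E: "E \<in> insert {p. R (xs0, ys0) p} (D ` ?U)" and p: "P p \<and> R (xs0, ys0) p" for E p
    proof (cases "E = {p. R (xs0, ys0) p}")
      case True then show ?thesis using p by (intro exI[of _ p]) (auto simp: R_def)
    next
      case False
      then obtain u where u: "u \<in> ?U" "E = D u" using E by auto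
      show ?thesis using dense[OF u(1), of p] p R_trans u by blast
    qed
    show "P (xs0, ys0) \<and> R (xs0, ys0) (xs0, ys0)" using xs0 by (auto simp: P_def R_def tuples_def)
  qed (auto)
  define Gr where "Gr = (\<Union>k. set (zip (fst (q k)) (snd (q k))))"
  have mono: "set (zip (fst (q j)) (snd (q j))) \<subseteq> set (zip (fst (q k)) (snd (q k)))" if "j \<le> k" for j k
  proof -
    have "length (fst (q j)) = length (snd (q j))" using q(1)[of j] by (auto simp: P_def)
    then show ?thesis
      using q(2)[OF that] by (auto simp: R_def prefix_def)
  qed
  have common: "\<exists>k. set ps \<subseteq> set (zip (fst (q k)) (snd (q k)))" if "set ps \<subseteq> Gr" for ps
    using that
  proof (induction ps)
    case (Cons p ps)
    then obtain k k' where "set ps \<subseteq> set (zip (fst (q k)) (snd (q k)))" "p \<in> set (zip (fst (q k')) (snd (q k')))"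
      by (auto simp: Gr_def)
    then have "set (p # ps) \<subseteq> set (zip (fst (q (max k k'))) (snd (q (max k k'))))"
      using mono[of k "max k k'"] mono[of k' "max k k'"] by auto
    then show ?case by blast
  qed auto
  have tp_ps: "tp L N (map fst ps) = tp L N (map snd ps)" if ps: "set ps \<subseteq> Gr" for ps
  proof -
    obtain k where k: "set ps \<subseteq> set (zip (fst (q k)) (snd (q k)))" using common[OF ps] by blast
    obtain xs ys where xy: "q k = (xs, ys)" by (cases "q k")
    have P: "length xs = length ys" "tp L N xs = tp L N ys" using q(1)[of k] by (auto simp: P_def xy)
    have "\<forall>p\<in>set ps. \<exists>i<length xs. fst p = xs ! i \<and> snd p = ys ! i"
      using k P(1) by (fastforce simp: xy in_set_zip)
    then obtain f where f: "\<And>p. p \<in> set ps \<Longrightarrow> f p < length xs \<and> fst p = xs ! f p \<and> snd p = ys ! f p" by metis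
    then have "map fst ps = map (nth xs) (map f ps)" "map snd ps = map (nth ys) (map f ps)" by auto
    moreover have "set (map f ps) \<subseteq> {..<length xs}" using f by auto
    ultimately show ?thesis using tp_reindex[OF P(2,1)] by metis
  qed
  \<comment> \<open>Types contain the equations that hold, so the limit relation is single-valued in
    both directions.\<close>
  have inj: "x = x' \<longleftrightarrow> y = y'" if "(x, y) \<in> Gr" "(x', y') \<in> Gr" for x y x' y'
  proof -
    have "tp L N [x, x'] = tp L N [y, y']" using tp_ps[of "[(x, y), (x', y')]"] that by simp
    moreover have "Eq (Var 0) (Var 1) \<in> tp L N [z, z'] \<longleftrightarrow> z = z'" for z z' :: 'c
      by (auto simp: tp_def formulas_def)
    ultimately show ?thesis by metis
  qed
  have GrU: "x \<in> ?U" "y \<in> ?U" if xy: "(x, y) \<in> Gr" for x y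
  proof -
    obtain k where "(x, y) \<in> set (zip (fst (q k)) (snd (q k)))" using xy by (auto simp: Gr_def)
    then have "x \<in> set (fst (q k))" "y \<in> set (snd (q k))"
      by (rule set_zip_leftD, rule set_zip_rightD)
    moreover have "set (fst (q k)) \<subseteq> ?U" "set (snd (q k)) \<subseteq> ?U"
      using q(1)[of k] by (simp_all add: P_def split_beta)
    ultimately show "x \<in> ?U" "y \<in> ?U" by auto
  qed
  have total: "\<exists>y. (u, y) \<in> Gr" "\<exists>x. (x, u) \<in> Gr" if u: "u \<in> ?U" for u
  proof -
    obtain k where k: "q k \<in> D u" using q(3)[of "D u"] u by blast
    obtain xs ys where xy: "q k = (xs, ys)" by (cases "q k")
    have len: "length xs = length ys" using q(1)[of k] by (auto simp: P_def xy)
    obtain i j where ij: "i < length xs" "xs ! i = u" "j < length ys" "ys ! j = u"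
      using k by (auto simp: D_def xy in_set_conv_nth)
    have "(xs ! l, ys ! l) \<in> Gr" if "l < length xs" for l
    proof -
      have "(xs ! l, ys ! l) \<in> set (zip xs ys)" using that len by (force simp: in_set_zip)
      then show ?thesis unfolding Gr_def by (intro UN_I[of k]) (simp_all add: xy)
    qed
    then show "\<exists>y. (u, y) \<in> Gr" "\<exists>x. (x, u) \<in> Gr" using ij len by metis+
  qed
  define g where "g x = (if x \<in> ?U then (SOME y. (x, y) \<in> Gr) else x)" for x
  have g: "(x, g x) \<in> Gr" if "x \<in> ?U" for x using someI_ex[OF total(1)[OF that]] that by (simp add: g_def)
  have g_eq: "g x = y" if "(x, y) \<in> Gr" for x y using inj[OF that g] GrU[OF that] by auto
  have bb: "bij_betw g ?U ?U"
  proof (rule bij_betwI')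
    show "(g x = g y) = (x = y)" if "x \<in> ?U" "y \<in> ?U" for x y using inj[OF g[OF that(1)] g[OF that(2)]] by simp
    show "g x \<in> ?U" if "x \<in> ?U" for x using GrU[OF g[OF that]] by simp
    show "\<exists>x\<in>?U. y = g x" if "y \<in> ?U" for y using total(2)[OF that] g_eq GrU by metis
  qed
  have "bij_betw g (- ?U) (- ?U)" by (rule bij_betw_cong[THEN iffD1, of _ "\<lambda>x. x"]) (auto simp: g_def bij_betw_def)
  from bij_betw_combine[OF bb this] have "bij g" by simp
  moreover have "iso L N N g"
  proof (rule iso_if_tp_eq[OF N bb])
    fix xs assume "set xs \<subseteq> ?U"
    then have "set (map (\<lambda>x. (x, g x)) xs) \<subseteq> Gr" using g by auto
    from tp_ps[OF this] show "tp L N (map g xs) = tp L N xs" by (simp add: o_def)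
  qed
  ultimately have "g \<in> autos L N" by (auto simp: autos_def g_def)
  moreover have "map g xs0 = ys0"
  proof -
    obtain k where k: "R (xs0, ys0) (q k)" using q(3) by blast
    have len: "length xs0 = length ys0" using xs0 by (auto simp: tuples_def)
    have "set (zip xs0 ys0) \<subseteq> set (zip (fst (q k)) (snd (q k)))"
      using k len by (auto simp: R_def prefix_def)
    then have "set (zip xs0 ys0) \<subseteq> Gr" by (auto simp: Gr_def)
    moreover have "(xs0 ! i, ys0 ! i) \<in> set (zip xs0 ys0)" if "i < length xs0" for i
      using that len by (force simp: in_set_zip)
    ultimately have "g (xs0 ! i) = ys0 ! i" if "i < length xs0" for i
      using g_eq that by blast
    then show ?thesis using len by (auto intro: nth_equalityI)
  qed
  ultimately show ?thesis by blast
qed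

section \<open>Definability as invariance\<close>

text \<open>The orbit under the pointwise stabilizer of \<open>A\<close>. For finite
  \<open>A\<close> this is the solution set of a type over \<open>A\<close>, by
  \<open>isolated_set_eq\<close>.\<close>

definition orb :: "('a \<Rightarrow> 'a) set \<Rightarrow> 'a set \<Rightarrow> 'a list \<Rightarrow> 'a list set" where
  "orb G A x = {map g x | g. g \<in> G \<and> (\<forall>a\<in>A. g a = a)}"

text \<open>Inclusion is enough: in a group, applying it to inverses gives equality.\<close>

definition supports :: "('a \<Rightarrow> 'a) set \<Rightarrow> 'a set \<Rightarrow> 'a list set \<Rightarrow> bool" where
  "supports G A X \<longleftrightarrow> (\<forall>g\<in>G. (\<forall>a\<in>A. g a = a) \<longrightarrow> map g ` X \<subseteq> X)"

locale perm_group =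
  fixes G :: "('a \<Rightarrow> 'a) set"
  assumes bij: "g \<in> G \<Longrightarrow> bij g"
    and id_mem: "(\<lambda>x. x) \<in> G"
    and comp_mem: "g \<in> G \<Longrightarrow> h \<in> G \<Longrightarrow> (\<lambda>x. g (h x)) \<in> G"
    and inv_mem: "g \<in> G \<Longrightarrow> inv g \<in> G"
begin

lemma inv_simps [simp]:
  assumes "g \<in> G"
  shows "inv g (g x) = x" "g (inv g x) = x"
  using bij[OF assms] by (simp_all add: bij_is_inj bij_is_surj surj_f_inv_f)

lemma map_inv_simps [simp]:
  assumes "g \<in> G"
  shows "map (inv g) (map g x) = x" "map g (map (inv g) x) = x"
  using assms by (auto intro: map_idI)

lemma eq_iff [simp]: "g \<in> G \<Longrightarrow> g x = g y \<longleftrightarrow> x = y"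
  by (metis inv_simps(1))

lemma map_eq_iff: "g \<in> G \<Longrightarrow> map g x = map g y \<longleftrightarrow> x = y"
  by (metis map_inv_simps(1))

lemma inv_fix: "g \<in> G \<Longrightarrow> g a = a \<Longrightarrow> inv g a = a"
  by (metis inv_simps(1))

lemma orbI: "g \<in> G \<Longrightarrow> \<forall>a\<in>A. g a = a \<Longrightarrow> map g x \<in> orb G A x"
  by (auto simp: orb_def)

lemma orbE:
  assumes "y \<in> orb G A x"
  obtains g where "g \<in> G" "\<forall>a\<in>A. g a = a" "y = map g x"
  using assms unfolding orb_def by blast

lemma orb_refl [simp]: "x \<in> orb G A x"
  using orbI[OF id_mem, of A x] by simp

lemma orb_sym: "y \<in> orb G A x \<Longrightarrow> x \<in> orb G A y"
  by (metis inv_fix inv_mem map_inv_simps(1) orbE orbI)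

lemma orb_trans:
  assumes "y \<in> orb G A x" "z \<in> orb G A y"
  shows "z \<in> orb G A x"
proof -
  obtain g where g: "g \<in> G" "\<forall>a\<in>A. g a = a" "y = map g x" using assms(1) by (rule orbE)
  obtain h where h: "h \<in> G" "\<forall>a\<in>A. h a = a" "z = map h y" using assms(2) by (rule orbE)
  have "map (\<lambda>x. h (g x)) x \<in> orb G A x"
    by (rule orbI[OF comp_mem[OF h(1) g(1)]]) (simp add: g h)
  then show ?thesis by (simp add: g(3) h(3) o_def)
qed

lemma orb_eq: "y \<in> orb G A x \<Longrightarrow> orb G A y = orb G A x"
  by (meson orb_sym orb_trans subsetI subset_antisym)

lemma orb_length: "y \<in> orb G A x \<Longrightarrow> length y = length x"
  by (auto elim: orbE)

lemma orb_mono: "A \<subseteq> B \<Longrightarrow> orb G B x \<subseteq> orb G A x"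
  by (auto simp: orb_def)

lemma orb_fixed: "set x \<subseteq> A \<Longrightarrow> orb G A x = {x}"
  using orb_refl[of x A] by (auto elim!: orbE simp: subset_iff intro: map_idI)

lemma supports_orb: "supports G A (orb G A x)"
  unfolding supports_def by (metis image_subsetI orbI orb_trans)

lemma supports_mono: "supports G A X \<Longrightarrow> A \<subseteq> B \<Longrightarrow> supports G B X"
  by (auto simp: supports_def)

lemma supports_orb_subset: "supports G A X \<Longrightarrow> x \<in> X \<Longrightarrow> orb G A x \<subseteq> X"
  by (auto simp: supports_def orb_def)

lemma supports_map_iff:
  assumes "supports G A X" "g \<in> G" "\<forall>a\<in>A. g a = a"
  shows "map g x \<in> X \<longleftrightarrow> x \<in> X"
proof
  assume "map g x \<in> X"
  moreover have "x \<in> orb G A (map g x)" by (rule orb_sym) (use assms in \<open>auto intro: orbI\<close>)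
  ultimately show "x \<in> X" using supports_orb_subset[OF assms(1)] by blast
next
  assume "x \<in> X" then show "map g x \<in> X" using assms by (auto simp: supports_def)
qed

lemma supports_image:
  assumes "supports G A X" "g \<in> G"
  shows "supports G (g ` A) (map g ` X)"
  unfolding supports_def
proof (intro ballI impI, safe)
  fix h x assume h: "h \<in> G" "\<forall>a\<in>g ` A. h a = a" and x: "x \<in> X"
  let ?k = "\<lambda>x. inv g (h (g x))"
  have k: "?k \<in> G" using comp_mem[OF inv_mem[OF assms(2)] comp_mem[OF h(1) assms(2)]] .
  have "map ?k x \<in> X"
    using supports_map_iff[OF assms(1) k] x h(2) assms(2) by simp
  moreover have "map h (map g x) = map g (map ?k x)" using assms(2) by simp
  ultimately show "map h (map g x) \<in> map g ` X" by blast
qed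

text \<open>Conjugation by \<open>g\<close> turns the stabilizer of \<open>A\<close> into that of
  its image; the reverse inclusion is the forward one for \<open>inv g\<close>.\<close>

lemma orb_image:
  assumes "g \<in> G"
  shows "orb G (g ` A) (map g x) = map g ` orb G A x"
proof -
  have sub: "map k ` orb G A x \<subseteq> orb G (k ` A) (map k x)" if k: "k \<in> G" for k A x
  proof safe
    fix y assume "y \<in> orb G A x"
    then obtain h where h: "h \<in> G" "\<forall>a\<in>A. h a = a" "y = map h x" by (rule orbE)
    have "map (\<lambda>x. k (h (inv k x))) (map k x) \<in> orb G (k ` A) (map k x)"
      by (rule orbI[OF comp_mem[OF k comp_mem[OF h(1) inv_mem[OF k]]]]) (use k h(2) in auto)
    moreover have "map (\<lambda>x. k (h (inv k x))) (map k x) = map k y" using k by (simp add: h(3))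
    ultimately show "map k y \<in> orb G (k ` A) (map k x)" by simp
  qed
  have "map (inv g) ` orb G (g ` A) (map g x) \<subseteq> orb G A x"
    using sub[OF inv_mem[OF assms], of "g ` A" "map g x"] assms by (simp add: image_image del: map_map)
  then have "orb G (g ` A) (map g x) \<subseteq> map g ` orb G A x"
    using assms by (metis (no_types, lifting) image_eqI image_subset_iff map_inv_simps(2) subsetI)
  with sub[OF assms] show ?thesis by blast
qed

lemma stabilizer: "perm_group {g \<in> G. g u = u}"
  by unfold_locales (auto intro: bij id_mem comp_mem inv_mem inv_fix)

text \<open>Orbits for a component group are thus orbits of the full group over one more point, the
  common predecessor.\<close>

lemma orb_stabilizer: "orb {g \<in> G. g u = u} A x = orb G (insert u A) x"
  by (auto simp: orb_def)

end

text \<open>Two structures are allowed because automorphisms of \<open>M\<close> will act as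
  isomorphisms between different components.\<close>

lemma solset_iso:
  assumes N: "is_struct L N" and g: "iso L N N' g"
    and \<phi>: "\<phi> \<in> formulas L (n + m)" and cs: "cs \<in> tuples (univ N) m"
  shows "solset N' n \<phi> (map g cs) = map g ` solset N n \<phi> cs"
proof -
  have img: "g ` univ N = univ N'" using g by (auto simp: iso_def bij_betw_def)
  have *: "map g x \<in> solset N' n \<phi> (map g cs) \<longleftrightarrow> x \<in> solset N n \<phi> cs"
    if x: "x \<in> tuples (univ N) n" for x
  proof -
    have "sat N' (nth (map g (x @ cs))) \<phi> \<longleftrightarrow> sat N (nth (x @ cs)) \<phi>"
      using x cs \<phi> by (intro iso_sat_nth[OF N g]) (auto simp: tuples_def)
    moreover have "map g x \<in> tuples (univ N') n" using x img by (auto simp: tuples_def)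
    ultimately show ?thesis using x by (simp add: solset_def)
  qed
  show ?thesis
  proof (intro equalityI subsetI)
    fix y assume y: "y \<in> solset N' n \<phi> (map g cs)"
    then have "set y \<subseteq> g ` univ N" "length y = n" by (auto simp: solset_def tuples_def img)
    then have "y = map g (map (inv_into (univ N) g) y)"
      by (auto simp: f_inv_into_f subset_iff intro!: map_idI[symmetric])
    moreover have "map (inv_into (univ N) g) y \<in> tuples (univ N) n"
      using \<open>set y \<subseteq> g ` univ N\<close> \<open>length y = n\<close> by (auto simp: tuples_def intro!: inv_into_into)
    ultimately obtain x where "y = map g x" "x \<in> tuples (univ N) n" by blast
    then show "y \<in> map g ` solset N n \<phi> cs" using * y by blast
  next
    fix y assume "y \<in> map g ` solset N n \<phi> cs"
    then show "y \<in> solset N' n \<phi> (map g cs)" using * by (auto simp: solset_def)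
  qed
qed

text \<open>The consequences of the Ryll-Nardzewski theorem as an interface. It is met by
  \<open>M\<close> with its automorphisms, and by each component with a stabilizer in place of its
  own automorphism group.\<close>

locale perm_struct = perm_group G
  for G :: "('a \<Rightarrow> 'a) set" +
  fixes L :: "('f, 'r) lang" and N :: "('f, 'r, 'a) struc"
  assumes struct: "is_struct L N"
    and aut: "g \<in> G \<Longrightarrow> iso L N N g"
    and definable_if_invariant: "X \<subseteq> tuples (univ N) n \<Longrightarrow> supports G {} X \<Longrightarrow> definable0 L N n X"
    and finite_orbits: "finite (orb G {} ` tuples (univ N) n)"
begin

lemma maps_univ [simp]:
  assumes "g \<in> G"
  shows "g x \<in> univ N \<longleftrightarrow> x \<in> univ N"
proof -
  have *: "k y \<in> univ N" if "k \<in> G" "y \<in> univ N" for k y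
    using aut[OF that(1)] that(2) by (auto simp: iso_def bij_betw_def)
  show ?thesis using *[OF assms] *[OF inv_mem[OF assms], of "g x"] assms by auto
qed

lemma maps_tuples [simp]: "g \<in> G \<Longrightarrow> map g x \<in> tuples (univ N) n \<longleftrightarrow> x \<in> tuples (univ N) n"
  by (auto simp: tuples_def)

lemma orb_tuples: "x \<in> tuples (univ N) n \<Longrightarrow> orb G A x \<subseteq> tuples (univ N) n"
  by (auto elim!: orbE)

lemma solset_map:
  assumes "\<phi> \<in> formulas L (n + m)" "cs \<in> tuples (univ N) m" "g \<in> G"
  shows "solset N n \<phi> (map g cs) = map g ` solset N n \<phi> cs"
  by (rule solset_iso[OF struct aut[OF assms(3)] assms(1,2)])

lemma solset_supports:
  assumes "\<phi> \<in> formulas L (n + m)" "cs \<in> tuples (univ N) m"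
  shows "supports G (set cs) (solset N n \<phi> cs)"
  unfolding supports_def
proof (intro ballI impI)
  fix g assume g: "g \<in> G" "\<forall>a\<in>set cs. g a = a"
  then have "map g cs = cs" by (auto intro: map_idI)
  then show "map g ` solset N n \<phi> cs \<subseteq> solset N n \<phi> cs" using solset_map[OF assms g(1)] by simp
qed

text \<open>The union \<open>Z\<close> of the orbits of all \<open>x @ cs\<close> is invariant under
  the whole group, hence definable without parameters; its fibre over \<open>cs\<close> is
  \<open>X\<close> again because \<open>X\<close> is supported by the entries of
  \<open>cs\<close>.\<close>

lemma uniformly_definable:
  assumes "X \<subseteq> tuples (univ N) n" "cs \<in> tuples (univ N) m" "supports G (set cs) X"
  shows "\<exists>\<phi>\<in>formulas L (n + m). X = solset N n \<phi> cs"
proof -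
  define Z where "Z = {map g (x @ cs) | x g. x \<in> X \<and> g \<in> G}"
  have "Z \<subseteq> tuples (univ N) (n + m)"
  proof
    fix z assume "z \<in> Z"
    then obtain x g where "z = map g (x @ cs)" "x \<in> X" "g \<in> G" by (auto simp: Z_def)
    moreover then have "x @ cs \<in> tuples (univ N) (n + m)" using assms(1,2) by (auto simp: tuples_def)
    ultimately show "z \<in> tuples (univ N) (n + m)" by (simp del: map_append)
  qed
  moreover have "supports G {} Z"
    unfolding supports_def Z_def
  proof (intro ballI impI, safe)
    fix h x g assume "h \<in> G" "x \<in> X" "g \<in> G"
    then show "\<exists>x' g'. map h (map g (x @ cs)) = map g' (x' @ cs) \<and> x' \<in> X \<and> g' \<in> G"
      by (intro exI[of _ x] exI[of _ "\<lambda>x. h (g x)"]) (auto intro: comp_mem)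
  qed
  ultimately have "definable0 L N (n + m) Z" by (rule definable_if_invariant)
  then obtain \<phi> where \<phi>: "\<phi> \<in> formulas L (n + m)" "Z = solset N (n + m) \<phi> []"
    by (auto simp: definable0_def)
  have "X = solset N n \<phi> cs"
  proof (intro equalityI subsetI)
    fix x assume x: "x \<in> X"
    have "map (\<lambda>x. x) (x @ cs) \<in> Z" unfolding Z_def using x id_mem by blast
    then show "x \<in> solset N n \<phi> cs"
      using x assms(1) by (auto simp: \<phi>(2) solset_def)
  next
    fix x assume x: "x \<in> solset N n \<phi> cs"
    then have "x @ cs \<in> Z" using assms(2) by (simp add: \<phi>(2) solset_def tuples_def)
    then obtain x' g where *: "x @ cs = map g (x' @ cs)" "x' \<in> X" "g \<in> G" by (auto simp: Z_def)
    have "length x = length x'" using x * assms(1) by (auto simp: solset_def tuples_def)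
    then have "x = map g x'" "map g cs = cs" using * by auto
    then have "\<forall>a\<in>set cs. g a = a" by (metis map_eq_conv map_ident)
    then show "x \<in> X" using supports_map_iff[OF assms(3) *(3)] * \<open>x = map g x'\<close> by simp
  qed
  with \<phi>(1) show ?thesis by blast
qed

text \<open>From here on definability is verified by exhibiting a finite support, never by writing a
  formula.\<close>

lemma Def_sets_iff:
  "X \<in> Def_sets L N n \<longleftrightarrow> X \<subseteq> tuples (univ N) n \<and> (\<exists>A. finite A \<and> A \<subseteq> univ N \<and> supports G A X)"
proof
  assume "X \<in> Def_sets L N n"
  then obtain \<phi> cs m where *: "X = solset N n \<phi> cs" "\<phi> \<in> formulas L (n + m)" "cs \<in> tuples (univ N) m"
    by (auto simp: Def_sets_def)
  have "supports G (set cs) X" using solset_supports[OF *(2,3)] *(1) by simp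
  then show "X \<subseteq> tuples (univ N) n \<and> (\<exists>A. finite A \<and> A \<subseteq> univ N \<and> supports G A X)"
    using * by (auto simp: solset_def tuples_def)
next
  assume *: "X \<subseteq> tuples (univ N) n \<and> (\<exists>A. finite A \<and> A \<subseteq> univ N \<and> supports G A X)"
  then obtain A where A: "finite A" "A \<subseteq> univ N" "supports G A X" by blast
  obtain cs where cs: "set cs = A" using finite_list[OF A(1)] by blast
  then show "X \<in> Def_sets L N n"
    using uniformly_definable[of X n cs "length cs"] * A by (auto simp: Def_sets_def tuples_def)
qed

text \<open>Any set definable over \<open>C\<close> that contains \<open>x\<close> is invariant
  under the stabilizer and so contains the orbit; the orbit is itself definable over
  \<open>C\<close>, hence it is the least such set.\<close>

lemma isolated_set_eq:
  assumes C: "finite C" "C \<subseteq> univ N" and x: "x \<in> tuples (univ N) n"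
  shows "isolated_set L N x C = orb G C x"
proof -
  have len: "length x = n" using x by (simp add: tuples_def)
  obtain cs where cs: "set cs = C" using finite_list[OF C(1)] by blast
  have cs': "cs \<in> tuples (univ N) (length cs)" using cs C by (simp add: tuples_def)
  obtain \<phi> where \<phi>: "\<phi> \<in> formulas L (n + length cs)" "orb G C x = solset N n \<phi> cs"
    using uniformly_definable[OF orb_tuples[OF x] cs', of C] supports_orb[of C x] cs by auto
  have sub: "orb G C x \<subseteq> solset N n \<psi> ds" if "(\<psi>, ds) \<in> tp_over L N x C" for \<psi> ds
  proof -
    have *: "set ds \<subseteq> C" "\<psi> \<in> formulas L (n + length ds)" "x \<in> solset N n \<psi> ds"
      using that x len by (auto simp: tp_over_def solset_def)
    have "supports G C (solset N n \<psi> ds)"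
      by (rule supports_mono[OF solset_supports[OF *(2)] *(1)]) (use *(1) C(2) in \<open>auto simp: tuples_def\<close>)
    then show ?thesis using supports_orb_subset *(3) by blast
  qed
  have mem: "(\<phi>, cs) \<in> tp_over L N x C"
    using \<phi> len orb_refl[of x C] cs by (auto simp: tp_over_def solset_def)
  have iso: "isolates L N \<phi> cs x C"
    unfolding isolates_def using mem sub \<phi>(2) len by auto
  have uniq: "solset N (length x) \<psi> ds = orb G C x" if "isolates L N \<psi> ds x C" for \<psi> ds
  proof -
    have "solset N n \<psi> ds \<subseteq> orb G C x"
      using that mem \<phi>(2) len unfolding isolates_def by auto
    moreover have "orb G C x \<subseteq> solset N n \<psi> ds" using sub that by (auto simp: isolates_def)
    ultimately show ?thesis using len by auto
  qed
  show ?thesis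
    unfolding isolated_set_def
  proof (rule the_equality)
    show "\<exists>\<psi> ds. isolates L N \<psi> ds x C \<and> orb G C x = solset N (length x) \<psi> ds"
      using iso uniq[OF iso] by blast
    show "X = orb G C x" if "\<exists>\<psi> ds. isolates L N \<psi> ds x C \<and> X = solset N (length x) \<psi> ds" for X
      using that uniq by blast
  qed
qed

text \<open>With \<open>cs\<close> enumerating \<open>A\<close>, an orbit over \<open>A\<close> is
  the fibre over \<open>cs\<close> of an orbit of longer tuples over the empty set, and those are
  finitely many.\<close>

lemma finite_orbits_over:
  assumes "finite A" "A \<subseteq> univ N"
  shows "finite (orb G A ` tuples (univ N) n)"
proof -
  obtain cs where cs: "set cs = A" using finite_list[OF assms(1)] by blast
  let ?f = "\<lambda>W. {x. x @ cs \<in> W}"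
  have "orb G A x = ?f (orb G {} (x @ cs))" if "x \<in> tuples (univ N) n" for x
  proof (intro equalityI subsetI)
    fix y assume "y \<in> orb G A x"
    then obtain g where g: "g \<in> G" "\<forall>a\<in>A. g a = a" "y = map g x" by (rule orbE)
    have "map g (x @ cs) \<in> orb G {} (x @ cs)" by (rule orbI) (use g in auto)
    moreover have "map g cs = cs" using g cs by (auto intro: map_idI)
    ultimately show "y \<in> ?f (orb G {} (x @ cs))" using g by simp
  next
    fix y assume "y \<in> ?f (orb G {} (x @ cs))"
    then obtain g where g: "g \<in> G" "y @ cs = map g (x @ cs)" by (auto elim: orbE)
    then have len: "length y = length x" using arg_cong[OF g(2), of length] by simp
    then have "y = map g x" "map g cs = cs" using g by auto
    then have "\<forall>a\<in>A. g a = a" by (metis cs map_eq_conv map_ident)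
    then show "y \<in> orb G A x" using g(1) \<open>y = map g x\<close> by (auto intro: orbI)
  qed
  then have "orb G A ` tuples (univ N) n \<subseteq> ?f ` orb G {} ` tuples (univ N) (n + length cs)"
    using assms(2) cs by (fastforce simp: tuples_def)
  then show ?thesis by (rule finite_subset) (simp add: finite_orbits)
qed

end

lemma perm_group_autos: 
  assumes N: "is_struct L N"
  shows "perm_group (autos L N)"
proof
  have fn_closed: "fn N f xs \<in> univ N" if "farity L f = Some k" "xs \<in> tuples (univ N) k" for f k xs
    using N that by (auto simp: is_struct_def)
  show "bij g" if "g \<in> autos L N" for g using that by (simp add: autos_def)
  show "(\<lambda>x. x) \<in> autos L N" by (auto simp: autos_def iso_def bij_betw_def)
  show "(\<lambda>x. g (h x)) \<in> autos L N" if "g \<in> autos L N" "h \<in> autos L N" for g h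
  proof -
    have t: "map h xs \<in> tuples (univ N) k" if "xs \<in> tuples (univ N) k" for xs k
    proof -
      have "h ` univ N = univ N" using \<open>h \<in> autos L N\<close> by (auto simp: autos_def iso_def bij_betw_def)
      then show ?thesis using that by (auto simp: tuples_def)
    qed
    have "bij_betw (g \<circ> h) (univ N) (univ N)" "bij (g \<circ> h)"
      using that by (auto simp: autos_def iso_def intro: bij_betw_trans bij_comp)
    moreover have "(\<lambda>x. g (h x)) = g \<circ> h" by auto
    moreover have "g (h (fn N f xs)) = fn N f (map (\<lambda>x. g (h x)) xs)"
      if "farity L f = Some k" "xs \<in> tuples (univ N) k" for f k xs
    proof -
      have "g (fn N f (map h xs)) = fn N f (map g (map h xs))" "h (fn N f xs) = fn N f (map h xs)"
        using that t[OF that(2)] \<open>g \<in> autos L N\<close> \<open>h \<in> autos L N\<close> unfolding autos_def iso_def by blast+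
      then show ?thesis by (simp add: o_def)
    qed
    moreover have "rl N r xs = rl N r (map (\<lambda>x. g (h x)) xs)"
      if "rarity L r = Some k" "xs \<in> tuples (univ N) k" for r k xs
    proof -
      have "rl N r (map h xs) = rl N r (map g (map h xs))" "rl N r xs = rl N r (map h xs)"
        using that t[OF that(2)] \<open>g \<in> autos L N\<close> \<open>h \<in> autos L N\<close> unfolding autos_def iso_def by blast+
      then show ?thesis by (simp add: o_def)
    qed
    ultimately show ?thesis using that by (simp add: autos_def iso_def)
  qed
  show "inv g \<in> autos L N" if g: "g \<in> autos L N" for g
  proof -
    have b: "bij g" "bij_betw g (univ N) (univ N)" using g by (auto simp: autos_def iso_def)
    have gi: "g (inv g x) = x" "inv g (g x) = x" for x
      using b(1) by (simp_all add: bij_is_inj bij_is_surj surj_f_inv_f)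
    have "inv g ` univ N = univ N" using b(2) gi by (metis bij_betw_def bij_betw_imp_surj_on image_inv_f_f b(1) bij_is_inj)
    then have bi: "bij_betw (inv g) (univ N) (univ N)"
      by (intro bij_betw_imageI inj_on_inverseI[of _ g]) (simp_all add: gi)
    have t: "map (inv g) xs \<in> tuples (univ N) k" if "xs \<in> tuples (univ N) k" for xs k
      using that \<open>inv g ` univ N = univ N\<close> by (auto simp: tuples_def)
    have mg: "map g (map (inv g) xs) = xs" for xs by (auto intro: map_idI simp: gi)
    have "inv g (fn N f xs) = fn N f (map (inv g) xs)"
      if "farity L f = Some k" "xs \<in> tuples (univ N) k" for f k xs
    proof -
      have "g (fn N f (map (inv g) xs)) = fn N f (map g (map (inv g) xs))"
        using that t[OF that(2)] g unfolding autos_def iso_def by blast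
      then show ?thesis using gi mg by metis
    qed
    moreover have "rl N r xs = rl N r (map (inv g) xs)"
      if "rarity L r = Some k" "xs \<in> tuples (univ N) k" for r k xs
    proof -
      have "rl N r (map (inv g) xs) = rl N r (map g (map (inv g) xs))"
        using that t[OF that(2)] g unfolding autos_def iso_def by blast
      then show ?thesis using mg by metis
    qed
    moreover have "inv g x = x" if "x \<notin> univ N" for x using g that gi by (metis (mono_tags, lifting) autos_def mem_Collect_eq)
    ultimately show ?thesis using bi b(1) by (auto simp: autos_def iso_def bij_imp_bij_inv)
  qed
qed

text \<open>Orbits are classes of types: automorphisms preserve formulas, and back-and-forth gives
  the converse. Finiteness and definability then come from the finitely many isolated types.\<close>

lemma perm_struct_autos:
  assumes cat: "aleph0_categorical L N" and N: "is_struct L N"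
  shows "perm_struct (autos L N) L N"
proof -
  interpret perm_group "autos L N" by (rule perm_group_autos[OF N])
  have orb: "orb (autos L N) {} x = {y \<in> tuples (univ N) n. tp L N y = tp L N x}"
    if x: "x \<in> tuples (univ N) n" for x n
  proof (intro equalityI subsetI)
    fix y assume "y \<in> orb (autos L N) {} x"
    then obtain g where g: "g \<in> autos L N" "y = map g x" by (auto elim: orbE)
    have "g ` univ N = univ N" using g(1) by (auto simp: autos_def iso_def bij_betw_def)
    then have "y \<in> tuples (univ N) n" using g(2) x by (auto simp: tuples_def)
    moreover have "tp L N y = tp L N x"
      using iso_sat_nth[OF N, of N g _ n x] g x by (auto simp: tp_def autos_def tuples_def)
    ultimately show "y \<in> {y \<in> tuples (univ N) n. tp L N y = tp L N x}" by simp
  next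
    fix y assume "y \<in> {y \<in> tuples (univ N) n. tp L N y = tp L N x}"
    then show "y \<in> orb (autos L N) {} x"
      using back_and_forth[OF cat N x, of y] by (auto intro: orbI)
  qed
  show ?thesis
  proof
    show "is_struct L N" by (rule N)
    show "iso L N N g" if "g \<in> autos L N" for g using that by (simp add: autos_def)
    have "orb (autos L N) {} ` tuples (univ N) n =
      (\<lambda>p. {y \<in> tuples (univ N) n. tp L N y = p}) ` tp L N ` tuples (univ N) n" for n
      by (auto simp: orb image_image)
    then show fin: "finite (orb (autos L N) {} ` tuples (univ N) n)" for n
      using rn_finite_tps[OF cat N, of n] by simp
    show "definable0 L N n X" if X: "X \<subseteq> tuples (univ N) n" "supports (autos L N) {} X" for X n
    proof -
      have "X = \<Union>(orb (autos L N) {} ` X)" using supports_orb_subset[OF X(2)] by auto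
      moreover have "definable0 L N n (\<Union>(orb (autos L N) {} ` X))"
      proof (rule definable0_Union)
        show "finite (orb (autos L N) {} ` X)" using fin finite_subset image_mono[OF X(1)] by metis
        show "definable0 L N n Y" if "Y \<in> orb (autos L N) {} ` X" for Y
          using that X(1) orb rn_tp_class[OF cat N] unfolding atom_def by fastforce
      qed
      ultimately show ?thesis by simp
    qed
  qed
qed

section \<open>Sums and products of dimension-measure pairs\<close>

definition otimes :: "nat \<times> real \<Rightarrow> nat \<times> real \<Rightarrow> nat \<times> real" where
  "otimes p q = (fst p + fst q, snd p * snd q)"

text \<open>Reading \<open>(d, \<mu>)\<close> as a monomial of degree \<open>d\<close> with
  coefficient \<open>\<mu>\<close>, this is the leading term of the sum: only summands of top degree
  count. The empty sum is \<open>(0, 0)\<close>, the value prescribed for the empty set.\<close>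

definition osum :: "'i set \<Rightarrow> ('i \<Rightarrow> nat \<times> real) \<Rightarrow> nat \<times> real" where
  "osum I f = (if I = {} then (0, 0) else
     (let m = Max ((\<lambda>i. fst (f i)) ` I) in (m, \<Sum>i | i \<in> I \<and> fst (f i) = m. snd (f i))))"

lemma otimes_one [simp]: "otimes p (0, 1) = p" "otimes (0, 1) p = p"
  by (simp_all add: otimes_def)

lemma otimes_commute: "otimes p q = otimes q p"
  by (simp add: otimes_def)

lemma osum_empty [simp]: "osum {} f = (0, 0)"
  by (simp add: osum_def)

lemma osum_cong: "I = J \<Longrightarrow> (\<And>i. i \<in> J \<Longrightarrow> f i = g i) \<Longrightarrow> osum I f = osum J g"
proof -
  assume "I = J" and *: "\<And>i. i \<in> J \<Longrightarrow> f i = g i"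
  moreover have "(\<lambda>i. fst (f i)) ` J = (\<lambda>i. fst (g i)) ` J" using * by auto
  moreover have "(\<Sum>i | i \<in> J \<and> fst (f i) = m. snd (f i)) = (\<Sum>i | i \<in> J \<and> fst (g i) = m. snd (g i))" for m
    using * by (intro sum.cong) auto
  ultimately show ?thesis by (simp add: osum_def)
qed

lemma osum_eqI:
  assumes "finite I" "i0 \<in> I" "fst (f i0) = m" "\<And>i. i \<in> I \<Longrightarrow> fst (f i) \<le> m"
    and "s = (\<Sum>i | i \<in> I \<and> fst (f i) = m. snd (f i))"
  shows "osum I f = (m, s)"
proof -
  have "Max ((\<lambda>i. fst (f i)) ` I) = m"
    using assms(1-4) by (intro Max_eqI) auto
  then show ?thesis using assms(2,5) by (auto simp: osum_def Let_def)
qed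

lemma osum_max:
  assumes "finite I" "I \<noteq> {}"
  obtains i0 where "i0 \<in> I" "fst (f i0) = fst (osum I f)"
    "\<And>i. i \<in> I \<Longrightarrow> fst (f i) \<le> fst (osum I f)"
proof -
  have "Max ((\<lambda>i. fst (f i)) ` I) \<in> (\<lambda>i. fst (f i)) ` I"
    using assms by (intro Max_in) auto
  moreover have "fst (f i) \<le> Max ((\<lambda>i. fst (f i)) ` I)" if "i \<in> I" for i
    using assms that by (intro Max_ge) auto
  ultimately show ?thesis using assms(2) that by (force simp: osum_def Let_def)
qed

lemma osum_ge: "finite I \<Longrightarrow> i \<in> I \<Longrightarrow> fst (f i) \<le> fst (osum I f)"
  by (rule osum_max[of I f]) auto

lemma snd_osum: "snd (osum I f) = (\<Sum>i | i \<in> I \<and> fst (f i) = fst (osum I f). snd (f i))"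
  by (simp add: osum_def Let_def)

lemma osum_pos:
  assumes "finite I" "I \<noteq> {}" "\<And>i. i \<in> I \<Longrightarrow> snd (f i) > 0"
  shows "snd (osum I f) > 0"
proof -
  obtain i0 where "i0 \<in> I" "fst (f i0) = fst (osum I f)" using osum_max[OF assms(1,2), of f] by blast
  then show ?thesis unfolding snd_osum using assms by (intro sum_pos) auto
qed

lemma osum_reindex:
  assumes "inj_on h I"
  shows "osum (h ` I) f = osum I (\<lambda>i. f (h i))"
proof -
  have "(\<Sum>i | i \<in> h ` I \<and> fst (f i) = m. snd (f i)) = (\<Sum>i | i \<in> I \<and> fst (f (h i)) = m. snd (f (h i)))" for m
  proof -
    have "{i. i \<in> h ` I \<and> fst (f i) = m} = h ` {i. i \<in> I \<and> fst (f (h i)) = m}" by auto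
    moreover have "inj_on h {i. i \<in> I \<and> fst (f (h i)) = m}" by (rule inj_on_subset[OF assms]) auto
    ultimately show ?thesis by (simp add: sum.reindex)
  qed
  then show ?thesis by (simp add: osum_def image_image)
qed

lemma osum_singleton [simp]: "osum {i} f = f i"
  by (rule osum_eqI[of _ i, THEN trans, of _ _ _ "snd (f i)"]) (auto simp: conj_commute cong: conj_cong)

text \<open>Distributivity. It fails for an empty index set, since \<open>otimes c (0, 0)\<close>
  keeps the dimension of \<open>c\<close>.\<close>

lemma osum_otimes:
  assumes "finite I" "I \<noteq> {}"
  shows "osum I (\<lambda>i. otimes c (f i)) = otimes c (osum I f)"
proof -
  obtain i0 where i0: "i0 \<in> I" "fst (f i0) = fst (osum I f)" "\<And>i. i \<in> I \<Longrightarrow> fst (f i) \<le> fst (osum I f)"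
    by (rule osum_max[OF assms]) (rule that)
  show ?thesis
    unfolding otimes_def
    by (rule osum_eqI[OF assms(1) i0(1)]) (use i0 in \<open>auto simp: snd_osum sum_distrib_left\<close>)
qed

text \<open>An inner sum of less than the maximal dimension contains no term of maximal dimension,
  so leaving it out on one side loses nothing on the other.\<close>

lemma osum_Sigma:
  assumes "finite I" "\<And>i. i \<in> I \<Longrightarrow> finite (J i)" "\<And>i. i \<in> I \<Longrightarrow> J i \<noteq> {}"
  shows "osum (Sigma I J) f = osum I (\<lambda>i. osum (J i) (\<lambda>j. f (i, j)))"
proof (cases "I = {}")
  case False
  let ?g = "\<lambda>i. osum (J i) (\<lambda>j. f (i, j))"
  obtain i0 where i0: "i0 \<in> I" "fst (?g i0) = fst (osum I ?g)" "\<And>i. i \<in> I \<Longrightarrow> fst (?g i) \<le> fst (osum I ?g)"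
    by (rule osum_max[OF assms(1) False]) (rule that)
  let ?m = "fst (osum I ?g)"
  have le: "fst (f (i, j)) \<le> fst (?g i)" if "i \<in> I" "j \<in> J i" for i j
    using osum_max[OF assms(2,3)[OF that(1)], of "\<lambda>j. f (i, j)"] that(2) by metis
  obtain j0 where j0: "j0 \<in> J i0" "fst (f (i0, j0)) = fst (?g i0)"
    using osum_max[OF assms(2,3)[OF i0(1)], of "\<lambda>j. f (i0, j)"] by metis
  have "snd (osum I ?g) = (\<Sum>i | i \<in> I \<and> fst (?g i) = ?m. snd (?g i))" by (rule snd_osum)
  also have "\<dots> = (\<Sum>i | i \<in> I \<and> fst (?g i) = ?m. \<Sum>j | j \<in> J i \<and> fst (f (i, j)) = ?m. snd (f (i, j)))"
    by (intro sum.cong refl) (simp add: snd_osum)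
  also have "\<dots> = (\<Sum>i\<in>I. \<Sum>j | j \<in> J i \<and> fst (f (i, j)) = ?m. snd (f (i, j)))"
  proof (rule sum.mono_neutral_left[OF assms(1)])
    show "\<forall>i\<in>I - {i. i \<in> I \<and> fst (?g i) = ?m}. (\<Sum>j | j \<in> J i \<and> fst (f (i, j)) = ?m. snd (f (i, j))) = 0"
    proof
      fix i assume i: "i \<in> I - {i. i \<in> I \<and> fst (?g i) = ?m}"
      then have "fst (?g i) < ?m" using i0(3)[of i] by auto
      then have "{j. j \<in> J i \<and> fst (f (i, j)) = ?m} = {}" using le[of i] i by fastforce
      then show "(\<Sum>j | j \<in> J i \<and> fst (f (i, j)) = ?m. snd (f (i, j))) = 0" by (simp only: sum.empty)
    qed
  qed auto
  also have "\<dots> = (\<Sum>p\<in>(SIGMA i:I. {j. j \<in> J i \<and> fst (f (i, j)) = ?m}). snd (f p))"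
    using assms(1,2) by (subst sum.Sigma) (auto simp: split_def)
  also have "(SIGMA i:I. {j. j \<in> J i \<and> fst (f (i, j)) = ?m}) = {p. p \<in> Sigma I J \<and> fst (f p) = ?m}"
    by auto
  finally have "snd (osum I ?g) = (\<Sum>p | p \<in> Sigma I J \<and> fst (f p) = ?m. snd (f p))" .
  moreover have "fst (f p) \<le> ?m" if "p \<in> Sigma I J" for p
    using le[of "fst p" "snd p"] i0(3)[of "fst p"] that by auto
  ultimately have "osum (Sigma I J) f = (?m, snd (osum I ?g))"
    using assms(1,2) i0(1,2) j0 by (intro osum_eqI[of _ "(i0, j0)"]) auto
  then show ?thesis by simp
qed simp

lemma osum_partition:
  assumes "finite I"
  shows "osum I f = osum (g ` I) (\<lambda>y. osum {i \<in> I. g i = y} f)"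
proof -
  let ?S = "SIGMA y:g ` I. {i \<in> I. g i = y}"
  have "I = snd ` ?S" by force
  moreover have "inj_on snd ?S" by (auto simp: inj_on_def)
  ultimately have "osum I f = osum ?S (\<lambda>p. f (snd p))" using osum_reindex[of snd ?S f] by simp
  also have "\<dots> = osum (g ` I) (\<lambda>y. osum {i \<in> I. g i = y} (\<lambda>i. f (snd (y, i))))"
    by (rule osum_Sigma) (use assms in auto)
  finally show ?thesis by simp
qed

lemma osum_ones: "finite I \<Longrightarrow> osum I (\<lambda>_. (0, 1)) = (0, real (card I))"
  by (cases "I = {}") (auto simp: osum_def image_constant_conv)

text \<open>The two equations of the Fubini clause in \<open>MS_measurable\<close>, for dimension
  and for measure, become one equation of leading terms.\<close>

lemma osum_fubini_iff:
  assumes "D \<noteq> {}"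
  shows "fst q = Max {fst p + fst (k p) | p. p \<in> D} \<and>
      snd q = (\<Sum>p | p \<in> D \<and> fst p + fst (k p) = fst q. snd p * snd (k p)) \<longleftrightarrow>
    q = osum D (\<lambda>p. otimes p (k p))"
proof -
  have "{fst p + fst (k p) | p. p \<in> D} = (\<lambda>p. fst p + fst (k p)) ` D" by blast
  then show ?thesis using assms by (auto simp: osum_def otimes_def Let_def prod_eq_iff)
qed

text \<open>Undoes the grouping by fibre value in the Fubini clause when the base \<open>Y\<close>
  is finite, where each group weighs its cardinality.\<close>

lemma osum_otimes_card:
  assumes "finite Y" "finite (B ` Y)"
  shows "osum (B ` Y) (\<lambda>p. otimes p (0, real (card {b \<in> Y. B b = p}))) = osum Y B"
proof -
  have "otimes p (0, real (card {b \<in> Y. B b = p})) = osum {b \<in> Y. B b = p} B" if "p \<in> B ` Y" for p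
  proof -
    let ?S = "{b \<in> Y. B b = p}"
    have "finite ?S" "?S \<noteq> {}" using assms that by auto
    then have "otimes p (osum ?S (\<lambda>_. (0, 1))) = osum ?S (\<lambda>_. otimes p (0, 1))"
      by (rule osum_otimes[symmetric])
    also have "\<dots> = osum ?S B" by (intro osum_cong) auto
    finally show ?thesis using \<open>finite ?S\<close> by (simp add: osum_ones)
  qed
  then show ?thesis unfolding osum_partition[OF assms(1), of B B] by (intro osum_cong) auto
qed

section \<open>Measured permutation structures\<close>

text \<open>The definable sets in the language-free description of
  \<open>Def_sets_iff\<close>.\<close>

definition Dset :: "('a \<Rightarrow> 'a) set \<Rightarrow> 'a set \<Rightarrow> nat \<Rightarrow> 'a list set set" where
  "Dset H K n = {X. X \<subseteq> tuples K n \<and> (\<exists>A. finite A \<and> A \<subseteq> K \<and> supports H A X)}"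

text \<open>MS-measurability as seen by a group alone. The clause \<open>invariant\<close> takes the
  place of the definability of the sets where the value is constant.\<close>

locale perm_meas = perm_group H
  for H :: "('a \<Rightarrow> 'a) set" +
  fixes K :: "'a set" and h :: "'a list set \<Rightarrow> nat \<times> real"
  assumes infinite_univ: "infinite K"
    and maps: "g \<in> H \<Longrightarrow> x \<in> K \<Longrightarrow> g x \<in> K"
    and positive: "X \<in> Dset H K n \<Longrightarrow> h X = (0, 0) \<or> snd (h X) > 0"
    and finite_sets: "X \<in> Dset H K n \<Longrightarrow> finite X \<Longrightarrow> h X = (0, real (card X))"
    and invariant: "X \<in> Dset H K n \<Longrightarrow> g \<in> H \<Longrightarrow> h (map g ` X) = h X"
    and fubini: "X \<in> Dset H K n \<Longrightarrow> Y \<in> Dset H K k \<Longrightarrow> X \<noteq> {} \<Longrightarrow> f ` X = Y \<Longrightarrow>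
      {x @ f x | x. x \<in> X} \<in> Dset H K (n + k) \<Longrightarrow>
      h X = osum ((\<lambda>b. h {x \<in> X. f x = b}) ` Y)
        (\<lambda>p. otimes p (h {b \<in> Y. h {x \<in> X. f x = b} = p}))"
begin

lemma maps_tuples: "g \<in> H \<Longrightarrow> x \<in> tuples K n \<Longrightarrow> map g x \<in> tuples K n"
  using maps[of g] by (auto simp: tuples_def)

lemma orb_sub: "x \<in> tuples K n \<Longrightarrow> orb H A x \<subseteq> tuples K n"
  using maps_tuples by (auto simp: orb_def)

lemma orb_Dset: "x \<in> tuples K n \<Longrightarrow> finite A \<Longrightarrow> A \<subseteq> K \<Longrightarrow> orb H A x \<in> Dset H K n"
  using orb_sub supports_orb by (auto simp: Dset_def)

text \<open>Finite additivity is extracted from Fubini by mapping every piece \<open>F i\<close> to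
  a point \<open>c i\<close> of its own. Such points exist as \<open>K\<close> is infinite, and they
  are added to the support.\<close>

lemma meas_partition:
  assumes I: "finite I" "I \<noteq> {}" and F: "\<And>i. i \<in> I \<Longrightarrow> F i \<in> Dset H K n" "\<And>i. i \<in> I \<Longrightarrow> F i \<noteq> {}"
    and disj: "\<And>i j. i \<in> I \<Longrightarrow> j \<in> I \<Longrightarrow> i \<noteq> j \<Longrightarrow> F i \<inter> F j = {}"
  shows "h (\<Union>i\<in>I. F i) = osum I (\<lambda>i. h (F i))"
proof -
  obtain T where T: "T \<subseteq> K" "finite T" "card T = card I"
    using infinite_arbitrarily_large[OF infinite_univ] by blast
  then obtain c where c: "bij_betw c I T" using finite_same_card_bij[OF I(1) T(2)] by auto
  have c_inj: "c i = c j \<longleftrightarrow> i = j" if "i \<in> I" "j \<in> I" for i j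
    using c that by (auto simp: bij_betw_def inj_on_def)
  have c_mem: "c i \<in> K" if "i \<in> I" for i using c that T(1) by (auto simp: bij_betw_def)
  define f where "f x = [c (THE i. i \<in> I \<and> x \<in> F i)]" for x
  have f: "f x = [c i]" if "i \<in> I" "x \<in> F i" for i x
  proof -
    have "(THE i. i \<in> I \<and> x \<in> F i) = i"
      by (rule the_equality) (use that disj in blast)+
    then show ?thesis by (simp add: f_def)
  qed
  let ?X = "\<Union>i\<in>I. F i" and ?Y = "(\<lambda>i. [c i]) ` I"
  have "\<forall>i\<in>I. \<exists>A. finite A \<and> A \<subseteq> K \<and> supports H A (F i)" using F(1) by (auto simp: Dset_def)
  then obtain A where A: "\<And>i. i \<in> I \<Longrightarrow> finite (A i) \<and> A i \<subseteq> K \<and> supports H (A i) (F i)" by metis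
  let ?A = "(\<Union>i\<in>I. A i) \<union> T"
  have fA: "finite ?A" "?A \<subseteq> K" using A T I by auto
  have map_F: "map g x \<in> F i" if "i \<in> I" "x \<in> F i" "g \<in> H" "\<forall>a\<in>?A. g a = a" for i g x
  proof -
    have "map g ` F i \<subseteq> F i"
      using A[OF that(1)] that(1,3,4) unfolding supports_def by blast
    then show ?thesis using that(2) by blast
  qed
  have gc: "g (c i) = c i" if "i \<in> I" "\<forall>a\<in>?A. g a = a" for i g
    using that c by (auto simp: bij_betw_def)
  have points: "S \<in> Dset H K 1" if S: "S \<subseteq> ?Y" for S
    unfolding Dset_def
  proof (intro CollectI conjI exI[of _ ?A])
    show "supports H ?A S"
      unfolding supports_def
    proof (intro ballI impI subsetI)
      fix g y assume g: "\<forall>a\<in>?A. g a = a" and "y \<in> map g ` S"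
      then obtain x where x: "x \<in> S" "y = map g x" by blast
      then obtain i where i: "i \<in> I" "x = [c i]" using S by blast
      then have "y = x" using gc[OF i(1) g] x(2) by simp
      then show "y \<in> S" using x(1) by simp
    qed
    show "S \<subseteq> tuples K 1" using S c_mem by (force simp: tuples_def)
  qed (use fA in auto)
  have sub: "?X \<subseteq> tuples K n" using F(1) by (auto simp: Dset_def)
  have X: "?X \<in> Dset H K n"
    unfolding Dset_def
  proof (intro CollectI conjI exI[of _ ?A])
    show "supports H ?A ?X"
      unfolding supports_def
    proof (intro ballI impI subsetI)
      fix g y assume g: "g \<in> H" "\<forall>a\<in>?A. g a = a" and "y \<in> map g ` ?X"
      then obtain i x where "i \<in> I" "x \<in> F i" "y = map g x" by blast
      then show "y \<in> ?X" using map_F[of i x g] g by blast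
    qed
  qed (use sub fA in auto)
  have Y: "?Y \<in> Dset H K 1"
    by (rule points) simp
  have graph: "{x @ f x | x. x \<in> ?X} = {x @ [c i] | x i. i \<in> I \<and> x \<in> F i}"
  proof (intro equalityI subsetI)
    fix z assume "z \<in> {x @ f x | x. x \<in> ?X}"
    then obtain x i where "z = x @ f x" "i \<in> I" "x \<in> F i" by blast
    then show "z \<in> {x @ [c i] | x i. i \<in> I \<and> x \<in> F i}" using f[of i x] by blast
  next
    fix z assume "z \<in> {x @ [c i] | x i. i \<in> I \<and> x \<in> F i}"
    then obtain x i where "z = x @ [c i]" "i \<in> I" "x \<in> F i" by blast
    then show "z \<in> {x @ f x | x. x \<in> ?X}" using f[of i x] by fastforce
  qed
  have G: "{x @ f x | x. x \<in> ?X} \<in> Dset H K (n + 1)"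
    unfolding graph Dset_def
  proof (intro CollectI conjI exI[of _ ?A])
    show "{x @ [c i] |x i. i \<in> I \<and> x \<in> F i} \<subseteq> tuples K (n + 1)"
    proof safe
      fix x i assume i: "i \<in> I" "x \<in> F i"
      then have "x \<in> tuples K n" using sub by blast
      then show "x @ [c i] \<in> tuples K (n + 1)" using c_mem[OF i(1)] by (simp add: tuples_def)
    qed
    show "supports H ?A {x @ [c i] |x i. i \<in> I \<and> x \<in> F i}"
      unfolding supports_def
    proof (intro ballI impI, safe)
      fix g x i assume "g \<in> H" "\<forall>a\<in>?A. g a = a" "i \<in> I" "x \<in> F i"
      then show "\<exists>x' i'. map g (x @ [c i]) = x' @ [c i'] \<and> i' \<in> I \<and> x' \<in> F i'"
        using map_F[of i x g] gc[of i g] by (intro exI[of _ "map g x"] exI[of _ i]) simp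
    qed
  qed (use fA in auto)
  have ne: "?X \<noteq> {}" using I F(2) by auto
  have fX: "f ` ?X = ?Y" using f F(2) by (fastforce simp: image_iff)
  have fib: "{x \<in> ?X. f x = [c i]} = F i" if "i \<in> I" for i
    using that f c_inj by fastforce
  let ?B = "\<lambda>b. h {x \<in> ?X. f x = b}"
  have "h ?X = osum (?B ` ?Y) (\<lambda>p. otimes p (h {b \<in> ?Y. ?B b = p}))"
    by (rule fubini[OF X Y ne fX G])
  also have "\<dots> = osum (?B ` ?Y) (\<lambda>p. otimes p (0, real (card {b \<in> ?Y. ?B b = p})))"
  proof (intro osum_cong refl arg_cong2[where f = otimes])
    fix p
    let ?S = "{b \<in> ?Y. ?B b = p}"
    have "?S \<in> Dset H K 1"
      by (rule points) auto
    then show "h ?S = (0, real (card ?S))" by (rule finite_sets) (use I in auto)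
  qed
  also have "\<dots> = osum ?Y ?B" by (rule osum_otimes_card) (use I in auto)
  also have "\<dots> = osum I (\<lambda>i. ?B [c i])"
    by (rule osum_reindex) (use c_inj in \<open>auto simp: inj_on_def\<close>)
  also have "\<dots> = osum I (\<lambda>i. h (F i))" using fib by (intro osum_cong) auto
  finally show ?thesis .
qed

text \<open>Fubini for the map that sends a conjugate of \<open>c\<close> to the matching conjugate
  of \<open>b\<close>. The fibres are conjugates of one orbit, so by invariance the sum has a single
  term, a product.\<close>

lemma meas_chain:
  assumes c: "c \<in> tuples K n" and b: "b \<in> tuples K k" and A: "finite A" "A \<subseteq> K"
    and dcl: "\<And>g. g \<in> H \<Longrightarrow> \<forall>a\<in>A \<union> set c. g a = a \<Longrightarrow> map g b = b"
  shows "h (orb H A c) = otimes (h (orb H A b)) (h (orb H (A \<union> set b) c))"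
proof -
  let ?X = "orb H A c" and ?Y = "orb H A b"
  define f where "f x = map (SOME g. g \<in> H \<and> (\<forall>a\<in>A. g a = a) \<and> map g c = x) b" for x
  have f: "f (map g c) = map g b" if g: "g \<in> H" "\<forall>a\<in>A. g a = a" for g
  proof -
    let ?P = "\<lambda>k. k \<in> H \<and> (\<forall>a\<in>A. k a = a) \<and> map k c = map g c"
    have "?P (SOME k. ?P k)"
      by (rule someI[where P = ?P and x = g]) (use g in blast)
    moreover have "f (map g c) = map (SOME k. ?P k) b" by (simp add: f_def)
    ultimately have "\<exists>k. ?P k \<and> f (map g c) = map k b" by blast
    then obtain k where k: "k \<in> H" "\<forall>a\<in>A. k a = a" "map k c = map g c" "f (map g c) = map k b"
      by blast
    let ?k = "\<lambda>x. inv g (k x)"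
    \<comment> \<open>The chosen group element and \<open>g\<close> differ by one that fixes
      \<open>A\<close> and \<open>c\<close>, hence also \<open>b\<close>; so \<open>f\<close> does
      not depend on the choice.\<close>
    have "map ?k b = b"
    proof (rule dcl)
      show "?k \<in> H" by (rule comp_mem[OF inv_mem[OF g(1)] k(1)])
      have "map ?k c = map (inv g) (map k c)" by simp
      also have "\<dots> = c" using g(1) by (simp only: k(3) map_inv_simps(1))
      finally have "\<forall>a\<in>set c. ?k a = a" by (metis map_eq_conv map_ident)
      moreover have "\<forall>a\<in>A. ?k a = a" using k(2) g by (simp add: inv_fix)
      ultimately show "\<forall>a\<in>A \<union> set c. ?k a = a" by blast
    qed
    then have "map (inv g) (map k b) = b" by (simp add: o_def)
    then have "map k b = map g b" using map_inv_simps(2)[OF g(1), of "map k b"] by simp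
    then show ?thesis using k(4) by simp
  qed
  have X: "?X \<in> Dset H K n" and Y: "?Y \<in> Dset H K k" using orb_Dset c b A by auto
  have graph: "{x @ f x | x. x \<in> ?X} = orb H A (c @ b)"
  proof (intro equalityI subsetI)
    fix z assume "z \<in> {x @ f x | x. x \<in> ?X}"
    then obtain g where "g \<in> H" "\<forall>a\<in>A. g a = a" "z = map g c @ f (map g c)"
      by (auto simp: orb_def)
    then show "z \<in> orb H A (c @ b)" using f[of g] orbI[of g A "c @ b"] by simp
  next
    fix z assume "z \<in> orb H A (c @ b)"
    then obtain g where g: "g \<in> H" "\<forall>a\<in>A. g a = a" "z = map g c @ map g b"
      by (auto simp: orb_def)
    then show "z \<in> {x @ f x | x. x \<in> ?X}" using f[OF g(1,2)] orbI[OF g(1,2), of c] by force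
  qed
  have G: "{x @ f x | x. x \<in> ?X} \<in> Dset H K (n + k)"
    unfolding graph using c b A by (intro orb_Dset) (auto simp: tuples_def)
  have fX: "f ` ?X = ?Y"
  proof (intro equalityI subsetI)
    fix y assume "y \<in> f ` ?X"
    then obtain g where "g \<in> H" "\<forall>a\<in>A. g a = a" "y = f (map g c)" by (auto simp: orb_def)
    then show "y \<in> ?Y" using f[of g] orbI[of g A b] by simp
  next
    fix y assume "y \<in> ?Y"
    then obtain g where g: "g \<in> H" "\<forall>a\<in>A. g a = a" "y = map g b" by (auto simp: orb_def)
    then show "y \<in> f ` ?X" using f[OF g(1,2)] orbI[OF g(1,2), of c] by force
  qed
  let ?p = "h (orb H (A \<union> set b) c)"
  have fib: "h {x \<in> ?X. f x = y} = ?p" if y: "y \<in> ?Y" for y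
  proof -
    obtain g where g: "g \<in> H" "\<forall>a\<in>A. g a = a" "y = map g b" using y by (rule orbE)
    have "{x \<in> ?X. f x = y} = map g ` orb H (A \<union> set b) c"
    proof (intro equalityI subsetI)
      fix x assume "x \<in> {x \<in> ?X. f x = y}"
      then obtain k where k: "k \<in> H" "\<forall>a\<in>A. k a = a" "x = map k c" "f x = map g b" using g(3) by (auto elim: orbE)
      then have "map k b = map g b" using f by simp
      then have "map (inv g) (map k b) = b" using g(1) by (simp only: map_inv_simps(1))
      then have "map (\<lambda>x. inv g (k x)) b = b" by (simp add: o_def)
      then have fb: "\<forall>a\<in>set b. inv g (k a) = a" by (metis map_eq_conv map_ident)
      have "map (\<lambda>x. inv g (k x)) c \<in> orb H (A \<union> set b) c"
      proof (rule orbI)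
        show "(\<lambda>x. inv g (k x)) \<in> H" by (rule comp_mem[OF inv_mem[OF g(1)] k(1)])
        show "\<forall>a\<in>A \<union> set b. inv g (k a) = a" using fb g k by (auto simp: inv_fix)
      qed
      moreover have "map g (map (\<lambda>x. inv g (k x)) c) = x" using g k by simp
      ultimately show "x \<in> map g ` orb H (A \<union> set b) c" by blast
    next
      fix x assume "x \<in> map g ` orb H (A \<union> set b) c"
      then obtain k where k: "k \<in> H" "\<forall>a\<in>A \<union> set b. k a = a" "x = map g (map k c)" by (auto elim: orbE)
      have gk: "(\<lambda>x. g (k x)) \<in> H" "\<forall>a\<in>A. g (k a) = a"
        using comp_mem[OF g(1) k(1)] g k by auto
      have x: "x = map (\<lambda>x. g (k x)) c" using k by simp
      have "map (\<lambda>x. g (k x)) b = map g b" using k(2) by simp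
      then show "x \<in> {x \<in> ?X. f x = y}" using f[OF gk] orbI[OF gk] x g(3) by simp
    qed
    moreover have "orb H (A \<union> set b) c \<in> Dset H K n"
      using c b A by (intro orb_Dset) (auto simp: tuples_def)
    ultimately show ?thesis using invariant g(1) by simp
  qed
  have "h ?X = osum ((\<lambda>y. h {x \<in> ?X. f x = y}) ` ?Y) (\<lambda>p. otimes p (h {y \<in> ?Y. h {x \<in> ?X. f x = y} = p}))"
    by (rule fubini[OF X Y _ fX G]) (use orb_refl in blast)
  also have "(\<lambda>y. h {x \<in> ?X. f x = y}) ` ?Y = {?p}"
  proof -
    have "(\<lambda>y. h {x \<in> ?X. f x = y}) ` ?Y = (\<lambda>_. ?p) ` ?Y" by (rule image_cong) (use fib in auto)
    moreover have "?Y \<noteq> {}" using orb_refl by blast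
    ultimately show ?thesis by (simp only: image_constant_conv if_False)
  qed
  also have "osum {?p} (\<lambda>p. otimes p (h {y \<in> ?Y. h {x \<in> ?X. f x = y} = p})) =
      otimes ?p (h {y \<in> ?Y. h {x \<in> ?X. f x = y} = ?p})" by simp
  also have "{y \<in> ?Y. h {x \<in> ?X. f x = y} = ?p} = ?Y" using fib by auto
  finally show ?thesis by (simp add: otimes_commute)
qed

text \<open>The bound by 1 comes from splitting the universe into \<open>X\<close> and its
  complement. Dimension 0 is impossible: splitting off a finite subset with more points than the
  measure of \<open>X\<close> would exceed that measure.\<close>

lemma infinite_dim1:
  assumes K1: "fst (h (tuples K 1)) = 1" and X: "X \<in> Dset H K 1" "infinite X"
  shows "fst (h X) = 1"
proof -
  let ?K = "tuples K 1"
  have diff: "Y - F \<in> Dset H K 1" if YF: "Y \<in> Dset H K 1" "F \<in> Dset H K 1" for Y F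
  proof -
    obtain A where A: "finite A" "A \<subseteq> K" "supports H A Y" using YF(1) by (auto simp: Dset_def)
    obtain B where B: "finite B" "B \<subseteq> K" "supports H B F" using YF(2) by (auto simp: Dset_def)
    note * = A B
    have "supports H (A \<union> B) Y" "supports H (A \<union> B) F"
      using supports_mono[OF A(3), of "A \<union> B"] supports_mono[OF B(3), of "A \<union> B"] by auto
    then have "supports H (A \<union> B) (Y - F)"
      unfolding supports_def[of H _ "Y - F"] using supports_map_iff[of "A \<union> B"] by blast
    moreover have "finite (A \<union> B)" "A \<union> B \<subseteq> K" using * by auto
    ultimately show ?thesis using YF(1) by (auto simp: Dset_def)
  qed
  have split: "h Y = osum {True, False} (\<lambda>i. h (if i then F else Y - F))"
    if "Y \<in> Dset H K 1" "F \<in> Dset H K 1" "F \<subseteq> Y" "F \<noteq> {}" "F \<noteq> Y" for Y F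
  proof -
    have "h (\<Union>i\<in>{True, False}. if i then F else Y - F) = osum {True, False} (\<lambda>i. h (if i then F else Y - F))"
      by (rule meas_partition[where n = 1]) (use that diff in auto)
    moreover have "(\<Union>i\<in>{True, False}. if i then F else Y - F) = Y" using that by auto
    ultimately show ?thesis by simp
  qed
  have K: "?K \<in> Dset H K 1" by (auto simp: Dset_def supports_def intro: maps_tuples)
  have le: "fst (h X) \<le> 1"
  proof (cases "X = ?K")
    case False
    have ne: "X \<noteq> {}" using X(2) by auto
    have s: "h ?K = osum {True, False} (\<lambda>i. h (if i then X else ?K - X))"
      by (rule split) (use K X ne False in \<open>auto simp: Dset_def\<close>)
    have "fst (h (if True then X else ?K - X)) \<le> fst (osum {True, False} (\<lambda>i. h (if i then X else ?K - X)))"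
      by (rule osum_ge) auto
    then show ?thesis using K1 s by simp
  qed (use K1 in simp)
  have "fst (h X) \<noteq> 0"
  proof
    assume 0: "fst (h X) = 0"
    obtain m :: nat where m: "snd (h X) < real m" using reals_Archimedean2 by blast
    obtain F where F: "F \<subseteq> X" "finite F" "card F = Suc m" using infinite_arbitrarily_large[OF X(2)] by metis
    have FK: "F \<subseteq> ?K" using F(1) X by (auto simp: Dset_def)
    have FD: "F \<in> Dset H K 1"
      unfolding Dset_def
    proof (intro CollectI conjI exI[of _ "\<Union>x\<in>F. set x"])
      show "supports H (\<Union>x\<in>F. set x) F"
        unfolding supports_def
      proof (intro ballI impI, safe)
        fix g x assume "\<forall>a\<in>\<Union> (set ` F). g a = a" "x \<in> F"
        then have "map g x = x" by (intro map_idI) blast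
        then show "map g x \<in> F" using \<open>x \<in> F\<close> by simp
      qed
    qed (use FK F in \<open>auto simp: tuples_def\<close>)
    let ?f = "\<lambda>i. h (if i then F else X - F)"
    have s: "h X = osum {True, False} ?f"
      by (rule split) (use FD F X in auto)
    have bound: "fst (?f i) \<le> fst (osum {True, False} ?f)" if "i \<in> {True, False}" for i
      by (rule osum_ge) (use that in auto)
    have s0: "fst (osum {True, False} ?f) = 0" using s 0 by simp
    have z: "fst (?f i) = 0" if "i \<in> {True, False}" for i
      using bound[OF that] unfolding s0 by (simp only: le_zero_eq)
    have "{i. i \<in> {True, False} \<and> fst (?f i) = fst (osum {True, False} ?f)} = {True, False}"
      using z s 0 by auto
    then have "snd (h X) = snd (h F) + snd (h (X - F))"
      unfolding s snd_osum by simp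
    moreover have "snd (h F) = real (Suc m)" using finite_sets[OF FD F(2)] F(3) by simp
    moreover have "snd (h (X - F)) \<ge> 0" using positive[OF diff[OF X(1) FD]] by auto
    ultimately show False using m by simp
  qed
  with le show ?thesis by simp
qed

end

section \<open>Nil-interaction coordinatized structures\<close>

lemma proj_simps [simp]: "length (proj a) = length a" "proj (take k a) = take k (proj a)"
  "proj (butlast a) = butlast (proj a)" "proj [] = []" "proj (a @ b) = proj a @ proj b"
  by (simp_all add: proj_def take_map map_butlast)

lemma prefix_iff_take: "prefix a b \<longleftrightarrow> a = take (length a) b"
  by (metis append_eq_conv_conj prefix_def take_is_prefix)

lemma prefix_butlast: "prefix a' a \<Longrightarrow> a' \<noteq> a \<Longrightarrow> prefix a' (butlast a)"
  by (cases a rule: rev_cases) (auto simp: prefix_snoc)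

section \<open>Combinatorics of the tree and of tree closure\<close>

locale tree_nodes =
  fixes \<Gamma> :: "nat list set" and lam :: "nat list \<Rightarrow> enat" and S :: "'s set"
  assumes plan: "tree_plan \<Gamma> lam"
begin

abbreviation "V \<equiv> nodes \<Gamma> lam S"
abbreviation "cl \<equiv> tcl \<Gamma> lam S"
abbreviation "infn a \<equiv> proj a \<in> inf_nodes \<Gamma> lam"

text \<open>A component is addressed by its common predecessor and projection instead of a member,
  so that such pairs can index products over components.\<close>

definition K :: "'s node \<Rightarrow> nat list \<Rightarrow> 's node set" where
  "K u \<sigma> = {a \<in> V. butlast a = u \<and> proj a = \<sigma>}"

lemma plan_simps: "finite \<Gamma>" "[] \<in> \<Gamma>" "lam [] = 1" "\<sigma> \<in> \<Gamma> \<Longrightarrow> prefix \<tau> \<sigma> \<Longrightarrow> \<tau> \<in> \<Gamma>"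
  "\<sigma> \<in> \<Gamma> \<Longrightarrow> lam \<sigma> = 1 \<or> lam \<sigma> = \<infinity>"
  using plan unfolding tree_plan_def by (blast, blast, blast, blast, metis)

lemma component_eq: "component \<Gamma> lam S e = K (butlast e) (proj e)"
  by (auto simp: component_def K_def)

lemma Nil_V [simp]: "[] \<in> V"
  using plan_simps by (simp add: nodes_def)

lemma take_V: "a \<in> V \<Longrightarrow> take k a \<in> V"
  using plan_simps(4)[of "proj a" "take k (proj a)"]
  by (auto simp: nodes_def take_is_prefix min_def)

lemma prefix_V: "a \<in> V \<Longrightarrow> prefix b a \<Longrightarrow> b \<in> V"
  by (metis prefix_iff_take take_V)

lemma butlast_V: "a \<in> V \<Longrightarrow> butlast a \<in> V"
  by (simp add: butlast_conv_take take_V)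

lemma infn_not_Nil: "infn a \<Longrightarrow> a \<noteq> []"
  using plan_simps by (auto simp: inf_nodes_def)

lemma infn_or_1: "a \<in> V \<Longrightarrow> infn a \<or> lam (proj a) = 1"
  using plan_simps(5)[of "proj a"] by (auto simp: nodes_def inf_nodes_def)

lemma infn_not_1: "infn a \<Longrightarrow> lam (proj a) \<noteq> 1"
  by (auto simp: inf_nodes_def)

text \<open>At a node with \<open>lam\<close> value 1 the last entry carries \<open>None\<close>, so
  its remaining half is read off the projection.\<close>

lemma node_eqI:
  assumes "a \<in> V" "a' \<in> V" "butlast a = butlast a'" "proj a = proj a'" "lam (proj a) = 1"
  shows "a = a'"
proof (cases "a = []")
  case True
  then show ?thesis using assms(4) by (metis length_0_conv proj_simps(1,4))
next
  case False
  have len: "length a = length a'" using assms(4) by (metis proj_simps(1))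
  then have ne: "a' \<noteq> []" using False by auto
  have last_None: "snd (last b) = None" if "b \<in> V" "b \<noteq> []" "lam (proj b) = 1" for b
  proof -
    have "\<forall>k<length b. lam (proj (take (Suc k) b)) = 1 \<longrightarrow> snd (b ! k) = None"
      using that(1) by (auto simp: nodes_def)
    from this[rule_format, of "length b - 1"] show ?thesis using that(2,3) by (simp add: last_conv_nth)
  qed
  have "fst (last a) = last (proj a)" "fst (last a') = last (proj a')"
    using False ne by (simp_all add: proj_def last_map)
  then have "last a = last a'"
    using last_None assms False ne by (intro prod_eqI) auto
  then show ?thesis using assms(3) False ne by (metis append_butlast_last_id)
qed

lemma cl_Nil: "[] \<in> cl B"
  unfolding tcl_def by (auto intro!: exI[of _ 0])

lemma cl_below: "a \<in> V \<Longrightarrow> b \<in> B \<Longrightarrow> prefix a b \<Longrightarrow> a \<in> cl B"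
  unfolding tcl_def by (auto intro!: exI[of _ 0])

lemma cl_step:
  assumes "a \<in> V" "lam (proj a) = 1" "butlast a \<in> cl B"
  shows "a \<in> cl B"
proof -
  obtain n where "butlast a \<in> tcl_step \<Gamma> lam S B n" using assms(3) by (auto simp: tcl_def)
  then have "a \<in> tcl_step \<Gamma> lam S B (Suc n)" using assms(1,2) by simp
  then show ?thesis unfolding tcl_def by blast
qed

lemma cl_induct [consumes 1, case_names Nil below step]:
  assumes "a \<in> cl B" "P []" "\<And>a b. a \<in> V \<Longrightarrow> b \<in> B \<Longrightarrow> prefix a b \<Longrightarrow> P a"
    "\<And>a. a \<in> V \<Longrightarrow> lam (proj a) = 1 \<Longrightarrow> butlast a \<in> cl B \<Longrightarrow> P (butlast a) \<Longrightarrow> P a"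
  shows "P a"
proof -
  obtain n where "a \<in> tcl_step \<Gamma> lam S B n" using assms(1) by (auto simp: tcl_def)
  then show ?thesis
  proof (induction n arbitrary: a)
    case 0
    then show ?case using assms(2,3) by auto
  next
    case (Suc n)
    then consider "a \<in> tcl_step \<Gamma> lam S B n"
      | "a \<in> V" "lam (proj a) = 1" "butlast a \<in> tcl_step \<Gamma> lam S B n" by auto
    then show ?case
    proof cases
      case 2
      then have "butlast a \<in> cl B" by (auto simp: tcl_def)
      then show ?thesis using assms(4) 2 Suc.IH by blast
    qed (rule Suc.IH)
  qed
qed

lemma cl_V: "cl B \<subseteq> V"
proof
  fix a assume "a \<in> cl B" then show "a \<in> V" by (induction rule: cl_induct) auto
qed

lemma cl_extensive: "B \<subseteq> V \<Longrightarrow> B \<subseteq> cl B"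
  using cl_below by blast

lemma cl_prefix: "a \<in> cl B \<Longrightarrow> prefix a' a \<Longrightarrow> a' \<in> cl B"
proof (induction arbitrary: a' rule: cl_induct)
  case Nil
  then show ?case by (simp add: cl_Nil)
next
  case (below a b)
  then show ?case by (metis cl_below prefix_V prefix_order.trans)
next
  case (step a)
  show ?case
  proof (cases "a' = a")
    case True then show ?thesis using step cl_step by blast
  next
    case False
    then have "prefix a' (butlast a)" using step.prems prefix_butlast by blast
    then show ?thesis using step.IH by blast
  qed
qed

lemma cl_least: "B \<subseteq> cl C \<Longrightarrow> cl B \<subseteq> cl C"
proof
  fix a assume "B \<subseteq> cl C" "a \<in> cl B"
  from this(2,1) show "a \<in> cl C"
    by (induction rule: cl_induct) (auto intro: cl_Nil cl_prefix cl_step)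
qed

lemma cl_mono: "B \<subseteq> C \<Longrightarrow> C \<subseteq> V \<Longrightarrow> cl B \<subseteq> cl C"
  using cl_least cl_extensive by blast

lemma cl_idem [simp]: "cl (cl B) = cl B"
  using cl_least[of "cl B" B] cl_extensive[OF cl_V] by blast

text \<open>The closure steps add only nodes with \<open>lam\<close> value 1; infinity-nodes must
  come from the initial stage.\<close>

lemma cl_infn: "a \<in> cl B \<Longrightarrow> infn a \<Longrightarrow> \<exists>b\<in>B. prefix a b"
  by (induction rule: cl_induct) (use infn_not_Nil infn_not_1 in blast)+

text \<open>Every stage is finite because an added node is determined by its predecessor and its
  projection in the finite \<open>\<Gamma>\<close>. A node of length \<open>l\<close> is present by
  stage \<open>l\<close>, so the height of \<open>\<Gamma>\<close> bounds the number of
  stages.\<close>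

lemma cl_finite:
  assumes "finite B"
  shows "finite (cl B)"
proof -
  have 1: "finite (tcl_step \<Gamma> lam S B n)" for n
  proof (induction n)
    case 0
    have "{a \<in> V. \<exists>b\<in>B. prefix a b} \<subseteq> (\<Union>b\<in>B. set (prefixes b))" by auto
    then have "finite {a \<in> V. \<exists>b\<in>B. prefix a b}" by (rule finite_subset) (use assms in auto)
    then show ?case by simp
  next
    case (Suc n)
    let ?X = "{a \<in> V. lam (proj a) = 1 \<and> butlast a \<in> tcl_step \<Gamma> lam S B n}"
    have "inj_on (\<lambda>a. (butlast a, proj a)) ?X" by (auto simp: inj_on_def intro: node_eqI)
    moreover have "(\<lambda>a. (butlast a, proj a)) ` ?X \<subseteq> tcl_step \<Gamma> lam S B n \<times> \<Gamma>" by (auto simp: nodes_def)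
    ultimately have "finite ?X" using Suc plan_simps(1) by (meson finite_SigmaI finite_subset inj_on_finite)
    then show ?case using Suc by simp
  qed
  have mono: "tcl_step \<Gamma> lam S B m \<subseteq> tcl_step \<Gamma> lam S B n" if "m \<le> n" for m n
    using that by (induction rule: dec_induct) auto
  obtain N where N: "\<And>\<sigma>. \<sigma> \<in> \<Gamma> \<Longrightarrow> length \<sigma> \<le> N"
    using plan_simps(1) by (metis finite_imageI finite_nat_set_iff_bounded_le image_eqI)
  have "a \<in> tcl_step \<Gamma> lam S B (length a)" if "a \<in> cl B" for a
    using that
  proof (induction rule: cl_induct)
    case (below a b)
    then have "a \<in> tcl_step \<Gamma> lam S B 0" by auto
    then show ?case using mono by blast
  next
    case (step a)
    then show ?case by (cases a rule: rev_cases) auto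
  qed auto
  moreover have "length a \<le> N" if "a \<in> cl B" for a
    using N[of "proj a"] cl_V that by (auto simp: nodes_def)
  ultimately have "cl B \<subseteq> tcl_step \<Gamma> lam S B N" using mono by blast
  then show ?thesis using 1 finite_subset by blast
qed

text \<open>A shortest element of the difference has its predecessor in \<open>A\<close>; it is an
  infinity-node, since otherwise closedness would put it into \<open>A\<close>. This allows
  induction by one infinity-node at a time.\<close>

lemma cl_generate:
  assumes "cl A = A" "cl B = B" "A \<subseteq> B" "A \<noteq> B"
  shows "\<exists>e\<in>B - A. infn e \<and> butlast e \<in> A"
proof -
  obtain e where e: "e \<in> B - A" "\<And>e'. e' \<in> B - A \<Longrightarrow> length e \<le> length e'"
    using assms(3,4) ex_has_least_nat[of "\<lambda>e. e \<in> B - A" _ length] by blast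
  have "e \<noteq> []" using e(1) assms(1) cl_Nil by auto
  moreover have "butlast e \<in> B" using e(1) assms(2) cl_prefix[of e B "butlast e"] by (auto simp: prefixeq_butlast)
  ultimately have be: "butlast e \<in> A" using e(2)[of "butlast e"] by (cases e rule: rev_cases) auto
  have "e \<in> V" using e(1) assms(2) cl_V by blast
  then have "infn e" using infn_or_1[of e] cl_step[of e A] be e(1) assms(1) by auto
  then show ?thesis using e(1) be by blast
qed

text \<open>Whatever lies strictly below \<open>e\<close> lies below \<open>butlast e\<close> and so
  in the closed set \<open>A\<close>; hence only one component changes its trace.\<close>

lemma cl_insert_infn:
  assumes "cl A = A" "butlast e \<in> A" "a \<in> cl (insert e A)" "infn a"
  shows "a = e \<or> a \<in> A"
proof -
  obtain b where b: "b \<in> insert e A" "prefix a b" using cl_infn[OF assms(3,4)] by blast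
  show ?thesis
  proof (cases "b = e")
    case True
    show ?thesis
    proof (cases "a = e")
      case False
      then have "prefix a (butlast e)" using b(2) True prefix_butlast by blast
      then show ?thesis using cl_prefix[of "butlast e" A a] assms(1,2) by simp
    qed simp
  next
    case False
    then show ?thesis using b assms(1) cl_prefix[of b A a] by auto
  qed
qed

lemma tree_is_struct: "is_struct (tree_lang \<Gamma>) (tree_struc \<Gamma> lam S)"
proof -
  have "longest_common_prefix a b \<in> V" if "a \<in> V" for a b :: "'s node"
    using that prefix_V longest_common_prefix_prefix1 by blast
  moreover have "V \<noteq> {}" using Nil_V by blast
  moreover have "xs ! i \<in> V" if "set xs \<subseteq> V" "i < length xs" for xs :: "'s node list" and i
    using that nth_mem by blast
  ultimately show ?thesis
    by (auto simp: is_struct_def tree_struc_def tree_lang_def tuples_def butlast_V split: tree_fun.splits)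
qed

text \<open>The witness swaps the cones above \<open>e\<close> and \<open>e'\<close>.\<close>

lemma tree_swap:
  assumes e: "e \<in> V" "e' \<in> K (butlast e) (proj e)" "infn e"
  obtains \<tau> where "iso (tree_lang \<Gamma>) (tree_struc \<Gamma> lam S) (tree_struc \<Gamma> lam S) \<tau>" "\<tau> e = e'"
    "\<And>c. \<not> prefix e c \<Longrightarrow> \<not> prefix e' c \<Longrightarrow> \<tau> c = c"
proof -
  define u where "u = butlast e"
  define n where "n = length u"
  define p p' where "p = last e" and "p' = last e'"
  have e': "e' \<in> V" "butlast e' = u" "proj e' = proj e" using e(2) by (auto simp: K_def u_def)
  have ne: "e \<noteq> []" "e' \<noteq> []" using infn_not_Nil[of e] infn_not_Nil[of e'] e(3) e'(3) by auto
  have e_eq: "e = u @ [p]" "e' = u @ [p']"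
    using append_butlast_last_id[OF ne(1)] append_butlast_last_id[OF ne(2)] e'(2)
    by (simp_all add: u_def p_def p'_def)
  have fst_p: "fst p = fst p'" using e'(3) by (simp add: e_eq proj_def)
  define t where "t x = (if x = p then p' else if x = p' then p else x)" for x
  have tt: "t (t x) = x" for x by (auto simp: t_def)
  have fst_t: "fst (t x) = fst x" for x using fst_p by (auto simp: t_def)
  \<comment> \<open>Position \<open>n\<close> comes right after the common predecessor
    \<open>u\<close>; only this entry changes, and only in nodes strictly above
    \<open>u\<close>.\<close>
  define \<tau> where "\<tau> a = (if n < length a \<and> take n a = u then a[n := t (a ! n)] else a)" for a
  have len: "length (\<tau> a) = length a" for a by (simp add: \<tau>_def)
  have take_\<tau>: "take k (\<tau> a) = \<tau> (take k a)" for k a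
    by (cases "k \<le> n") (auto simp: \<tau>_def take_update_swap list_update_beyond min_def not_le)
  have \<tau>\<tau>: "\<tau> (\<tau> a) = a" for a
    by (cases "n < length a \<and> take n a = u") (auto simp: \<tau>_def tt)
  have proj_\<tau>: "proj (\<tau> a) = proj a" for a
  proof (rule nth_equalityI)
    show "proj (\<tau> a) ! i = proj a ! i" if "i < length (proj (\<tau> a))" for i
      using that by (auto simp: proj_def \<tau>_def nth_list_update fst_t)
  qed (simp add: len)
  have \<tau>V: "\<tau> a \<in> V" if a: "a \<in> V" for a
  proof -
    have "(lam (proj (take (Suc k) (\<tau> a))) = 1 \<longrightarrow> snd (\<tau> a ! k) = None) \<and>
       (lam (proj (take (Suc k) (\<tau> a))) = \<infinity> \<longrightarrow> snd (\<tau> a ! k) \<in> Some ` S)" if k: "k < length a" for k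
    proof (cases "\<tau> a ! k = a ! k")
      case True
      then show ?thesis using a k by (auto simp: nodes_def proj_\<tau>)
    next
      case False
      then have c: "k = n" "take n a = u" "t (a ! n) \<noteq> a ! n" "\<tau> a ! n = t (a ! n)"
        using k by (auto simp: \<tau>_def nth_list_update split: if_splits)
      \<comment> \<open>Changed entries are \<open>p\<close> or \<open>p'\<close>, and these carry
        letters of \<open>S\<close> because \<open>e\<close> and \<open>e'\<close> are
        infinity-nodes.\<close>
      have last_S: "snd x \<in> Some ` S" if "u @ [x] \<in> V" "proj (u @ [x]) = proj e" for x
      proof -
        have "lam (proj (take (Suc n) (u @ [x]))) = \<infinity>" using that(2) e(3) by (simp add: n_def inf_nodes_def del: proj_simps(5))
        moreover have "\<forall>k<length (u @ [x]). lam (proj (take (Suc k) (u @ [x]))) = \<infinity> \<longrightarrow> snd ((u @ [x]) ! k) \<in> Some ` S"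
          using that(1) unfolding nodes_def by blast
        ultimately show ?thesis by (metis length_append_singleton lessI n_def nth_append_length)
      qed
      have pS: "snd p \<in> Some ` S" "snd p' \<in> Some ` S"
        using last_S[of p] last_S[of p'] e(1) e' by (auto simp: e_eq simp del: proj_simps(5))
      have an: "a ! n = p \<or> a ! n = p'" using c(3) by (auto simp: t_def split: if_splits)
      have "take (Suc n) a = u @ [a ! n]" using c k by (simp add: take_Suc_conv_app_nth)
      then have "proj (take (Suc n) (\<tau> a)) = proj e"
        using an e_eq e'(3) by (metis proj_\<tau> proj_simps(2))
      moreover have "snd (\<tau> a ! n) \<in> Some ` S" using an pS c(4) by (auto simp: t_def)
      ultimately show ?thesis using e(3) c(1) by (auto simp: inf_nodes_def)
    qed
    then show ?thesis using a by (auto simp: nodes_def proj_\<tau> len)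
  qed
  have pre: "prefix (\<tau> a) (\<tau> b)" if "prefix a b" for a b
    using that by (metis len prefix_iff_take take_\<tau>)
  have pre_iff: "prefix (\<tau> a) (\<tau> b) \<longleftrightarrow> prefix a b" for a b using pre \<tau>\<tau> by metis
  have lcp: "\<tau> (longest_common_prefix a b) = longest_common_prefix (\<tau> a) (\<tau> b)" for a b
  proof (rule prefix_order.antisym)
    show "prefix (\<tau> (longest_common_prefix a b)) (longest_common_prefix (\<tau> a) (\<tau> b))"
      by (intro longest_common_prefix_max_prefix pre longest_common_prefix_prefix1 longest_common_prefix_prefix2)
    have "prefix (\<tau> (longest_common_prefix (\<tau> a) (\<tau> b))) (longest_common_prefix a b)"
      by (rule longest_common_prefix_max_prefix)
        (use pre[OF longest_common_prefix_prefix1] pre[OF longest_common_prefix_prefix2] \<tau>\<tau> in metis)+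
    then show "prefix (longest_common_prefix (\<tau> a) (\<tau> b)) (\<tau> (longest_common_prefix a b))"
      using pre \<tau>\<tau> by metis
  qed
  have bl: "\<tau> (butlast a) = butlast (\<tau> a)" for a by (simp add: butlast_conv_take take_\<tau> len)
  have "\<tau> [] = []" by (simp add: \<tau>_def)
  have "bij_betw \<tau> V V" by (rule bij_betw_byWitness[of _ \<tau>]) (auto simp: \<tau>\<tau> intro: \<tau>V)
  then have "iso (tree_lang \<Gamma>) (tree_struc \<Gamma> lam S) (tree_struc \<Gamma> lam S) \<tau>"
    by (auto simp: iso_def tree_struc_def tree_lang_def tuples_def lcp bl pre_iff proj_\<tau> \<open>\<tau> [] = []\<close>
        split: tree_fun.splits tree_rel.splits if_splits)
  moreover have "\<tau> e = e'" by (simp add: \<tau>_def e_eq n_def t_def)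
  moreover have "\<tau> c = c" if "\<not> prefix e c" "\<not> prefix e' c" for c
  proof (cases "n < length c \<and> take n c = u")
    case True
    then have "take (Suc n) c = u @ [c ! n]" by (simp add: take_Suc_conv_app_nth)
    then have "prefix (u @ [c ! n]) c" by (metis take_is_prefix)
    then have "c ! n \<noteq> p" "c ! n \<noteq> p'" using that e_eq by auto
    then show ?thesis by (simp add: \<tau>_def t_def)
  qed (auto simp: \<tau>_def)
  ultimately show ?thesis using that by blast
qed

end

text \<open>Only the last clause is rewritten, into the leading-term form of Fubini.\<close>

lemma MS_measurable_iff:
  "MS_measurable L N h \<longleftrightarrow> infinite (univ N) \<and>
     (\<forall>n. \<forall>X\<in>Def_sets L N n. h X = (0, 0) \<or> snd (h X) > 0) \<and>
     (\<forall>n m. \<forall>\<phi>\<in>formulas L (n + m). \<exists>D. finite D \<and>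
        (\<forall>as\<in>tuples (univ N) m. h (solset N n \<phi> as) \<in> D)) \<and>
     (\<forall>n m. \<forall>\<phi>\<in>formulas L (n + m). \<forall>as\<in>tuples (univ N) m. finite (solset N n \<phi> as) \<longrightarrow>
        h (solset N n \<phi> as) = (0, real (card (solset N n \<phi> as)))) \<and>
     (\<forall>n m. \<forall>\<phi>\<in>formulas L (n + m). \<forall>d \<mu>. \<exists>\<psi>\<in>formulas L m.
        {as \<in> tuples (univ N) m. h (solset N n \<phi> as) = (d, \<mu>)} = solset N m \<psi> []) \<and>
     (\<forall>n k. \<forall>X\<in>Def_sets L N n. \<forall>Y\<in>Def_sets L N k. \<forall>f.
        X \<noteq> {} \<and> f ` X = Y \<and> {x @ f x | x. x \<in> X} \<in> Def_sets L N (n + k) \<longrightarrow>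
        h X = osum ((\<lambda>b. h {x \<in> X. f x = b}) ` Y)
          (\<lambda>p. otimes p (h {b \<in> Y. h {x \<in> X. f x = b} = p})))"
proof -
  have *: "(X \<noteq> {} \<and> f ` X = Y \<and> Q \<longrightarrow>
      fst (h X) = Max {fst p + fst (h {b \<in> Y. h {x \<in> X. f x = b} = p}) | p. p \<in> (\<lambda>b. h {x \<in> X. f x = b}) ` Y} \<and>
      snd (h X) = (\<Sum>p | p \<in> (\<lambda>b. h {x \<in> X. f x = b}) ` Y \<and>
        fst p + fst (h {b \<in> Y. h {x \<in> X. f x = b} = p}) = fst (h X).
        snd p * snd (h {b \<in> Y. h {x \<in> X. f x = b} = p}))) \<longleftrightarrow>
    (X \<noteq> {} \<and> f ` X = Y \<and> Q \<longrightarrow> h X = osum ((\<lambda>b. h {x \<in> X. f x = b}) ` Y)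
          (\<lambda>p. otimes p (h {b \<in> Y. h {x \<in> X. f x = b} = p})))"
    for X Y and f :: "'c list \<Rightarrow> 'c list" and Q
  proof (cases "X \<noteq> {} \<and> f ` X = Y")
    case True
    then have "(\<lambda>b. h {x \<in> X. f x = b}) ` Y \<noteq> {}" by auto
    from osum_fubini_iff[OF this, of "h X" "\<lambda>p. h {b \<in> Y. h {x \<in> X. f x = b} = p}"] show ?thesis by simp
  qed auto
  show ?thesis unfolding MS_measurable_def Let_def * ..
qed

section \<open>The action of the automorphisms of \<open>M\<close> on the tree and on the
  components\<close>

locale nic_meas = tree_nodes \<Gamma> lam S
  for \<Gamma> :: "nat list set" and lam :: "nat list \<Rightarrow> enat" and S :: "'s set" +
  fixes L :: "(tree_fun + 'f, tree_rel + 'r) lang"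
    and M :: "(tree_fun + 'f, tree_rel + 'r, 's node) struc"
    and hs :: "nat list \<Rightarrow> 's node list set \<Rightarrow> nat \<times> real"
  assumes nic: "NIC \<Gamma> lam S L M"
    and meas: "\<sigma> \<in> inf_nodes \<Gamma> lam \<Longrightarrow>
      MS_measurable_theory (comp_lang \<Gamma> lam S L M \<sigma>)
        {comp_struc \<Gamma> lam S M e | e. e \<in> nodes \<Gamma> lam S \<and> proj e = \<sigma>} (hs \<sigma>)"
    and dim1: "\<sigma> \<in> inf_nodes \<Gamma> lam \<Longrightarrow> e \<in> nodes \<Gamma> lam S \<Longrightarrow> proj e = \<sigma> \<Longrightarrow>
      fst (hs \<sigma> (solset (comp_struc \<Gamma> lam S M e) 1 (Eq (Var 0) (Var 0)) [])) = 1"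
begin

abbreviation "G \<equiv> autos L M"
abbreviation "LC \<equiv> comp_lang \<Gamma> lam S L M"
abbreviation "C \<equiv> comp_struc \<Gamma> lam S M"
abbreviation "Hs u \<equiv> {g \<in> G. g u = u}"

lemma expansion: "is_expansion (tree_lang \<Gamma>) (tree_struc \<Gamma> lam S) L M"
  using nic unfolding NIC_def by blast

lemma univ_M [simp]: "univ M = V"
  using expansion by (simp add: is_expansion_def tree_struc_def)

lemma struct_M: "is_struct L M"
  using expansion by (simp add: is_expansion_def)

lemma cat: "aleph0_categorical L M"
  using nic unfolding NIC_def by blast

sublocale ps: perm_struct "autos L M" L M
  by (rule perm_struct_autos[OF cat struct_M])

lemma g_V: "g \<in> G \<Longrightarrow> g a \<in> V \<longleftrightarrow> a \<in> V"
  using ps.maps_univ[of g a] by simp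

lemma g_tuples: "g \<in> G \<Longrightarrow> map g x \<in> tuples V n \<longleftrightarrow> x \<in> tuples V n"
  using ps.maps_tuples[of g x n] by simp

lemma g_iso: "g \<in> G \<Longrightarrow> iso L M M g"
  by (simp add: autos_def)

lemma g_pred:
  assumes "g \<in> G" "a \<in> V"
  shows "butlast (g a) = g (butlast a)"
proof -
  have ar: "farity L (Inl Pred) = Some 1"
    using expansion by (simp add: is_expansion_def tree_lang_def)
  have fn: "fn M (Inl Pred) [b] = butlast b" if "b \<in> V" for b
    using expansion that unfolding is_expansion_def
    by (auto simp: tree_lang_def tree_struc_def tuples_def)
  have "[a] \<in> tuples (univ M) 1" using assms(2) by (simp add: tuples_def)
  then have "g (fn M (Inl Pred) [a]) = fn M (Inl Pred) (map g [a])"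
    using g_iso[OF assms(1)] ar unfolding iso_def by blast
  then show ?thesis using fn[of a] fn[of "g a"] g_V[OF assms(1)] assms(2) by simp
qed

lemma g_rel:
  assumes "g \<in> G" "set xs \<subseteq> V" "rarity (tree_lang \<Gamma>) r = Some (length xs)"
  shows "rl (tree_struc \<Gamma> lam S) r (map g xs) \<longleftrightarrow> rl (tree_struc \<Gamma> lam S) r xs"
proof -
  have ar: "rarity L (Inl r) = Some (length xs)"
    using expansion assms(3) by (simp add: is_expansion_def)
  have rl: "rl M (Inl r) ys \<longleftrightarrow> rl (tree_struc \<Gamma> lam S) r ys" if "ys \<in> tuples V (length xs)" for ys
    using expansion that assms(3) univ_M unfolding is_expansion_def by metis
  have "xs \<in> tuples V (length xs)" using assms(2) by (simp add: tuples_def)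
  moreover then have "map g xs \<in> tuples V (length xs)" using g_tuples[OF assms(1)] by blast
  moreover have "rl M (Inl r) xs \<longleftrightarrow> rl M (Inl r) (map g xs)"
    using g_iso[OF assms(1)] ar calculation(1) univ_M unfolding iso_def by metis
  ultimately show ?thesis using rl by blast
qed

lemma g_proj [simp]:
  assumes "g \<in> G" "a \<in> V"
  shows "proj (g a) = proj a"
  using g_rel[OF assms(1), of "[a]" "At (proj a)"] assms(2)
  by (auto simp: tree_lang_def tree_struc_def nodes_def)

lemma g_prefix:
  assumes "g \<in> G" "a \<in> V" "b \<in> V"
  shows "prefix (g a) (g b) \<longleftrightarrow> prefix a b"
  using g_rel[OF assms(1), of "[a, b]" Leq] assms(2,3)
  by (auto simp: tree_lang_def tree_struc_def)

lemma g_length: "g \<in> G \<Longrightarrow> a \<in> V \<Longrightarrow> length (g a) = length a"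
  by (metis g_proj proj_simps(1))

lemma g_Nil: "g \<in> G \<Longrightarrow> g [] = []"
  using g_length[of g "[]"] by simp

text \<open>Automorphisms preserve order, length, predecessor and projection. A node below
  \<open>b\<close> is determined by its length, and a node with \<open>lam\<close> value 1 by its
  predecessor and projection.\<close>

lemma cl_fix:
  assumes "g \<in> G" "B \<subseteq> V" "\<forall>b\<in>B. g b = b" "a \<in> cl B"
  shows "g a = a"
  using assms(4)
proof (induction rule: cl_induct)
  case Nil
  then show ?case using g_Nil assms(1) by blast
next
  case (below a b)
  then have "prefix (g a) b" using g_prefix[OF assms(1) below(1), of b] assms(2,3) by auto
  then show ?case using below g_length[OF assms(1) below(1)] by (metis prefix_iff_take)
next
  case (step a)
  show ?case
    by (rule node_eqI) (use step g_V[OF assms(1)] g_pred[OF assms(1)] assms(1) in auto)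
qed

lemma cl_image:
  assumes "g \<in> G" "B \<subseteq> V"
  shows "cl (g ` B) = g ` cl B"
proof -
  have sub: "k ` cl D \<subseteq> cl (k ` D)" if k: "k \<in> G" and D: "D \<subseteq> V" for k D
  proof
    fix y assume "y \<in> k ` cl D"
    then obtain a where a: "a \<in> cl D" "y = k a" by blast
    from a(1) have "k a \<in> cl (k ` D)"
    proof (induction rule: cl_induct)
      case Nil
      then show ?case using g_Nil[OF k] cl_Nil by simp
    next
      case (below a b)
      then show ?case using g_V[OF k, of a] g_prefix[OF k, of a b] D by (intro cl_below[of _ "k b"]) auto
    next
      case (step a)
      show ?case
      proof (rule cl_step)
        show "k a \<in> V" using step(1) g_V[OF k] by simp
        show "lam (proj (k a)) = 1" using step(1,2) k by simp
        show "butlast (k a) \<in> cl (k ` D)" using step(4) g_pred[OF k step(1)] by simp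
      qed
    qed
    then show "y \<in> cl (k ` D)" using a(2) by simp
  qed
  have gB: "g ` B \<subseteq> V" using assms g_V[OF assms(1)] by blast
  have "inv g ` cl (g ` B) \<subseteq> cl (inv g ` g ` B)" by (rule sub[OF ps.inv_mem[OF assms(1)] gB])
  also have "inv g ` g ` B = B" using assms(1) by (simp add: image_image)
  finally have *: "inv g ` cl (g ` B) \<subseteq> cl B" .
  have "cl (g ` B) \<subseteq> g ` cl B"
  proof
    fix y assume "y \<in> cl (g ` B)"
    then have "inv g y \<in> cl B" using * by blast
    then have "g (inv g y) \<in> g ` cl B" by (rule imageI)
    then show "y \<in> g ` cl B" using assms(1) by simp
  qed
  then show ?thesis using sub[OF assms] by blast
qed

text \<open>A finite orbit over \<open>A\<close> is definable over \<open>A\<close>, which would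
  place \<open>e\<close> in \<open>acl\<close>, and \<open>NIC\<close> identifies \<open>acl\<close>
  with the tree closure.\<close>

lemma infinite_orbit:
  assumes A: "finite A" "A \<subseteq> V" and e: "e \<in> V" "e \<notin> cl A"
  shows "infinite (orb G A [e])"
proof
  assume fin: "finite (orb G A [e])"
  obtain cs where cs: "set cs = A" using finite_list[OF A(1)] by blast
  have "orb G A [e] \<subseteq> tuples (univ M) 1" by (rule ps.orb_tuples) (use e in \<open>simp add: tuples_def\<close>)
  then obtain \<phi> where \<phi>: "\<phi> \<in> formulas L (1 + length cs)" "orb G A [e] = solset M 1 \<phi> cs"
    using ps.uniformly_definable[of "orb G A [e]" 1 cs "length cs"] ps.supports_orb[of A "[e]"] cs A
    by (auto simp: tuples_def)
  have "cs \<in> tuples A (length cs)" using cs by (simp add: tuples_def)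
  then have "e \<in> acl L M A"
    unfolding acl_def using \<phi> fin ps.orb_refl[of "[e]" A] by auto
  moreover have "\<forall>B\<subseteq>V. acl L M B = cl B"
    using nic unfolding NIC_def by (elim conjE) assumption
  then have "acl L M A = cl A" using A(2) by blast
  ultimately show False using e(2) by simp
qed

lemma g_K:
  assumes "g \<in> G"
  shows "g ` K u \<sigma> = K (g u) \<sigma>"
proof -
  have sub: "k ` K v \<sigma> \<subseteq> K (k v) \<sigma>" if k: "k \<in> G" for k v
  proof safe
    fix a assume "a \<in> K v \<sigma>"
    then show "k a \<in> K (k v) \<sigma>" using g_V[OF k, of a] g_pred[OF k, of a] k by (simp add: K_def)
  qed
  have "K (g u) \<sigma> \<subseteq> g ` K u \<sigma>"
  proof
    fix y assume "y \<in> K (g u) \<sigma>"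
    then have "inv g y \<in> K u \<sigma>" using sub[OF ps.inv_mem[OF assms], of "g u"] assms by auto
    then have "g (inv g y) \<in> g ` K u \<sigma>" by (rule imageI)
    then show "y \<in> g ` K u \<sigma>" using assms by simp
  qed
  with sub[OF assms] show ?thesis by blast
qed

lemma K_V: "K u \<sigma> \<subseteq> V"
  by (auto simp: K_def)

lemma univ_C [simp]: "univ (C e) = K (butlast e) (proj e)"
  by (simp add: comp_struc_def component_eq)

lemma C_cong: "butlast e = butlast e' \<Longrightarrow> proj e = proj e' \<Longrightarrow> C e = C e'"
  by (simp add: comp_struc_def component_eq)

text \<open>The relations of a component are types of \<open>M\<close> evaluated at the predecessor
  followed by the tuple, and automorphisms preserve these while moving the predecessor
  along.\<close>

lemma iso_comp:
  assumes g: "g \<in> G" and e: "e \<in> V"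
  shows "iso (LC (proj e)) (C e) (C (g e)) g"
proof -
  let ?K = "K (butlast e) (proj e)"
  have ge: "butlast (g e) = g (butlast e)" "proj (g e) = proj e" using g_pred[OF g e] g e by auto
  have img: "g ` ?K = K (g (butlast e)) (proj e)" by (rule g_K[OF g])
  have bij: "bij_betw g (univ (C e)) (univ (C (g e)))"
    unfolding univ_C ge img[symmetric] using g by (auto simp: bij_betw_def inj_on_def)
  have be: "butlast e \<in> V" using butlast_V[OF e] .
  have "rl (C e) r xs \<longleftrightarrow> rl (C (g e)) r (map g xs)"
    if r: "rarity (LC (proj e)) r = Some k" and xs: "xs \<in> tuples (univ (C e)) k" for r k xs
  proof -
    obtain n p where np: "r = (n, p)" by (cases r)
    have k: "k = n" "p \<in> comp_types \<Gamma> lam S L M (proj e) n"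
      using r by (auto simp: np comp_lang_def split: if_splits)
    then have p: "p \<subseteq> formulas L (Suc n)" by (auto simp: comp_types_def tp_def)
    have xs': "xs \<in> tuples ?K n" "map g xs \<in> tuples (K (g (butlast e)) (proj e)) n"
      using xs k(1) by (auto simp: tuples_def simp flip: img)
    have V: "set (butlast e # xs) \<subseteq> V" using be xs'(1) K_V[of "butlast e" "proj e"] by (auto simp: tuples_def)
    have "sat M (nth (butlast (g e) # map g xs)) \<phi> \<longleftrightarrow> sat M (nth (butlast e # xs)) \<phi>" if "\<phi> \<in> p" for \<phi>
    proof -
      have "sat M (nth (map g (butlast e # xs))) \<phi> \<longleftrightarrow> sat M (nth (butlast e # xs)) \<phi>"
        by (rule iso_sat_nth[OF struct_M g_iso[OF g], of _ "Suc n"])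
          (use p that xs' V in \<open>auto simp: tuples_def\<close>)
      then show ?thesis by (simp add: ge)
    qed
    then show ?thesis using xs' by (simp add: np comp_struc_def component_eq ge)
  qed
  then show ?thesis using bij by (simp add: iso_def comp_lang_def)
qed

lemma comp_is_struct: "e \<in> V \<Longrightarrow> is_struct (LC \<sigma>) (C e)"
  by (auto simp: is_struct_def comp_lang_def K_def)

text \<open>The symbol given by the type of \<open>butlast e # x\<close> defines precisely the orbit
  of \<open>x\<close> under the stabilizer. An invariant set is a union of such orbits, finitely
  many because they are orbits of \<open>M\<close> over the single point
  \<open>butlast e\<close>.\<close>

lemma comp_perm_struct:
  assumes e: "e \<in> V" "infn e"
  shows "perm_struct (Hs (butlast e)) (LC (proj e)) (C e)"
proof -
  let ?u = "butlast e" and ?\<sigma> = "proj e"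
  interpret H: perm_group "Hs ?u" by (rule ps.stabilizer)
  have u: "?u \<in> V" using butlast_V[OF e(1)] .
  have KV: "tuples (K ?u ?\<sigma>) n \<subseteq> tuples V n" for n using K_V by (auto simp: tuples_def)
  have orb: "orb (Hs ?u) {} x = orb G {?u} x" for x using ps.orb_stabilizer[of ?u "{}" x] by simp
  show ?thesis
  proof
    show "is_struct (LC ?\<sigma>) (C e)" by (rule comp_is_struct[OF e(1)])
    show "iso (LC ?\<sigma>) (C e) (C e) g" if "g \<in> Hs ?u" for g
    proof -
      have "C (g e) = C e" by (rule C_cong) (use that g_pred[of g e] e in auto)
      then show ?thesis using iso_comp[of g e] that e by auto
    qed
    show fin: "finite (orb (Hs ?u) {} ` tuples (univ (C e)) n)" for n
    proof -
      have "finite (orb G {?u} ` tuples (univ M) n)" by (rule ps.finite_orbits_over) (use u in auto)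
      moreover have "orb (Hs ?u) {} ` tuples (univ (C e)) n \<subseteq> orb G {?u} ` tuples (univ M) n"
        using KV[of n] by (auto simp: orb)
      ultimately show ?thesis by (rule finite_subset[rotated])
    qed
    show "definable0 (LC ?\<sigma>) (C e) n X"
      if X: "X \<subseteq> tuples (univ (C e)) n" "supports (Hs ?u) {} X" for X n
    \<comment> \<open>The component language has no symbol of arity 0, so sets of empty tuples are
      handled separately.\<close>
    proof (cases "n = 0")
      case True
      then have X0: "X = {} \<or> X = {[]}" using X(1) by (auto simp: tuples_def)
      have "definable0 (LC ?\<sigma>) (C e) 0 {[]}"
        using definable0_compl[OF definable0_empty, of "LC ?\<sigma>" "C e" 0]
        by (simp add: tuples_def conj_commute cong: conj_cong)
      then show ?thesis using X0 True definable0_empty by metis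
    next
      case False
      have "definable0 (LC ?\<sigma>) (C e) n (orb (Hs ?u) {} x)" if x: "x \<in> X" for x
      proof -
        let ?p = "tp L M (?u # x)"
        have xK: "x \<in> tuples (K ?u ?\<sigma>) n" using x X(1) by auto
        then obtain a0 as where a: "x = a0 # as" using False by (cases x) (auto simp: tuples_def)
        have a0: "a0 \<in> V" "proj a0 = ?\<sigma>" "butlast a0 = ?u" "set as \<subseteq> K ?u ?\<sigma>" "Suc (length as) = n"
          using xK by (auto simp: a tuples_def K_def)
        then have "?p \<in> comp_types \<Gamma> lam S L M ?\<sigma> n"
          unfolding comp_types_def component_eq a
          by (intro CollectI exI[of _ a0] exI[of _ as]) simp
        then have ar: "rarity (LC ?\<sigma>) (n, ?p) = Some n" using False by (simp add: comp_lang_def)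
        let ?\<phi> = "Rel (n, ?p) (map Var [0..<n]) :: (unit, nat \<times> (tree_fun + 'f, tree_rel + 'r) fm set) fm"
        have \<phi>: "?\<phi> \<in> formulas (LC ?\<sigma>) n" using ar by (auto simp: formulas_def)
        have ev: "map (eval_tm (C e) (nth y)) (map Var [0..<n]) = y" if "length y = n" for y
          by (rule nth_equalityI) (use that in auto)
        have sat: "sat (C e) (nth y) ?\<phi> \<longleftrightarrow> (\<forall>\<phi>\<in>?p. sat M (nth (?u # y)) \<phi>)" if y: "y \<in> tuples (K ?u ?\<sigma>) n" for y
        proof -
          have "sat (C e) (nth y) ?\<phi> \<longleftrightarrow> rl (C e) (n, ?p) y"
            using ev[of y] y by (simp only: sat.simps tuples_def mem_Collect_eq)
          then show ?thesis using y by (simp add: comp_struc_def component_eq)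
        qed
        have "orb (Hs ?u) {} x = solset (C e) n ?\<phi> []"
        proof (intro equalityI subsetI)
          fix y assume "y \<in> orb (Hs ?u) {} x"
          then have "y \<in> X" using H.supports_orb_subset[OF X(2) x] by blast
          then have yK: "y \<in> tuples (K ?u ?\<sigma>) n" using X(1) by auto
          from \<open>y \<in> orb (Hs ?u) {} x\<close> obtain g where g: "g \<in> G" "g ?u = ?u" "y = map g x"
            by (auto simp: orb_def)
          have "sat M (nth (?u # y)) \<psi>" if "\<psi> \<in> ?p" for \<psi>
          proof -
            have "sat M (nth (map g (?u # x))) \<psi> \<longleftrightarrow> sat M (nth (?u # x)) \<psi>"
              by (rule iso_sat_nth[OF struct_M g_iso[OF g(1)], of _ "Suc n"])
                (use that xK KV u in \<open>auto simp: tp_def tuples_def\<close>)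
            then show ?thesis using that g by (simp add: tp_def)
          qed
          then show "y \<in> solset (C e) n ?\<phi> []" using sat[OF yK] yK by (simp add: solset_def)
        next
          fix y assume "y \<in> solset (C e) n ?\<phi> []"
          then have yK: "y \<in> tuples (K ?u ?\<sigma>) n" and all: "\<forall>\<phi>\<in>?p. sat M (nth (?u # y)) \<phi>"
            using sat[of y] by (auto simp: solset_def)
          have len: "length y = length x" using xK yK by (simp add: tuples_def)
          \<comment> \<open>Complete types are closed under negation, so the inclusion given by the
            symbol is already an equality.\<close>
          have "tp L M (?u # x) = tp L M (?u # y)"
          proof (intro equalityI subsetI)
            fix \<psi> assume "\<psi> \<in> tp L M (?u # x)"
            then show "\<psi> \<in> tp L M (?u # y)" using all len by (simp add: tp_def)
          next
            fix \<psi> assume \<psi>: "\<psi> \<in> tp L M (?u # y)"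
            show "\<psi> \<in> tp L M (?u # x)"
            proof (rule ccontr)
              assume "\<psi> \<notin> tp L M (?u # x)"
              then have "Neg \<psi> \<in> tp L M (?u # x)" using \<psi> len by (auto simp: tp_def formulas_def)
              then show False using all \<psi> by (auto simp: tp_def)
            qed
          qed
          then obtain g where "g \<in> G" "map g (?u # x) = ?u # y"
            using back_and_forth[OF cat struct_M, of "?u # x" "Suc n" "?u # y"] xK yK KV[of n] u
            by (auto simp: tuples_def)
          then show "y \<in> orb (Hs ?u) {} x" by (auto simp: orb_def)
        qed
        then show ?thesis using \<phi> by (auto simp: definable0_def)
      qed
      moreover have "finite (orb (Hs ?u) {} ` X)"
        by (rule finite_subset[OF image_mono[OF X(1)] fin])
      ultimately have "definable0 (LC ?\<sigma>) (C e) n (\<Union>(orb (Hs ?u) {} ` X))"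
        by (intro definable0_Union) auto
      moreover have "\<Union>(orb (Hs ?u) {} ` X) = X" using H.supports_orb_subset[OF X(2)] H.orb_refl by blast
      ultimately show ?thesis by simp
    qed
  qed
qed

lemma comp_Def_sets:
  "e \<in> V \<Longrightarrow> infn e \<Longrightarrow> Def_sets (LC (proj e)) (C e) n = Dset (Hs (butlast e)) (K (butlast e) (proj e)) n"
  using perm_struct.Def_sets_iff[OF comp_perm_struct] by (auto simp: Dset_def)

text \<open>The uniformity in \<open>MS_measurable_theory\<close> is used here: a single formula
  recognizes the value both in \<open>C e\<close> and in \<open>C (g e)\<close>, and
  \<open>g\<close> carries the solutions of one to those of the other.\<close>

lemma comp_invariant:
  assumes e: "e \<in> V" "infn e" and g: "g \<in> G"
    and X: "X \<in> Dset (Hs (butlast e)) (K (butlast e) (proj e)) n"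
  shows "hs (proj e) (map g ` X) = hs (proj e) X"
proof -
  let ?\<sigma> = "proj e"
  obtain \<phi> cs m where \<phi>: "X = solset (C e) n \<phi> cs" "\<phi> \<in> formulas (LC ?\<sigma>) (n + m)" "cs \<in> tuples (univ (C e)) m"
    using X unfolding comp_Def_sets[OF e, of n, symmetric] Def_sets_def by blast
  have iso: "iso (LC ?\<sigma>) (C e) (C (g e)) g" by (rule iso_comp[OF g e(1)])
  note st = comp_is_struct[OF e(1), of ?\<sigma>]
  have gX: "map g ` X = solset (C (g e)) n \<phi> (map g cs)"
    using solset_iso[OF st iso \<phi>(2,3)] \<phi>(1) by simp
  obtain d \<mu> where h: "hs ?\<sigma> X = (d, \<mu>)" by (cases "hs ?\<sigma> X")
  have "\<forall>d \<mu>. \<exists>\<psi>\<in>formulas (LC ?\<sigma>) m. \<forall>N\<in>{C e | e. e \<in> V \<and> proj e = ?\<sigma>}.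
      {as \<in> tuples (univ N) m. hs ?\<sigma> (solset N n \<phi> as) = (d, \<mu>)} = solset N m \<psi> []"
    using meas[OF e(2)] \<phi>(2) unfolding MS_measurable_theory_def by blast
  from this[THEN spec, of d, THEN spec, of \<mu>]
  obtain \<psi> where \<psi>: "\<psi> \<in> formulas (LC ?\<sigma>) m" "\<forall>N\<in>{C e | e. e \<in> V \<and> proj e = ?\<sigma>}.
      {as \<in> tuples (univ N) m. hs ?\<sigma> (solset N n \<phi> as) = (d, \<mu>)} = solset N m \<psi> []" by (rule bexE)
  have ge: "g e \<in> V" "proj (g e) = ?\<sigma>" using g e g_V by auto
  have "{as \<in> tuples (univ (C e)) m. hs ?\<sigma> (solset (C e) n \<phi> as) = (d, \<mu>)} = solset (C e) m \<psi> []"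
    by (rule \<psi>(2)[rule_format]) (use e in auto)
  moreover have "cs \<in> {as \<in> tuples (univ (C e)) m. hs ?\<sigma> (solset (C e) n \<phi> as) = (d, \<mu>)}"
    using \<phi> h by simp
  ultimately have "map g cs \<in> map g ` solset (C e) m \<psi> []" by simp
  also have "\<dots> = solset (C (g e)) m \<psi> []"
    using solset_iso[OF st iso, of \<psi> m 0 "[]"] \<psi>(1) by (simp add: tuples_def)
  also have "\<dots> = {as \<in> tuples (univ (C (g e))) m. hs ?\<sigma> (solset (C (g e)) n \<phi> as) = (d, \<mu>)}"
    by (rule \<psi>(2)[rule_format, symmetric]) (use ge in blast)
  finally have "hs ?\<sigma> (solset (C (g e)) n \<phi> (map g cs)) = (d, \<mu>)" by simp
  then show ?thesis using gX h by simp
qed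

lemma comp_perm_meas:
  assumes e: "e \<in> V" "infn e"
  shows "perm_meas (Hs (butlast e)) (K (butlast e) (proj e)) (hs (proj e))"
proof -
  let ?\<sigma> = "proj e" and ?H = "Hs (butlast e)" and ?K = "K (butlast e) (proj e)"
  interpret H: perm_struct ?H "LC ?\<sigma>" "C e" by (rule comp_perm_struct[OF e])
  have ms: "MS_measurable (LC ?\<sigma>) (C e) (hs ?\<sigma>)"
    using meas[OF e(2)] e(1) unfolding MS_measurable_theory_def by blast
  note D = comp_Def_sets[OF e, symmetric]
  show ?thesis
  proof
    show "infinite ?K" using ms[unfolded MS_measurable_iff] by simp
    show "g x \<in> ?K" if "g \<in> ?H" "x \<in> ?K" for g x using H.maps_univ[of g x] that by simp
    show "hs ?\<sigma> X = (0, 0) \<or> 0 < snd (hs ?\<sigma> X)" if "X \<in> Dset ?H ?K n" for X n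
      using ms[unfolded MS_measurable_iff, THEN conjunct2, THEN conjunct1] that unfolding D by blast
    show "hs ?\<sigma> X = (0, real (card X))" if X: "X \<in> Dset ?H ?K n" "finite X" for X n
    proof -
      obtain \<phi> cs m where \<phi>: "X = solset (C e) n \<phi> cs" "\<phi> \<in> formulas (LC ?\<sigma>) (n + m)" "cs \<in> tuples (univ (C e)) m"
        using X(1) unfolding D Def_sets_def by blast
      then show ?thesis using ms[unfolded MS_measurable_iff, THEN conjunct2, THEN conjunct2, THEN conjunct2, THEN conjunct1] X(2)
        by blast
    qed
    show "hs ?\<sigma> (map g ` X) = hs ?\<sigma> X" if "X \<in> Dset ?H ?K n" "g \<in> ?H" for X n g
      using comp_invariant[OF e _ that(1)] that(2) by blast
    show "hs ?\<sigma> X = osum ((\<lambda>b. hs ?\<sigma> {x \<in> X. f x = b}) ` Y)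
        (\<lambda>p. otimes p (hs ?\<sigma> {b \<in> Y. hs ?\<sigma> {x \<in> X. f x = b} = p}))"
      if "X \<in> Dset ?H ?K n" "Y \<in> Dset ?H ?K k" "X \<noteq> {}" "f ` X = Y" "{x @ f x | x. x \<in> X} \<in> Dset ?H ?K (n + k)"
      for X Y n k f
      using ms[unfolded MS_measurable_iff, THEN conjunct2, THEN conjunct2, THEN conjunct2, THEN conjunct2, THEN conjunct2]
        that unfolding D by blast
  qed
qed

lemma nil_interaction:
  assumes "finite A" "A \<subseteq> V" "e \<in> V" "infn e" "e' \<in> component \<Gamma> lam S e"
    and "tp_over (tree_lang \<Gamma>) (tree_struc \<Gamma> lam S) [e'] A = tp_over (tree_lang \<Gamma>) (tree_struc \<Gamma> lam S) [e] A"
    and "tp_over (LC (proj e)) (C e) [e'] (cl A \<inter> component \<Gamma> lam S e) =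
      tp_over (LC (proj e)) (C e) [e] (cl A \<inter> component \<Gamma> lam S e)"
  shows "tp_over L M [e'] A = tp_over L M [e] A"
proof -
  have "\<forall>A. finite A \<and> A \<subseteq> V \<longrightarrow> (\<forall>e\<in>V. infn e \<longrightarrow> (\<forall>e'\<in>component \<Gamma> lam S e.
      tp_over (tree_lang \<Gamma>) (tree_struc \<Gamma> lam S) [e'] A = tp_over (tree_lang \<Gamma>) (tree_struc \<Gamma> lam S) [e] A \<and>
      tp_over (LC (proj e)) (C e) [e'] (cl A \<inter> component \<Gamma> lam S e) =
        tp_over (LC (proj e)) (C e) [e] (cl A \<inter> component \<Gamma> lam S e) \<longrightarrow>
      tp_over L M [e'] A = tp_over L M [e] A))"
    using nic unfolding NIC_def by (elim conjE) assumption
  then show ?thesis using assms by metis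
qed

text \<open>Nil interaction applies because \<open>e\<close> and its conjugates inside the component lie outside the
  closed set \<open>A\<close>: swapping their cones fixes \<open>A\<close>, so they have the same tree type over \<open>A\<close>.\<close>

lemma component_orbit:
  assumes A: "finite A" "cl A = A" and e: "e \<in> V" "infn e" "e \<notin> A" "butlast e \<in> A"
  shows "orb G A [e] = orb (Hs (butlast e)) (A \<inter> K (butlast e) (proj e)) [e]"
proof (intro equalityI subsetI)
  fix y assume "y \<in> orb G A [e]"
  then show "y \<in> orb (Hs (butlast e)) (A \<inter> K (butlast e) (proj e)) [e]"
    using e(4) by (auto simp: orb_def)
next
  let ?u = "butlast e" and ?K = "K (butlast e) (proj e)"
  fix y assume "y \<in> orb (Hs ?u) (A \<inter> ?K) [e]"
  then obtain g where g: "g \<in> G" "g ?u = ?u" "\<forall>a\<in>A \<inter> ?K. g a = a" "y = [g e]" by (auto simp: orb_def)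
  let ?e = "g e"
  have AV: "A \<subseteq> V" using cl_V[of A] A(2) by simp
  have eK: "e \<in> ?K" using e(1) by (simp add: K_def)
  have geK: "?e \<in> ?K" using g_K[OF g(1), of ?u "proj e"] eK g(2) by auto
  have geA: "?e \<notin> A"
  proof
    assume "?e \<in> A"
    then have "g ?e = ?e" using g(3) geK by blast
    then have "?e = e" using g(1) by simp
    then show False using \<open>?e \<in> A\<close> e(3) by simp
  qed
  obtain \<tau> where \<tau>: "iso (tree_lang \<Gamma>) (tree_struc \<Gamma> lam S) (tree_struc \<Gamma> lam S) \<tau>" "\<tau> e = ?e"
    "\<And>c. \<not> prefix e c \<Longrightarrow> \<not> prefix ?e c \<Longrightarrow> \<tau> c = c"
    by (rule tree_swap[OF e(1) geK e(2)]) (rule that)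
  have \<tau>A: "\<tau> c = c" if "c \<in> A" for c
    by (rule \<tau>(3)) (use that cl_prefix[of c A] A(2) e(3) geA in auto)
  have over_eq: "tp_over LL N [?e] D = tp_over LL N [e] D"
    if N: "is_struct LL N" and h: "iso LL N N k" "k e = ?e" "\<forall>d\<in>D. k d = d"
      and D: "D \<subseteq> univ N" "e \<in> univ N" for D k and LL :: "('x, 'y) lang" and N
  proof -
    have "sat N (nth (?e # cs)) \<phi> \<longleftrightarrow> sat N (nth (e # cs)) \<phi>"
      if "set cs \<subseteq> D" "\<phi> \<in> formulas LL (Suc (length cs))" for cs \<phi>
    proof -
      have "map k (e # cs) = ?e # cs" using that(1) h by (auto intro: map_idI)
      then show ?thesis
        using iso_sat_nth[OF N h(1) that(2), of "e # cs"] that(1) D by auto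
    qed
    then show ?thesis by (auto simp: tp_over_def)
  qed
  have t1: "tp_over (tree_lang \<Gamma>) (tree_struc \<Gamma> lam S) [?e] A = tp_over (tree_lang \<Gamma>) (tree_struc \<Gamma> lam S) [e] A"
    by (rule over_eq[OF tree_is_struct \<tau>(1,2)]) (use \<tau>A AV e(1) in \<open>auto simp: tree_struc_def\<close>)
  have iso: "iso (LC (proj e)) (C e) (C e) g"
    using iso_comp[OF g(1) e(1)] C_cong[of ?e e] g_pred[OF g(1) e(1)] g(1,2) e(1) by simp
  have t2: "tp_over (LC (proj e)) (C e) [?e] (cl A \<inter> component \<Gamma> lam S e) =
      tp_over (LC (proj e)) (C e) [e] (cl A \<inter> component \<Gamma> lam S e)"
    by (rule over_eq[OF comp_is_struct[OF e(1)] iso refl]) (use g(3) A(2) eK in \<open>auto simp: component_eq\<close>)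
  have t3: "tp_over L M [?e] A = tp_over L M [e] A"
    by (rule nil_interaction[OF A(1) AV e(1,2) _ t1 t2]) (use geK in \<open>simp add: component_eq\<close>)
  \<comment> \<open>Equal types over \<open>A\<close> are turned back into an automorphism fixing
    \<open>A\<close>, by listing \<open>A\<close> as a tuple.\<close>
  obtain cs where cs: "set cs = A" using finite_list[OF A(1)] by blast
  have "tp L M (e # cs) = tp L M (?e # cs)"
    using t3 cs by (auto simp: tp_def tp_over_def set_eq_iff)
  moreover have "e # cs \<in> tuples (univ M) (Suc (length cs))" "?e # cs \<in> tuples (univ M) (Suc (length cs))"
    using e(1) cs AV geK K_V by (auto simp: tuples_def)
  ultimately have "\<exists>k\<in>G. map k (e # cs) = ?e # cs" by (intro back_and_forth[OF cat struct_M])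
  then obtain k where k: "k \<in> G" "map k cs = cs" "k e = ?e" by auto
  have "\<forall>a\<in>A. k a = a" using k(2) cs by (metis map_eq_conv map_ident)
  then show "y \<in> orb G A [e]" using ps.orbI[of k A "[e]"] g(4) k by simp
qed

end

section \<open>Dimension and measure of types\<close>

definition oprod :: "'i set \<Rightarrow> ('i \<Rightarrow> nat \<times> real) \<Rightarrow> nat \<times> real" where
  "oprod I f = (\<Sum>i\<in>I. fst (f i), \<Prod>i\<in>I. snd (f i))"

lemma oprod_otimes: "oprod I (\<lambda>i. otimes (f i) (g i)) = otimes (oprod I f) (oprod I g)"
  by (simp add: oprod_def otimes_def sum.distrib prod.distrib)

lemma oprod_cong: "I = J \<Longrightarrow> (\<And>i. i \<in> J \<Longrightarrow> f i = g i) \<Longrightarrow> oprod I f = oprod J g"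
  by (simp add: oprod_def)

lemma oprod_neutral: "(\<And>i. i \<in> I \<Longrightarrow> f i = (0, 1)) \<Longrightarrow> oprod I f = (0, 1)"
  by (simp add: oprod_def)

lemma oprod_mono_neutral:
  "finite J \<Longrightarrow> I \<subseteq> J \<Longrightarrow> (\<And>i. i \<in> J - I \<Longrightarrow> f i = (0, 1)) \<Longrightarrow> oprod I f = oprod J f"
  by (auto simp: oprod_def intro!: sum.mono_neutral_left prod.mono_neutral_left)

lemma oprod_reindex: "inj_on h I \<Longrightarrow> oprod (h ` I) f = oprod I (\<lambda>i. f (h i))"
  by (simp add: oprod_def sum.reindex prod.reindex)

text \<open>An arbitrary enumeration; by \<open>comp_val_enum\<close> the values formed with it do
  not depend on the choice.\<close>

definition enum :: "'a set \<Rightarrow> 'a list" where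
  "enum E = (SOME l. set l = E)"

lemma set_enum [simp]: "finite E \<Longrightarrow> set (enum E) = E"
  unfolding enum_def by (rule someI_ex) (rule finite_list)

context nic_meas
begin

section \<open>Values inside one component and their products over all components\<close>

definition comp_val :: "'s node \<Rightarrow> nat list \<Rightarrow> 's node set \<Rightarrow> 's node set \<Rightarrow> nat \<times> real" where
  "comp_val u \<sigma> E D = hs \<sigma> (orb (Hs u) D (enum E))"

text \<open>Only components that meet \<open>B\<close> are listed, which keeps the product finite;
  any other component would contribute the neutral value.\<close>

definition comp_ix :: "'s node set \<Rightarrow> ('s node \<times> nat list) set" where
  "comp_ix B = (\<lambda>e. (butlast e, proj e)) ` {e \<in> B. infn e}"

definition closed_val :: "'s node set \<Rightarrow> 's node set \<Rightarrow> nat \<times> real" where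
  "closed_val B A = oprod (comp_ix B) (\<lambda>(u, \<sigma>). comp_val u \<sigma> (B \<inter> K u \<sigma>) (A \<inter> K u \<sigma>))"

lemma finite_comp_ix [simp]: "finite B \<Longrightarrow> finite (comp_ix B)"
  by (simp add: comp_ix_def)

lemma comp_ixE:
  assumes "(u, \<sigma>) \<in> comp_ix B" "B \<subseteq> V"
  obtains e where "e \<in> B" "e \<in> V" "infn e" "u = butlast e" "\<sigma> = proj e"
  using assms by (auto simp: comp_ix_def)

lemma comp_ix_perm_meas: "(u, \<sigma>) \<in> comp_ix B \<Longrightarrow> B \<subseteq> V \<Longrightarrow> perm_meas (Hs u) (K u \<sigma>) (hs \<sigma>)"
  by (elim comp_ixE) (auto intro: comp_perm_meas)

lemma enum_tuples: "finite E \<Longrightarrow> E \<subseteq> A \<Longrightarrow> enum E \<in> tuples A (length (enum E))"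
  by (simp add: tuples_def)

lemma comp_val_trivial:
  assumes "perm_meas (Hs u) (K u \<sigma>) (hs \<sigma>)" "finite D" "D \<subseteq> K u \<sigma>" "c \<in> tuples (K u \<sigma>) n" "set c \<subseteq> D"
  shows "hs \<sigma> (orb (Hs u) D c) = (0, 1)"
proof -
  interpret pm: perm_meas "Hs u" "K u \<sigma>" "hs \<sigma>" by fact
  have "orb (Hs u) D c = {c}" by (rule pm.orb_fixed) fact
  then show ?thesis using pm.finite_sets[OF pm.orb_Dset[OF assms(4,2,3)]] by simp
qed

lemma comp_val_refl:
  assumes "perm_meas (Hs u) (K u \<sigma>) (hs \<sigma>)" "finite D" "D \<subseteq> K u \<sigma>"
  shows "comp_val u \<sigma> D D = (0, 1)"
  unfolding comp_val_def by (rule comp_val_trivial[OF assms enum_tuples]) (use assms in auto)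

text \<open>Fixing an enumeration of \<open>F\<close> fixes the smaller set \<open>E\<close>, so the
  chain rule \<open>meas_chain\<close> applies to the two enumerations.\<close>

lemma comp_val_chain:
  assumes "perm_meas (Hs u) (K u \<sigma>) (hs \<sigma>)" "finite F" "F \<subseteq> K u \<sigma>" "D \<subseteq> E" "E \<subseteq> F"
  shows "comp_val u \<sigma> F D = otimes (comp_val u \<sigma> E D) (comp_val u \<sigma> F E)"
proof -
  interpret pm: perm_meas "Hs u" "K u \<sigma>" "hs \<sigma>" by fact
  have fin: "finite E" "finite D" using assms finite_subset by metis+
  have "hs \<sigma> (orb (Hs u) D (enum F)) =
      otimes (hs \<sigma> (orb (Hs u) D (enum E))) (hs \<sigma> (orb (Hs u) (D \<union> set (enum E)) (enum F)))"
    by (rule pm.meas_chain[OF enum_tuples enum_tuples]) (use assms fin in \<open>auto intro!: map_idI\<close>)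
  moreover have "D \<union> set (enum E) = E" using assms fin by auto
  ultimately show ?thesis by (simp add: comp_val_def)
qed

text \<open>Over \<open>D\<close> the tuple \<open>c\<close> and the enumeration of the union fix
  each other, so the second factor of the chain rule is trivial.\<close>

lemma comp_val_enum:
  assumes "perm_meas (Hs u) (K u \<sigma>) (hs \<sigma>)" "finite D" "D \<subseteq> K u \<sigma>" "c \<in> tuples (K u \<sigma>) n"
  shows "comp_val u \<sigma> (D \<union> set c) D = hs \<sigma> (orb (Hs u) D c)"
proof -
  interpret pm: perm_meas "Hs u" "K u \<sigma>" "hs \<sigma>" by fact
  let ?E = "D \<union> set c"
  have E: "finite ?E" "?E \<subseteq> K u \<sigma>" using assms by (auto simp: tuples_def)
  have "hs \<sigma> (orb (Hs u) D (enum ?E)) =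
      otimes (hs \<sigma> (orb (Hs u) D c)) (hs \<sigma> (orb (Hs u) ?E (enum ?E)))"
    by (rule pm.meas_chain[OF enum_tuples[OF E] assms(4,2,3)]) (use E in \<open>auto intro!: map_idI\<close>)
  moreover have "hs \<sigma> (orb (Hs u) ?E (enum ?E)) = (0, 1)"
    by (rule comp_val_trivial[OF assms(1) E enum_tuples[OF E]]) (use E in simp)
  ultimately show ?thesis by (simp add: comp_val_def)
qed

lemma comp_val_image:
  assumes e: "e \<in> V" "infn e" and g: "g \<in> G"
    and D: "finite E" "E \<subseteq> K (butlast e) (proj e)" "D \<subseteq> E"
  shows "comp_val (g (butlast e)) (proj e) (g ` E) (g ` D) = comp_val (butlast e) (proj e) E D"
proof -
  let ?u = "butlast e" and ?\<sigma> = "proj e"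
  interpret pm: perm_meas "Hs ?u" "K ?u ?\<sigma>" "hs ?\<sigma>" by (rule comp_perm_meas[OF e])
  have ge: "g e \<in> V" "infn (g e)" "butlast (g e) = g ?u" "proj (g e) = ?\<sigma>"
    using e g g_V[OF g] g_pred[OF g] by auto
  have pm': "perm_meas (Hs (g ?u)) (K (g ?u) ?\<sigma>) (hs ?\<sigma>)"
    using comp_perm_meas[OF ge(1,2)] ge(3,4) by simp
  have gK: "g ` X \<subseteq> K (g ?u) ?\<sigma>" if "X \<subseteq> K ?u ?\<sigma>" for X
    using that g_K[OF g, of ?u ?\<sigma>] by blast
  \<comment> \<open>The chosen enumeration of the image of \<open>E\<close> need not be
    \<open>map g (enum E)\<close>; independence of the enumeration bridges the gap.\<close>
  have "comp_val (g ?u) ?\<sigma> (g ` E) (g ` D) = hs ?\<sigma> (orb (Hs (g ?u)) (g ` D) (map g (enum E)))"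
  proof -
    have *: "g ` E = g ` D \<union> set (map g (enum E))" using D by auto
    show ?thesis
      by (subst *, rule comp_val_enum[OF pm'])
        (use D gK[of D] gK[of E] finite_subset[OF D(3)] in \<open>auto simp: tuples_def\<close>)
  qed
  also have "orb (Hs (g ?u)) (g ` D) (map g (enum E)) = map g ` orb (Hs ?u) D (enum E)"
    using ps.orb_image[OF g, of "insert ?u D" "enum E"] by (simp add: ps.orb_stabilizer)
  also have "hs ?\<sigma> \<dots> = hs ?\<sigma> (orb (Hs ?u) D (enum E))"
    by (rule comp_invariant[OF e g], rule pm.orb_Dset[OF enum_tuples])
      (use D finite_subset[OF D(3)] in auto)
  finally show ?thesis by (simp add: comp_val_def)
qed

text \<open>An infinity-node of the closure lies below a generator. But \<open>butlast e\<close> is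
  shorter than \<open>e\<close>, and the members of \<open>D\<close> have the same length as
  \<open>e\<close> and differ from it.\<close>

lemma infinite_comp_orbit:
  assumes e: "e \<in> V" "infn e" and D: "finite D" "D \<subseteq> K (butlast e) (proj e)" "e \<notin> D"
  shows "infinite (orb (Hs (butlast e)) D [e])"
  unfolding ps.orb_stabilizer
proof (rule infinite_orbit)
  have len: "length b = length e" if "b \<in> D" for b
    using that D(2) by (metis (mono_tags, lifting) K_def mem_Collect_eq proj_simps(1) subsetD)
  show "e \<notin> cl (insert (butlast e) D)"
  proof
    assume "e \<in> cl (insert (butlast e) D)"
    then obtain b where b: "b \<in> insert (butlast e) D" "prefix e b" using cl_infn e(2) by blast
    show False
    proof (cases "b = butlast e")
      case True
      then have "length e \<le> length (butlast e)" using b(2) prefix_length_le by blast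
      then show False using infn_not_Nil[OF e(2)] by (cases e rule: rev_cases) auto
    next
      case False
      then have "b \<in> D" using b(1) by simp
      then have "b = e" using b(2) len by (metis prefix_iff_take take_all order_refl)
      then show False using D(3) \<open>b \<in> D\<close> by simp
    qed
  qed
  show "insert (butlast e) D \<subseteq> V" using D(2) K_V butlast_V[OF e(1)] by blast
qed (use D e in auto)

text \<open>Points are added one at a time. Each new factor is the value of an infinite orbit in a
  component of dimension 1, so it has dimension 1; its value is then not \<open>(0, 0)\<close> and
  its measure is positive.\<close>

lemma comp_val_dim_pos:
  assumes pm: "perm_meas (Hs u) (K u \<sigma>) (hs \<sigma>)" and \<sigma>: "\<sigma> \<in> inf_nodes \<Gamma> lam"
    and F: "finite F" "F \<subseteq> K u \<sigma>" and D: "finite D" "D \<subseteq> K u \<sigma>" "F \<inter> D = {}"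
  shows "fst (comp_val u \<sigma> (D \<union> F) D) = card F \<and> snd (comp_val u \<sigma> (D \<union> F) D) > 0"
  using F D(3)
proof (induction F rule: finite_induct)
  case empty
  then show ?case using comp_val_refl[OF pm D(1,2)] by simp
next
  case (insert x F)
  interpret pm: perm_meas "Hs u" "K u \<sigma>" "hs \<sigma>" by (rule pm)
  let ?E = "D \<union> F"
  have x: "x \<in> V" "infn x" "butlast x = u" "proj x = \<sigma>" "[x] \<in> tuples (K u \<sigma>) 1" "x \<notin> ?E"
    using insert \<sigma> by (auto simp: K_def tuples_def)
  have E: "finite ?E" "?E \<subseteq> K u \<sigma>" using insert D by auto
  have "comp_val u \<sigma> (insert x ?E) D = otimes (comp_val u \<sigma> ?E D) (comp_val u \<sigma> (insert x ?E) ?E)"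
    by (rule comp_val_chain[OF pm]) (use insert D in auto)
  moreover have "comp_val u \<sigma> (?E \<union> set [x]) ?E = hs \<sigma> (orb (Hs u) ?E [x])"
    by (rule comp_val_enum[OF pm E x(5)])
  moreover have "fst (hs \<sigma> (orb (Hs u) ?E [x])) = 1"
  proof (rule pm.infinite_dim1)
    have "solset (C x) 1 (Eq (Var 0) (Var 0)) [] = tuples (K u \<sigma>) 1"
      using x(3,4) by (simp add: solset_def)
    then show "fst (hs \<sigma> (tuples (K u \<sigma>) 1)) = 1" using dim1[OF \<sigma> x(1,4)] by simp
    show "orb (Hs u) ?E [x] \<in> Dset (Hs u) (K u \<sigma>) 1" by (rule pm.orb_Dset[OF x(5) E])
    show "infinite (orb (Hs u) ?E [x])"
      using infinite_comp_orbit[OF x(1,2), of ?E] x(3,4,6) E by simp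
  qed
  moreover then have "snd (hs \<sigma> (orb (Hs u) ?E [x])) > 0"
    using pm.positive[OF pm.orb_Dset[OF x(5) E]] by (metis fst_conv zero_neq_one)
  ultimately show ?case using insert by (simp add: otimes_def)
qed

lemma K_inf: "(u, \<sigma>) \<in> comp_ix F \<Longrightarrow> x \<in> B \<Longrightarrow> x \<in> K u \<sigma> \<Longrightarrow> (u, \<sigma>) \<in> comp_ix B"
  by (auto simp: comp_ix_def K_def intro!: image_eqI[of _ _ x])

lemma closed_val_refl:
  assumes "finite A" "A \<subseteq> V"
  shows "closed_val A A = (0, 1)"
  unfolding closed_val_def by (rule oprod_neutral) (use assms in \<open>auto intro!: comp_val_refl comp_ix_perm_meas\<close>)

lemma closed_val_chain:
  assumes F: "finite F" "F \<subseteq> V" and sub: "A \<subseteq> B" "B \<subseteq> F"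
  shows "closed_val F A = otimes (closed_val B A) (closed_val F B)"
proof -
  let ?m = "\<lambda>X Y (u, \<sigma>). comp_val u \<sigma> (X \<inter> K u \<sigma>) (Y \<inter> K u \<sigma>)"
  have "?m F A i = otimes (?m B A i) (?m F B i)" if "i \<in> comp_ix F" for i
  proof -
    obtain u \<sigma> where i: "i = (u, \<sigma>)" by (cases i)
    show ?thesis
      unfolding i split by (rule comp_val_chain[OF comp_ix_perm_meas[OF _ F(2)]]) (use that i F sub in auto)
  qed
  then have "closed_val F A = otimes (oprod (comp_ix F) (?m B A)) (closed_val F B)"
    unfolding closed_val_def oprod_otimes[symmetric] by (intro oprod_cong) auto
  \<comment> \<open>A component that meets \<open>F\<close> but not \<open>B\<close> has empty
    traces of \<open>B\<close> and \<open>A\<close> and contributes the neutral value.\<close>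
  moreover have "oprod (comp_ix B) (?m B A) = oprod (comp_ix F) (?m B A)"
  proof (rule oprod_mono_neutral)
    show "comp_ix B \<subseteq> comp_ix F" using sub(2) by (auto simp: comp_ix_def)
    fix i assume i: "i \<in> comp_ix F - comp_ix B"
    obtain u \<sigma> where u: "i = (u, \<sigma>)" by (cases i)
    have "B \<inter> K u \<sigma> = {}" "A \<inter> K u \<sigma> = {}" using i u K_inf sub by blast+
    then show "?m B A i = (0, 1)" using comp_val_refl[OF comp_ix_perm_meas[OF _ F(2)], of u \<sigma> "{}"] i u by simp
  qed (use F in simp)
  ultimately show ?thesis by (simp add: closed_val_def)
qed

lemma closed_val_image:
  assumes B: "finite B" "B \<subseteq> V" "A \<subseteq> B" and g: "g \<in> G"
  shows "closed_val (g ` B) (g ` A) = closed_val B A"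
proof -
  let ?h = "\<lambda>(u, \<sigma>). (g u, \<sigma>)"
  have comp_ix: "comp_ix (g ` B) = ?h ` comp_ix B"
  proof -
    have "{e \<in> g ` B. infn e} = g ` {e \<in> B. infn e}" using B(2) g by (auto simp: subset_iff)
    then have "comp_ix (g ` B) = (\<lambda>e. (butlast (g e), proj (g e))) ` {e \<in> B. infn e}"
      by (simp add: comp_ix_def image_image)
    also have "\<dots> = (\<lambda>e. (g (butlast e), proj e)) ` {e \<in> B. infn e}"
      by (rule image_cong) (use B(2) g g_pred[OF g] in auto)
    finally show ?thesis by (simp add: comp_ix_def image_image)
  qed
  have inj: "inj_on ?h (comp_ix B)" using g by (auto simp: inj_on_def)
  have "closed_val (g ` B) (g ` A) = oprod (comp_ix B) (\<lambda>(u, \<sigma>). comp_val (g u) \<sigma> (g ` B \<inter> K (g u) \<sigma>) (g ` A \<inter> K (g u) \<sigma>))"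
    unfolding closed_val_def comp_ix oprod_reindex[OF inj] by (rule oprod_cong) auto
  also have "\<dots> = oprod (comp_ix B) (\<lambda>(u, \<sigma>). comp_val u \<sigma> (B \<inter> K u \<sigma>) (A \<inter> K u \<sigma>))"
  proof (rule oprod_cong[OF refl])
    fix i assume i: "i \<in> comp_ix B"
    obtain u \<sigma> where u: "i = (u, \<sigma>)" by (cases i)
    obtain e where e: "e \<in> B" "e \<in> V" "infn e" "u = butlast e" "\<sigma> = proj e"
      using i B(2) unfolding u by (rule comp_ixE)
    have int: "g ` X \<inter> K (g u) \<sigma> = g ` (X \<inter> K u \<sigma>)" for X
      unfolding g_K[OF g, symmetric] using g by auto
    show "(\<lambda>(u, \<sigma>). comp_val (g u) \<sigma> (g ` B \<inter> K (g u) \<sigma>) (g ` A \<inter> K (g u) \<sigma>)) i =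
        (\<lambda>(u, \<sigma>). comp_val u \<sigma> (B \<inter> K u \<sigma>) (A \<inter> K u \<sigma>)) i"
      unfolding u split int unfolding e(4,5)
      by (rule comp_val_image[OF e(2,3) g]) (use B in auto)
  qed
  finally show ?thesis by (simp add: closed_val_def)
qed

text \<open>The components partition the infinity-nodes of \<open>B\<close>, so the component
  dimensions add up to the number of all new ones.\<close>

lemma closed_val_dim_pos:
  assumes B: "finite B" "B \<subseteq> V" "A \<subseteq> B"
  shows "fst (closed_val B A) = card {x \<in> B - A. infn x}" "snd (closed_val B A) > 0"
proof -
  have *: "fst (comp_val u \<sigma> (B \<inter> K u \<sigma>) (A \<inter> K u \<sigma>)) = card (B \<inter> K u \<sigma> - A) \<and>
      snd (comp_val u \<sigma> (B \<inter> K u \<sigma>) (A \<inter> K u \<sigma>)) > 0" if i: "(u, \<sigma>) \<in> comp_ix B" for u \<sigma>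
  proof -
    have "\<sigma> \<in> inf_nodes \<Gamma> lam" using i by (auto simp: comp_ix_def)
    from comp_val_dim_pos[OF comp_ix_perm_meas[OF i B(2)] this, of "B \<inter> K u \<sigma> - A" "A \<inter> K u \<sigma>"]
    have "fst (comp_val u \<sigma> ((A \<inter> K u \<sigma>) \<union> (B \<inter> K u \<sigma> - A)) (A \<inter> K u \<sigma>)) = card (B \<inter> K u \<sigma> - A) \<and>
        snd (comp_val u \<sigma> ((A \<inter> K u \<sigma>) \<union> (B \<inter> K u \<sigma> - A)) (A \<inter> K u \<sigma>)) > 0"
      using B finite_subset[OF B(3)] by blast
    moreover have "(A \<inter> K u \<sigma>) \<union> (B \<inter> K u \<sigma> - A) = B \<inter> K u \<sigma>" using B(3) by auto
    ultimately show ?thesis by simp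
  qed
  have "{x \<in> B - A. infn x} = (\<Union>(u, \<sigma>)\<in>comp_ix B. B \<inter> K u \<sigma> - A)"
    using B(2) by (auto simp: comp_ix_def K_def)
  moreover have "card (\<Union>(u, \<sigma>)\<in>comp_ix B. B \<inter> K u \<sigma> - A) = (\<Sum>(u, \<sigma>)\<in>comp_ix B. card (B \<inter> K u \<sigma> - A))"
    unfolding split_def by (rule card_UN_disjoint) (use B in \<open>auto simp: K_def prod_eq_iff\<close>)
  moreover have "fst (closed_val B A) = (\<Sum>(u, \<sigma>)\<in>comp_ix B. card (B \<inter> K u \<sigma> - A))"
    unfolding closed_val_def oprod_def fst_conv by (rule sum.cong) (use * in auto)
  ultimately show "fst (closed_val B A) = card {x \<in> B - A. infn x}" by simp
  show "snd (closed_val B A) > 0"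
    unfolding closed_val_def oprod_def snd_conv by (rule prod_pos) (use * in auto)
qed

text \<open>Closing up adds the single infinity-node \<open>e\<close>, so every other component
  keeps its trace and contributes the neutral value. The remaining factor is a component orbit,
  which \<open>component_orbit\<close> identifies with the orbit in \<open>M\<close>.\<close>

lemma closed_val_one:
  assumes A: "finite A" "cl A = A" and e: "e \<in> V" "infn e" "e \<notin> A" "butlast e \<in> A"
  shows "closed_val (cl (insert e A)) A = hs (proj e) (orb G A [e])"
proof -
  let ?u = "butlast e" and ?\<sigma> = "proj e" and ?B = "cl (insert e A)"
  let ?D = "A \<inter> K ?u ?\<sigma>"
  have AV: "A \<subseteq> V" using cl_V[of A] A(2) by simp
  have BV: "?B \<subseteq> V" by (rule cl_V)
  have AB: "insert e A \<subseteq> ?B" by (rule cl_extensive) (use AV e in auto)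
  have new: "x = e \<or> x \<in> A" if "x \<in> ?B" "infn x" for x using cl_insert_infn[OF A(2) e(4) that] .
  have B: "finite ?B" using A by (simp add: cl_finite)
  let ?m = "\<lambda>(u, \<sigma>). comp_val u \<sigma> (?B \<inter> K u \<sigma>) (A \<inter> K u \<sigma>)"
  have "oprod {(?u, ?\<sigma>)} ?m = oprod (comp_ix ?B) ?m"
  proof (rule oprod_mono_neutral)
    show "{(?u, ?\<sigma>)} \<subseteq> comp_ix ?B" using AB e by (auto simp: comp_ix_def)
    fix i assume i: "i \<in> comp_ix ?B - {(?u, ?\<sigma>)}"
    obtain u \<sigma> where u: "i = (u, \<sigma>)" by (cases i)
    have "\<sigma> \<in> inf_nodes \<Gamma> lam" using i u by (auto simp: comp_ix_def)
    then have "?B \<inter> K u \<sigma> = A \<inter> K u \<sigma>" using new AB i u by (auto simp: K_def)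
    then show "?m i = (0, 1)" using comp_val_refl[OF comp_ix_perm_meas[OF _ BV], of u \<sigma> "A \<inter> K u \<sigma>"] i u A by simp
  qed (use B in simp)
  then have "closed_val ?B A = comp_val ?u ?\<sigma> (?B \<inter> K ?u ?\<sigma>) ?D" by (simp add: closed_val_def oprod_def)
  also have "?B \<inter> K ?u ?\<sigma> = ?D \<union> set [e]"
  proof (intro equalityI subsetI)
    fix x assume x: "x \<in> ?B \<inter> K ?u ?\<sigma>"
    then have "infn x" using e(2) by (simp add: K_def)
    then show "x \<in> ?D \<union> set [e]" using new[of x] x by auto
  qed (use AB e(1) in \<open>auto simp: K_def\<close>)
  also have "comp_val ?u ?\<sigma> (?D \<union> set [e]) ?D = hs ?\<sigma> (orb (Hs ?u) ?D [e])"
    by (rule comp_val_enum[OF comp_perm_meas[OF e(1,2)]]) (use A e in \<open>auto simp: tuples_def K_def\<close>)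
  also have "orb (Hs ?u) ?D [e] = orb G A [e]" by (rule component_orbit[OF A e, symmetric])
  finally show ?thesis .
qed

text \<open>Passing to closures gives a value to every tuple over every base. It sees the tuple only
  through the closed set generated with the base, so interdefinable tuples share their
  value.\<close>

definition type_val :: "'s node list \<Rightarrow> 's node set \<Rightarrow> nat \<times> real" where
  "type_val x A = closed_val (cl (A \<union> set x)) (cl A)"

lemma cl_Un_cl: "A \<subseteq> V \<Longrightarrow> B \<subseteq> V \<Longrightarrow> cl (cl A \<union> B) = cl (A \<union> B)"
  by (intro equalityI cl_least) (use cl_mono[of A "A \<union> B"] cl_extensive[of "A \<union> B"] cl_V
     cl_extensive[of A] cl_extensive[of "cl A \<union> B"] in blast)+

lemma orb_cl: "A \<subseteq> V \<Longrightarrow> orb G (cl A) x = orb G A x"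
  using cl_fix[of _ A] cl_extensive[of A] unfolding orb_def by blast

lemma cl_mono_Un: "A \<subseteq> V \<Longrightarrow> B \<subseteq> V \<Longrightarrow> cl A \<subseteq> cl (A \<union> B)"
  by (rule cl_mono) auto

lemma type_val_image:
  assumes "finite A" "A \<subseteq> V" "set x \<subseteq> V" "g \<in> G"
  shows "type_val (map g x) (g ` A) = type_val x A"
proof -
  have AxV: "A \<union> set x \<subseteq> V" using assms by auto
  have "cl (g ` A \<union> set (map g x)) = g ` cl (A \<union> set x)" "cl (g ` A) = g ` cl A"
    using cl_image[OF assms(4) AxV] cl_image[OF assms(4,2)] by (simp_all add: image_Un)
  then show ?thesis
    unfolding type_val_def using closed_val_image[OF _ cl_V cl_mono[OF _ AxV] assms(4)] cl_finite assms(1) by simp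
qed

lemma type_val_invariant:
  assumes "finite A" "A \<subseteq> V" "set x \<subseteq> V" "y \<in> orb G A x"
  shows "type_val y A = type_val x A"
proof -
  obtain g where g: "g \<in> G" "\<forall>a\<in>A. g a = a" "y = map g x" using assms(4) by (rule ps.orbE)
  have "g ` A = A" using g(2) by force
  then show ?thesis using type_val_image[OF assms(1-3) g(1)] g(3) by simp
qed

text \<open>The tower property of \<open>closed_val\<close>, read for tuples; this is the
  multiplicative half of Fubini.\<close>

lemma type_val_append:
  assumes "finite A" "A \<subseteq> V" "set x \<subseteq> V" "set y \<subseteq> V"
  shows "type_val (x @ y) A = otimes (type_val x A) (type_val y (A \<union> set x))"
proof -
  have "closed_val (cl (A \<union> set x \<union> set y)) (cl A) =
      otimes (closed_val (cl (A \<union> set x)) (cl A)) (closed_val (cl (A \<union> set x \<union> set y)) (cl (A \<union> set x)))"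
    by (rule closed_val_chain[OF cl_finite cl_V cl_mono_Un cl_mono_Un]) (use assms in auto)
  then show ?thesis by (simp add: type_val_def Un_assoc)
qed

lemma type_val_interdefinable: "cl (A \<union> set x) = cl (A \<union> set y) \<Longrightarrow> type_val x A = type_val y A"
  by (simp add: type_val_def)

lemma type_val_trivial:
  assumes "finite A" "A \<subseteq> V" "set x \<subseteq> cl A"
  shows "type_val x A = (0, 1)"
proof -
  have "cl (A \<union> set x) \<subseteq> cl A" by (rule cl_least) (use assms cl_extensive in auto)
  moreover have "cl A \<subseteq> cl (A \<union> set x)" by (rule cl_mono) (use assms cl_V in auto)
  ultimately show ?thesis using closed_val_refl[OF cl_finite[OF assms(1)] cl_V] by (simp add: type_val_def)
qed

lemma type_val_cl: "A \<subseteq> V \<Longrightarrow> set x \<subseteq> V \<Longrightarrow> type_val x (cl A) = type_val x A"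
  by (simp add: type_val_def cl_Un_cl)

lemma type_val_dim_pos:
  assumes "finite A" "A \<subseteq> V" "set x \<subseteq> V"
  shows "fst (type_val x A) = card {y \<in> cl (A \<union> set x) - cl A. infn y}" "snd (type_val x A) > 0"
  unfolding type_val_def
  using closed_val_dim_pos[OF cl_finite cl_V cl_mono_Un[OF assms(2,3)]] assms by simp_all

lemma type_val_one:
  assumes A: "finite A" "A \<subseteq> V" and e: "e \<in> V" "infn e" "e \<notin> cl A" "butlast e \<in> cl A"
  shows "type_val [e] A = hs (proj e) (orb G A [e])"
proof -
  have "type_val [e] (cl A) = hs (proj e) (orb G (cl A) [e])"
    using closed_val_one[OF cl_finite[OF A(1)] cl_idem e] by (simp add: type_val_def)
  then show ?thesis using type_val_cl[OF A(2)] orb_cl[OF A(2)] e(1) by simp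
qed

end

section \<open>Additivity over extensions of the base\<close>

text \<open>A transversal of the orbits over \<open>A\<close> that meet \<open>X\<close>; sums over
  types become sums over representing tuples.\<close>

definition transv :: "('a \<Rightarrow> 'a) set \<Rightarrow> 'a set \<Rightarrow> 'a list set \<Rightarrow> 'a list set \<Rightarrow> bool" where
  "transv G A X T \<longleftrightarrow> T \<subseteq> X \<and> (\<forall>x\<in>X. \<exists>t\<in>T. t \<in> orb G A x) \<and>
     (\<forall>t\<in>T. \<forall>t'\<in>T. t' \<in> orb G A t \<longrightarrow> t' = t)"

context perm_group
begin

lemma transv_ex: "\<exists>T. transv G A X T"
proof -
  define c where "c q = (SOME x. x \<in> q \<and> x \<in> X)" for q
  have c: "c (orb G A x) \<in> orb G A x \<and> c (orb G A x) \<in> X" if "x \<in> X" for x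
    unfolding c_def by (rule someI[of _ x]) (use that in simp)
  have "transv G A X ((\<lambda>x. c (orb G A x)) ` X)"
    unfolding transv_def
  proof (intro conjI ballI impI)
    fix t t' assume "t \<in> (\<lambda>x. c (orb G A x)) ` X" "t' \<in> (\<lambda>x. c (orb G A x)) ` X" "t' \<in> orb G A t"
    then obtain x y where x: "x \<in> X" "t = c (orb G A x)" and y: "y \<in> X" "t' = c (orb G A y)"
      and t: "t' \<in> orb G A t" by blast
    have "orb G A x = orb G A t" "orb G A y = orb G A t'" using c[OF x(1)] c[OF y(1)] x(2) y(2) orb_eq by auto
    moreover have "orb G A t' = orb G A t" using t by (rule orb_eq)
    ultimately show "t' = t" using x(2) y(2) by simp
  qed (use c in auto)
  then show ?thesis by blast
qed

text \<open>Matching representatives of the same orbit is a bijection between the two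
  transversals.\<close>

lemma transv_osum:
  assumes T: "transv G A X T" "transv G A X T'"
    and f: "\<And>x y. x \<in> X \<Longrightarrow> y \<in> orb G A x \<Longrightarrow> f y = f x"
  shows "osum T f = osum T' f"
proof -
  have "\<forall>t\<in>T. \<exists>t'\<in>T'. t' \<in> orb G A t" using T unfolding transv_def by blast
  then obtain \<phi> where \<phi>: "\<And>t. t \<in> T \<Longrightarrow> \<phi> t \<in> T' \<and> \<phi> t \<in> orb G A t" by metis
  have inj: "inj_on \<phi> T"
  proof (rule inj_onI)
    fix t s assume ts: "t \<in> T" "s \<in> T" "\<phi> t = \<phi> s"
    then have "s \<in> orb G A t" using \<phi>[of t] \<phi>[of s] orb_sym orb_trans by metis
    then show "t = s" using T(1) ts unfolding transv_def by blast
  qed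
  have "\<phi> ` T = T'"
  proof (intro equalityI subsetI)
    fix t' assume t': "t' \<in> T'"
    then obtain t where t: "t \<in> T" "t \<in> orb G A t'" using T unfolding transv_def by blast
    then have "\<phi> t \<in> orb G A t'" using \<phi>[OF t(1)] orb_trans by blast
    then have "\<phi> t = t'" using T(2) \<phi>[OF t(1)] t' unfolding transv_def by blast
    then show "t' \<in> \<phi> ` T" using t(1) by blast
  qed (use \<phi> in auto)
  then have "osum T' f = osum T (\<lambda>t. f (\<phi> t))" using osum_reindex[OF inj] by metis
  also have "\<dots> = osum T f"
    by (rule osum_cong[OF refl]) (use f \<phi> T(1) in \<open>auto simp: transv_def\<close>)
  finally show ?thesis by simp
qed

lemma transv_image:
  assumes "transv G A X T" "g \<in> G"
  shows "transv G (g ` A) (map g ` X) (map g ` T)"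
  unfolding transv_def
proof (intro conjI)
  have mem: "map g y \<in> map g ` Z \<longleftrightarrow> y \<in> Z" for y Z using map_eq_iff[OF assms(2)] by auto
  show "map g ` T \<subseteq> map g ` X" using assms(1) by (auto simp: transv_def)
  show "\<forall>x\<in>map g ` X. \<exists>t\<in>map g ` T. t \<in> orb G (g ` A) x"
    using assms(1) unfolding transv_def by (auto simp: orb_image[OF assms(2)] mem)
  show "\<forall>t\<in>map g ` T. \<forall>t'\<in>map g ` T. t' \<in> orb G (g ` A) t \<longrightarrow> t' = t"
    using assms(1) unfolding transv_def by (auto simp: orb_image[OF assms(2)] mem)
qed

lemma transv_orb: "transv G A (orb G A x) {x}"
  unfolding transv_def by (auto intro: orb_sym)

lemma transv_nonempty:
  assumes "transv G A X T" "x \<in> X"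
  shows "T \<noteq> {}"
  using assms unfolding transv_def by blast

end

context perm_struct
begin

lemma transv_finite:
  assumes "transv G A X T" "X \<subseteq> tuples (univ N) n" "finite A" "A \<subseteq> univ N"
  shows "finite T"
proof -
  have "inj_on (orb G A) T"
  proof (rule inj_onI)
    fix t s assume "t \<in> T" "s \<in> T" "orb G A t = orb G A s"
    then show "t = s" using assms(1) orb_refl[of s A] unfolding transv_def by metis
  qed
  moreover have "orb G A ` T \<subseteq> orb G A ` tuples (univ N) n"
    using assms(1,2) by (auto simp: transv_def)
  ultimately show ?thesis
    using finite_orbits_over[OF assms(3,4)] by (meson finite_imageD finite_subset)
qed

end

context nic_meas
begin

text \<open>The additivity under enlarging the base that later makes \<open>global_val\<close>
  independent of the support chosen.\<close>

definition ext_add :: "'s node list \<Rightarrow> 's node set \<Rightarrow> bool" where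
  "ext_add x A \<longleftrightarrow> (\<forall>A' T. finite A' \<and> A \<subseteq> A' \<and> A' \<subseteq> V \<and> transv G A' (orb G A x) T \<longrightarrow>
     type_val x A = osum T (\<lambda>t. type_val t A'))"

lemma orb_V: "set x \<subseteq> V \<Longrightarrow> y \<in> orb G A x \<Longrightarrow> set y \<subseteq> V"
  using g_V by (fastforce simp: orb_def)

lemma orb_tuples_V: "set x \<subseteq> V \<Longrightarrow> orb G A x \<subseteq> tuples (univ M) (length x)"
  by (rule ps.orb_tuples) (simp add: tuples_def)

lemma type_val_transv:
  assumes "transv G A X T" "transv G A X T'" "X \<subseteq> tuples V n" "finite A" "A \<subseteq> V"
  shows "osum T (\<lambda>t. type_val t A) = osum T' (\<lambda>t. type_val t A)"
  by (rule ps.transv_osum[OF assms(1,2)]) (use assms in \<open>auto intro!: type_val_invariant simp: tuples_def\<close>)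

text \<open>Values are constant on orbits over the larger base, so a single convenient transversal
  suffices.\<close>

lemma ext_addI:
  assumes "set x \<subseteq> V"
    and "\<And>A'. finite A' \<Longrightarrow> A \<subseteq> A' \<Longrightarrow> A' \<subseteq> V \<Longrightarrow>
      \<exists>T. transv G A' (orb G A x) T \<and> type_val x A = osum T (\<lambda>t. type_val t A')"
  shows "ext_add x A"
  unfolding ext_add_def
proof (intro allI impI, elim conjE)
  fix A' T assume A': "finite A'" "A \<subseteq> A'" "A' \<subseteq> V" "transv G A' (orb G A x) T"
  then obtain T' where T': "transv G A' (orb G A x) T'" "type_val x A = osum T' (\<lambda>t. type_val t A')"
    using assms(2) by blast
  have "osum T' (\<lambda>t. type_val t A') = osum T (\<lambda>t. type_val t A')"
    by (rule type_val_transv[OF T'(1) A'(4) _ A'(1,3)]) (use orb_tuples_V[OF assms(1)] in simp)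
  then show "type_val x A = osum T (\<lambda>t. type_val t A')" using T'(2) by simp
qed

lemma ext_add_trivial:
  assumes "finite A" "A \<subseteq> V" "set x \<subseteq> cl A"
  shows "ext_add x A"
proof (rule ext_addI)
  show "set x \<subseteq> V" using assms(3) cl_V by blast
  fix A' assume A': "finite A'" "A \<subseteq> A'" "A' \<subseteq> V"
  have "orb G A x = {x}"
    using ps.orb_fixed[OF assms(3)] orb_cl[OF assms(2)] by simp
  moreover have "transv G A' {x} {x}" by (simp add: transv_def)
  moreover have "set x \<subseteq> cl A'" using assms(3) cl_mono[OF A'(2,3)] by blast
  ultimately show "\<exists>T. transv G A' (orb G A x) T \<and> type_val x A = osum T (\<lambda>t. type_val t A')"
    using type_val_trivial[OF assms] type_val_trivial[OF A'(1,3)] by (intro exI[of _ "{x}"]) simp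
qed

text \<open>A base and its closure have the same orbits and values; hence the induction may run over
  closed bases.\<close>

lemma ext_add_cl:
  assumes "finite A" "A \<subseteq> V" "set x \<subseteq> V"
  shows "ext_add x (cl A) \<longleftrightarrow> ext_add x A"
proof
  assume *: "ext_add x (cl A)"
  show "ext_add x A"
    unfolding ext_add_def
  proof (intro allI impI, elim conjE)
    fix A' T assume A': "finite A'" "A \<subseteq> A'" "A' \<subseteq> V" "transv G A' (orb G A x) T"
    have "transv G (cl A') (orb G (cl A) x) T" using A' by (simp add: transv_def orb_cl assms(2))
    moreover have "finite (cl A')" "cl A \<subseteq> cl A'" "cl A' \<subseteq> V" using A' cl_finite cl_mono cl_V by auto
    ultimately have "type_val x (cl A) = osum T (\<lambda>t. type_val t (cl A'))"
      using * unfolding ext_add_def by blast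
    also have "\<dots> = osum T (\<lambda>t. type_val t A')"
    proof (rule osum_cong[OF refl])
      fix t assume "t \<in> T"
      then have "set t \<subseteq> V" using A'(4) orb_V[OF assms(3)] by (auto simp: transv_def)
      then show "type_val t (cl A') = type_val t A'" using type_val_cl[OF A'(3)] by simp
    qed
    finally show "type_val x A = osum T (\<lambda>t. type_val t A')" using type_val_cl assms by simp
  qed
next
  assume *: "ext_add x A"
  show "ext_add x (cl A)"
    unfolding ext_add_def
  proof (intro allI impI, elim conjE)
    fix A' T assume A': "finite A'" "cl A \<subseteq> A'" "A' \<subseteq> V" "transv G A' (orb G (cl A) x) T"
    have "A \<subseteq> A'" using A'(2) cl_extensive[OF assms(2)] by blast
    then have "type_val x A = osum T (\<lambda>t. type_val t A')"
      using * A' unfolding ext_add_def by (simp add: orb_cl assms(2))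
    then show "type_val x (cl A) = osum T (\<lambda>t. type_val t A')" using type_val_cl assms by simp
  qed
qed

text \<open>Over a larger base \<open>A'\<close> the type of \<open>e\<close> splits into types whose measures are all computed in
  the component of \<open>e\<close>, so the claim is additivity of the measure of that component.\<close>

lemma ext_add_one:
  assumes A: "finite A" "A \<subseteq> V" and e: "e \<in> V" "infn e" "e \<notin> cl A" "butlast e \<in> cl A"
  shows "ext_add [e] A"
proof (rule ext_addI)
  fix A' assume A': "finite A'" "A \<subseteq> A'" "A' \<subseteq> V"
  let ?u = "butlast e" and ?\<sigma> = "proj e"
  interpret pm: perm_meas "Hs ?u" "K ?u ?\<sigma>" "hs ?\<sigma>" by (rule comp_perm_meas[OF e(1,2)])
  obtain T where T: "transv G A' (orb G A [e]) T" using ps.transv_ex by blast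
  have fT: "finite T" by (rule ps.transv_finite[OF T]) (use A' orb_tuples_V[of "[e]"] e(1) in auto)
  have clA': "cl A \<subseteq> cl A'" by (rule cl_mono[OF A'(2,3)])
  have u: "?u \<in> cl A'" using e(4) clA' by blast
  have *: "orb G A' t \<in> Dset (Hs ?u) (K ?u ?\<sigma>) 1 \<and> type_val t A' = hs ?\<sigma> (orb G A' t)" if "t \<in> T" for t
  proof -
    have "t \<in> orb G A [e]" using T that by (auto simp: transv_def)
    then obtain g where g: "g \<in> G" "\<forall>a\<in>A. g a = a" "t = [g e]" by (auto elim: ps.orbE)
    have gu: "g ?u = ?u" by (rule cl_fix[OF g(1) A(2) g(2) e(4)])
    let ?e = "g e"
    have ge: "?e \<in> V" "infn ?e" "butlast ?e = ?u" "proj ?e = ?\<sigma>"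
      using g_V[OF g(1)] g_pred[OF g(1) e(1)] gu g(1) e by auto
    then have geK: "[?e] \<in> tuples (K ?u ?\<sigma>) 1" by (simp add: tuples_def K_def)
    show ?thesis
    \<comment> \<open>A representative swallowed by the larger closure is a single point of value
      \<open>(0, 1)\<close>; the others are component orbits by nil interaction.\<close>
    proof (cases "?e \<in> cl A'")
      case True
      have o: "orb G A' t = {t}" using ps.orb_fixed[of t "cl A'"] orb_cl[OF A'(3)] True g(3) by simp
      have "orb (Hs ?u) {?e} [?e] = {[?e]}" by (rule pm.orb_fixed) simp
      then have D: "{t} \<in> Dset (Hs ?u) (K ?u ?\<sigma>) 1"
        using pm.orb_Dset[OF geK, of "{?e}"] geK g(3) by (simp add: tuples_def)
      then show ?thesis using pm.finite_sets[OF D] type_val_trivial[OF A'(1,3), of t] True g(3) o by simp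
    next
      case False
      have "orb G A' t = orb (Hs ?u) (cl A' \<inter> K ?u ?\<sigma>) t"
        using component_orbit[OF cl_finite[OF A'(1)] cl_idem ge(1,2) False] u ge(3,4) orb_cl[OF A'(3)] g(3)
        by simp
      moreover have "orb (Hs ?u) (cl A' \<inter> K ?u ?\<sigma>) t \<in> Dset (Hs ?u) (K ?u ?\<sigma>) 1"
        using pm.orb_Dset[OF geK] cl_finite[OF A'(1)] g(3) by simp
      moreover have "type_val t A' = hs ?\<sigma> (orb G A' t)"
        using type_val_one[OF A'(1,3) ge(1,2) False] u ge(3,4) g(3) by simp
      ultimately show ?thesis by simp
    qed
  qed
  have "T \<noteq> {}" by (rule ps.transv_nonempty[OF T ps.orb_refl])
  have "hs ?\<sigma> (\<Union>t\<in>T. orb G A' t) = osum T (\<lambda>t. hs ?\<sigma> (orb G A' t))"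
  proof (rule pm.meas_partition[OF fT \<open>T \<noteq> {}\<close>])
    show "orb G A' t \<inter> orb G A' t' = {}" if "t \<in> T" "t' \<in> T" "t \<noteq> t'" for t t'
    proof (rule ccontr)
      assume "orb G A' t \<inter> orb G A' t' \<noteq> {}"
      then have "t' \<in> orb G A' t" using ps.orb_sym ps.orb_trans by blast
      then show False using T that unfolding transv_def by blast
    qed
  qed (use * ps.orb_refl in blast)+
  moreover have "(\<Union>t\<in>T. orb G A' t) = orb G A [e]"
  proof (intro equalityI subsetI)
    fix y assume "y \<in> (\<Union>t\<in>T. orb G A' t)"
    then obtain t where "t \<in> T" "y \<in> orb G A t" using ps.orb_mono[OF A'(2)] by blast
    then show "y \<in> orb G A [e]" using T ps.orb_trans unfolding transv_def by blast
  next
    fix y assume "y \<in> orb G A [e]"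
    then obtain t where "t \<in> T" "t \<in> orb G A' y" using T unfolding transv_def by blast
    then show "y \<in> (\<Union>t\<in>T. orb G A' t)" using ps.orb_sym by blast
  qed
  moreover have "type_val [e] A = hs ?\<sigma> (orb G A [e])" by (rule type_val_one[OF A e])
  moreover have "osum T (\<lambda>t. hs ?\<sigma> (orb G A' t)) = osum T (\<lambda>t. type_val t A')"
    by (rule osum_cong) (use * in auto)
  ultimately show "\<exists>T. transv G A' (orb G A [e]) T \<and> type_val [e] A = osum T (\<lambda>t. type_val t A')"
    using T by auto
qed (use e in simp)

text \<open>The larger base and its transversal are pulled back along \<open>inv g\<close>.\<close>

lemma ext_add_image:
  assumes B: "finite B" "B \<subseteq> V" "set y \<subseteq> V" and g: "g \<in> G" and ext: "ext_add y B"
  shows "ext_add (map g y) (g ` B)"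
  unfolding ext_add_def
proof (intro allI impI, elim conjE)
  fix A' T assume A': "finite A'" "g ` B \<subseteq> A'" "A' \<subseteq> V" "transv G A' (orb G (g ` B) (map g y)) T"
  let ?k = "inv g"
  have k: "?k \<in> G" by (rule ps.inv_mem[OF g])
  have kk: "?k ` g ` Z = Z" "g ` ?k ` Z = Z" for Z using g by (simp_all add: image_image)
  have mk: "map ?k ` map g ` Z = Z" for Z using g by (simp add: image_image del: map_map)
  have "transv G (?k ` A') (orb G B y) (map ?k ` T)"
    using ps.transv_image[OF A'(4) k] by (simp only: ps.orb_image[OF g] mk)
  moreover have "finite (?k ` A')" "B \<subseteq> ?k ` A'" "?k ` A' \<subseteq> V"
    using A' kk(1)[of B] image_mono[OF A'(2), of ?k] g_V[OF k] by auto
  ultimately have "type_val y B = osum (map ?k ` T) (\<lambda>t. type_val t (?k ` A'))"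
    using ext unfolding ext_add_def by blast
  also have "\<dots> = osum T (\<lambda>t. type_val (map ?k t) (?k ` A'))"
    by (rule osum_reindex) (use ps.map_eq_iff[OF k] in \<open>auto simp: inj_on_def\<close>)
  also have "\<dots> = osum T (\<lambda>t. type_val t A')"
  proof (rule osum_cong[OF refl])
    fix t assume "t \<in> T"
    then have "t \<in> orb G (g ` B) (map g y)" using A'(4) by (auto simp: transv_def)
    moreover have "set (map g y) \<subseteq> V" using B(3) g_V[OF g] by auto
    ultimately have "set t \<subseteq> V" using orb_V by blast
    then show "type_val (map ?k t) (?k ` A') = type_val t A'" by (rule type_val_image[OF A'(1,3) _ k])
  qed
  also have "type_val y B = type_val (map g y) (g ` B)" using type_val_image[OF B g] by simp
  finally show "type_val (map g y) (g ` B) = osum T (\<lambda>t. type_val t A')" .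
qed

text \<open>First the orbit of \<open>x\<close> is split over \<open>A'\<close> into pieces
  represented by \<open>t\<close>, then over each \<open>t\<close> the orbit of the accordingly
  moved \<open>y\<close>. The chain rule and distributivity recombine the double sum.\<close>

lemma ext_add_append:
  assumes A: "finite A" "A \<subseteq> V" and xy: "set x \<subseteq> V" "set y \<subseteq> V"
    and x: "ext_add x A" and y: "ext_add y (A \<union> set x)"
  shows "ext_add (x @ y) A"
proof (rule ext_addI)
  show "set (x @ y) \<subseteq> V" using xy by simp
  fix A' assume A': "finite A'" "A \<subseteq> A'" "A' \<subseteq> V"
  obtain P where P: "transv G A' (orb G A x) P" using ps.transv_ex by blast
  have fP: "finite P" by (rule ps.transv_finite[OF P]) (use A' orb_tuples_V[OF xy(1)] in auto)
  have "P \<noteq> {}" by (rule ps.transv_nonempty[OF P ps.orb_refl])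
  have "\<forall>t\<in>P. \<exists>g. g \<in> G \<and> (\<forall>a\<in>A. g a = a) \<and> t = map g x"
    using P unfolding transv_def orb_def by blast
  then obtain g where g: "\<And>t. t \<in> P \<Longrightarrow> g t \<in> G \<and> (\<forall>a\<in>A. g t a = a) \<and> t = map (g t) x" by metis
  have gA: "g t ` (A \<union> set x) = A \<union> set t" if "t \<in> P" for t
  proof -
    have "g t ` A = A" using g[OF that] by force
    moreover have "set t = g t ` set x" using g[OF that] by (metis set_map)
    ultimately show ?thesis by (simp add: image_Un)
  qed
  have tV: "set t \<subseteq> V" "length t = length x" if "t \<in> P" for t
  proof -
    have "t \<in> orb G A x" using P that by (auto simp: transv_def)
    then show "set t \<subseteq> V" "length t = length x" using orb_V[OF xy(1)] ps.orb_length by blast+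
  qed
  \<comment> \<open>The element \<open>g t\<close> carries \<open>x\<close> to \<open>t\<close> over
    \<open>A\<close>, so \<open>map (g t) y\<close> stands to \<open>t\<close> as \<open>y\<close>
    stands to \<open>x\<close>.\<close>
  let ?Y = "\<lambda>t. orb G (A \<union> set t) (map (g t) y)"
  have "\<forall>t. \<exists>Q. transv G (A' \<union> set t) (?Y t) Q" using ps.transv_ex by blast
  then obtain Q where Q: "\<And>t. transv G (A' \<union> set t) (?Y t) (Q t)" by metis
  have gyV: "set (map (g t) y) \<subseteq> V" if "t \<in> P" for t using g[OF that] g_V xy(2) by auto
  have fQ: "finite (Q t)" if "t \<in> P" for t
    by (rule ps.transv_finite[OF Q orb_tuples_V[OF gyV[OF that]]]) (use A' tV[OF that] in auto)
  have neQ: "Q t \<noteq> {}" for t by (rule ps.transv_nonempty[OF Q ps.orb_refl])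
  have qV: "set q \<subseteq> V" if "t \<in> P" "q \<in> Q t" for t q
    using Q[of t] that orb_V[OF gyV[OF that(1)]] by (auto simp: transv_def)
  let ?T = "(\<lambda>(t, q). t @ q) ` Sigma P Q"
  have "transv G A' (orb G A (x @ y)) ?T"
    unfolding transv_def
  proof (intro conjI)
    show "?T \<subseteq> orb G A (x @ y)"
    proof (safe, simp)
      fix t q assume t: "t \<in> P" and q: "q \<in> Q t"
      then have "q \<in> ?Y t" using Q[of t] unfolding transv_def by blast
      then obtain k where k: "k \<in> G" "\<forall>a\<in>A \<union> set t. k a = a" "q = map k (map (g t) y)" by (rule ps.orbE)
      have "map k t = t" using k(2) by (auto intro: map_idI)
      then have "t = map k (map (g t) x)" using g[OF t] by simp
      then have "t @ q = map (\<lambda>a. k (g t a)) (x @ y)" using k(3) by (simp add: o_def)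
      moreover have "(\<lambda>a. k (g t a)) \<in> G" using ps.comp_mem[OF k(1)] g[OF t] by blast
      moreover have "\<forall>a\<in>A. k (g t a) = a" using g[OF t] k(2) by simp
      ultimately show "t @ q \<in> orb G A (x @ y)" unfolding orb_def by blast
    qed
    show "\<forall>z\<in>orb G A (x @ y). \<exists>s\<in>?T. s \<in> orb G A' z"
    proof
      fix z assume "z \<in> orb G A (x @ y)"
      then obtain h where h: "h \<in> G" "\<forall>a\<in>A. h a = a" "z = map h x @ map h y" by (auto elim: ps.orbE)
      have "map h x \<in> orb G A x" by (rule ps.orbI[OF h(1,2)])
      then obtain t where t: "t \<in> P" "t \<in> orb G A' (map h x)" using P unfolding transv_def by blast
      then obtain k where k: "k \<in> G" "\<forall>a\<in>A'. k a = a" "t = map k (map h x)" by (auto elim: ps.orbE)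
      \<comment> \<open>Compares two routes from \<open>x\<close> to \<open>t\<close>, one by
        \<open>g t\<close> and one by \<open>h\<close> followed by \<open>k\<close>; the difference
        fixes \<open>A\<close> and \<open>t\<close> and therefore acts on
        \<open>?Y t\<close>.\<close>
      let ?d = "\<lambda>a. k (h (inv (g t) a))"
      have gt: "g t \<in> G" "\<forall>a\<in>A. g t a = a" "t = map (g t) x" using g[OF t(1)] by auto
      have d: "?d \<in> G" by (rule ps.comp_mem[OF k(1) ps.comp_mem[OF h(1) ps.inv_mem[OF gt(1)]]])
      have "map ?d (map (g t) x) = t" using gt(1) k(3) by simp
      then have "map ?d t = t" using gt(3) by simp
      then have dt: "\<forall>a\<in>set t. ?d a = a" by (metis map_eq_conv map_ident)
      have dA: "\<forall>a\<in>A. ?d a = a"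
      proof
        fix a assume a: "a \<in> A"
        then have "inv (g t) a = a" using ps.inv_fix[OF gt(1)] gt(2) by blast
        then show "?d a = a" using h(2) k(2) a A'(2) by auto
      qed
      have "map ?d (map (g t) y) \<in> ?Y t" by (rule ps.orbI[OF d]) (use dt dA in blast)
      moreover have "map ?d (map (g t) y) = map k (map h y)" using gt(1) by simp
      ultimately have "map k (map h y) \<in> ?Y t" by (simp only:)
      then obtain q where q: "q \<in> Q t" "q \<in> orb G (A' \<union> set t) (map k (map h y))"
        using Q[of t] unfolding transv_def by blast
      then obtain l where l: "l \<in> G" "\<forall>a\<in>A' \<union> set t. l a = a" "q = map l (map k (map h y))" by (auto elim: ps.orbE)
      have "map l t = t" using l(2) by (auto intro: map_idI)
      then have "t @ q = map (\<lambda>a. l (k a)) z" using l(3) k(3) h(3) by (simp add: o_def)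
      moreover have "(\<lambda>a. l (k a)) \<in> G" by (rule ps.comp_mem[OF l(1) k(1)])
      moreover have "\<forall>a\<in>A'. l (k a) = a" using l(2) k(2) by simp
      ultimately have "t @ q \<in> orb G A' z" unfolding orb_def by blast
      moreover have "t @ q \<in> ?T" using t(1) q(1) by force
      ultimately show "\<exists>s\<in>?T. s \<in> orb G A' z" by blast
    qed
    show "\<forall>s\<in>?T. \<forall>s'\<in>?T. s' \<in> orb G A' s \<longrightarrow> s' = s"
    proof (intro ballI impI)
      fix s s' assume "s \<in> ?T" "s' \<in> ?T" and o: "s' \<in> orb G A' s"
      then obtain t q t' q' where s: "s = t @ q" "t \<in> P" "q \<in> Q t" "s' = t' @ q'" "t' \<in> P" "q' \<in> Q t'" by auto
      obtain k where k: "k \<in> G" "\<forall>a\<in>A'. k a = a" "t' @ q' = map k t @ map k q"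
        using o s by (auto elim: ps.orbE)
      then have kt: "t' = map k t" "q' = map k q" using tV s by auto
      have "t' \<in> orb G A' t" unfolding kt by (rule ps.orbI[OF k(1,2)])
      then have tt: "t' = t" using P s unfolding transv_def by blast
      then have "\<forall>a\<in>set t. k a = a" using kt(1) by (metis map_eq_conv map_ident)
      then have "q' \<in> orb G (A' \<union> set t) q" unfolding kt using k by (intro ps.orbI) auto
      then have "q' = q" using Q[of t] s tt unfolding transv_def by blast
      then show "s' = s" using tt s by simp
    qed
  qed
  moreover have "type_val (x @ y) A = osum ?T (\<lambda>s. type_val s A')"
  proof -
    have "inj_on (\<lambda>(t, q). t @ q) (Sigma P Q)" using tV(2) by (auto simp: inj_on_def)
    then have "osum ?T (\<lambda>s. type_val s A') = osum (Sigma P Q) (\<lambda>p. type_val ((\<lambda>(t, q). t @ q) p) A')" by (rule osum_reindex)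
    also have "\<dots> = osum P (\<lambda>t. osum (Q t) (\<lambda>q. type_val (t @ q) A'))"
      by (subst osum_Sigma) (use fP fQ neQ in auto)
    \<comment> \<open>By conjugation with \<open>g t\<close> the inner sum is the value of
      \<open>y\<close> over \<open>A \<union> set x\<close> for every \<open>t\<close>, a constant
      that can be pulled out.\<close>
    also have "\<dots> = osum P (\<lambda>t. otimes (type_val y (A \<union> set x)) (type_val t A'))"
    proof (rule osum_cong[OF refl])
      fix t assume t: "t \<in> P"
      have "osum (Q t) (\<lambda>q. type_val (t @ q) A') = osum (Q t) (\<lambda>q. otimes (type_val t A') (type_val q (A' \<union> set t)))"
        by (rule osum_cong[OF refl]) (use type_val_append A' tV(1)[OF t] qV[OF t] in auto)
      also have "\<dots> = otimes (type_val t A') (osum (Q t) (\<lambda>q. type_val q (A' \<union> set t)))"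
        by (rule osum_otimes[OF fQ[OF t] neQ])
      also have "osum (Q t) (\<lambda>q. type_val q (A' \<union> set t)) = type_val (map (g t) y) (A \<union> set t)"
      proof -
        have "ext_add (map (g t) y) (g t ` (A \<union> set x))"
          by (rule ext_add_image[OF _ _ xy(2) _ y]) (use A xy g[OF t] in auto)
        then have "ext_add (map (g t) y) (A \<union> set t)" by (simp only: gA[OF t])
        moreover have "finite (A' \<union> set t)" "A \<union> set t \<subseteq> A' \<union> set t" "A' \<union> set t \<subseteq> V"
          using A' tV(1)[OF t] by auto
        ultimately show ?thesis using Q[of t] unfolding ext_add_def by metis
      qed
      also have "type_val (map (g t) y) (A \<union> set t) = type_val y (A \<union> set x)"
        using type_val_image[of "A \<union> set x" y "g t"] A xy g[OF t] unfolding gA[OF t] by auto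
      finally show "osum (Q t) (\<lambda>q. type_val (t @ q) A') = otimes (type_val y (A \<union> set x)) (type_val t A')"
        by (simp add: otimes_commute)
    qed
    also have "\<dots> = otimes (type_val y (A \<union> set x)) (osum P (\<lambda>t. type_val t A'))"
      by (rule osum_otimes[OF fP \<open>P \<noteq> {}\<close>])
    also have "osum P (\<lambda>t. type_val t A') = type_val x A" using x P A' unfolding ext_add_def by metis
    also have "otimes (type_val y (A \<union> set x)) (type_val x A) = type_val (x @ y) A"
      using type_val_append[OF A xy] by (simp add: otimes_commute)
    finally show ?thesis by simp
  qed
  ultimately show "\<exists>T. transv G A' (orb G A (x @ y)) T \<and> type_val (x @ y) A = osum T (\<lambda>t. type_val t A')" by blast
qed

text \<open>When \<open>x\<close> and \<open>y\<close> have the same closure over \<open>A\<close>,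
  the effect of an automorphism fixing \<open>A\<close> on one determines its effect on the other.
  Transversals correspond, and corresponding representatives have equal values over
  \<open>A'\<close>.\<close>

lemma ext_add_interdefinable:
  assumes A: "finite A" "A \<subseteq> V" and xy: "set x \<subseteq> V" "set y \<subseteq> V"
    and cl_eq: "cl (A \<union> set x) = cl (A \<union> set y)" and x: "ext_add x A"
  shows "ext_add y A"
  unfolding ext_add_def
proof (intro allI impI, elim conjE)
  fix A' T assume A': "finite A'" "A \<subseteq> A'" "A' \<subseteq> V" and T: "transv G A' (orb G A y) T"
  have "\<forall>t\<in>T. \<exists>g. g \<in> G \<and> (\<forall>a\<in>A. g a = a) \<and> t = map g y"
    using T unfolding transv_def orb_def by blast
  then obtain g where g: "\<And>t. t \<in> T \<Longrightarrow> g t \<in> G \<and> (\<forall>a\<in>A. g t a = a) \<and> t = map (g t) y" by metis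
  let ?f = "\<lambda>t. map (g t) x"
  \<comment> \<open>Two automorphisms over \<open>A\<close> that agree on \<open>p\<close> differ by
    one fixing \<open>A\<close> and \<open>p\<close>, hence their closure, which contains
    \<open>q\<close>.\<close>
  have transfer: "map k q = map l q"
    if k: "k \<in> G" "\<forall>a\<in>A. k a = a" and l: "l \<in> G" "\<forall>a\<in>A. l a = a" and pq: "map k p = map l p"
      "set q \<subseteq> cl (A \<union> set p)" "set p \<subseteq> V" for k l p q
  proof -
    let ?d = "\<lambda>a. inv l (k a)"
    have d: "?d \<in> G" by (rule ps.comp_mem[OF ps.inv_mem[OF l(1)] k(1)])
    have "?d a = a" if "a \<in> A \<union> set p" for a
    proof (cases "a \<in> A")
      case True
      then show ?thesis using k(2) ps.inv_fix[OF l(1)] l(2) by auto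
    next
      case False
      then have "k a = l a" using pq(1) that by auto
      then show ?thesis using l(1) by simp
    qed
    then have "\<forall>b\<in>cl (A \<union> set p). ?d b = b" using cl_fix[OF d, of "A \<union> set p"] A pq(3) by auto
    then have "l (inv l (k b)) = l b" if "b \<in> set q" for b using that pq(2) by (metis subsetD)
    then show ?thesis using l(1) by auto
  qed
  have AxV: "A \<union> set x \<subseteq> V" "A \<union> set y \<subseteq> V" using A xy by auto
  have yx: "set y \<subseteq> cl (A \<union> set x)" and xy': "set x \<subseteq> cl (A \<union> set y)"
    using cl_extensive[OF AxV(1)] cl_extensive[OF AxV(2)] cl_eq by auto
  have T': "transv G A' (orb G A x) (?f ` T)"
    unfolding transv_def
  proof (intro conjI)
    show "?f ` T \<subseteq> orb G A x" using g by (auto intro: ps.orbI)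
    show "\<forall>z\<in>orb G A x. \<exists>s\<in>?f ` T. s \<in> orb G A' z"
    proof
      fix z assume "z \<in> orb G A x"
      then obtain h where h: "h \<in> G" "\<forall>a\<in>A. h a = a" "z = map h x" by (rule ps.orbE)
      obtain t where t: "t \<in> T" "t \<in> orb G A' (map h y)"
        using T ps.orbI[OF h(1,2), of y] unfolding transv_def by blast
      then obtain k where k: "k \<in> G" "\<forall>a\<in>A'. k a = a" "t = map k (map h y)" by (auto elim: ps.orbE)
      have gt: "g t \<in> G" "\<forall>a\<in>A. g t a = a" "t = map (g t) y" using g[OF t(1)] by auto
      have kh: "(\<lambda>a. k (h a)) \<in> G" "\<forall>a\<in>A. k (h a) = a"
        using ps.comp_mem[OF k(1) h(1)] h(2) k(2) A'(2) by auto
      have "map (g t) y = map (\<lambda>a. k (h a)) y" using gt(3) k(3) by (simp add: o_def)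
      from transfer[OF gt(1,2) kh this xy' xy(2)] have "?f t = map k z" using h(3) by (simp add: o_def)
      then have "?f t \<in> orb G A' z" using ps.orbI[OF k(1,2), of z] by simp
      then show "\<exists>s\<in>?f ` T. s \<in> orb G A' z" using t(1) by blast
    qed
    show "\<forall>s\<in>?f ` T. \<forall>s'\<in>?f ` T. s' \<in> orb G A' s \<longrightarrow> s' = s"
    proof (intro ballI impI)
      fix s s' assume "s \<in> ?f ` T" "s' \<in> ?f ` T" and o: "s' \<in> orb G A' s"
      then obtain t t' where t: "t \<in> T" "s = ?f t" "t' \<in> T" "s' = ?f t'" by blast
      obtain k where k: "k \<in> G" "\<forall>a\<in>A'. k a = a" "map (g t') x = map k (map (g t) x)"
        using o t by (auto elim: ps.orbE)
      have gt: "g t \<in> G" "\<forall>a\<in>A. g t a = a" "t = map (g t) y" using g[OF t(1)] by auto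
      have gt': "g t' \<in> G" "\<forall>a\<in>A. g t' a = a" "t' = map (g t') y" using g[OF t(3)] by auto
      have kg: "(\<lambda>a. k (g t a)) \<in> G" "\<forall>a\<in>A. k (g t a) = a"
        using ps.comp_mem[OF k(1) gt(1)] gt(2) k(2) A'(2) by auto
      have "map (g t') x = map (\<lambda>a. k (g t a)) x" using k(3) by (simp add: o_def)
      from transfer[OF gt'(1,2) kg this yx xy(1)] have "map (g t') y = map (\<lambda>a. k (g t a)) y" .
      also have "\<dots> = map k (map (g t) y)" by (simp add: o_def)
      finally have "t' = map k t" using gt(3) gt'(3) by metis
      then have "t' \<in> orb G A' t" using ps.orbI[OF k(1,2), of t] by simp
      then have "t' = t" using T t unfolding transv_def by blast
      then show "s' = s" using t by simp
    qed
  qed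
  have inj: "inj_on ?f T"
  proof (rule inj_onI)
    fix t s assume ts: "t \<in> T" "s \<in> T" "?f t = ?f s"
    have "map (g t) y = map (g s) y"
      using transfer[of "g t" "g s" x y] g[OF ts(1)] g[OF ts(2)] ts(3) yx xy(1) by blast
    then show "t = s" using g[OF ts(1)] g[OF ts(2)] by metis
  qed
  have "type_val x A = osum (?f ` T) (\<lambda>t. type_val t A')" using x A' T' unfolding ext_add_def by blast
  also have "\<dots> = osum T (\<lambda>t. type_val (?f t) A')" by (rule osum_reindex[OF inj])
  also have "\<dots> = osum T (\<lambda>t. type_val t A')"
  proof (rule osum_cong[OF refl])
    fix t assume t: "t \<in> T"
    have gt: "g t \<in> G" "g t ` A = A" "t = map (g t) y" using g[OF t] by force+
    have st: "set t = g t ` set y" using gt(3) by (metis set_map)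
    have gV: "g t ` set x \<subseteq> V" "g t ` set y \<subseteq> V" using xy g_V[OF gt(1)] by auto
    have "cl (A \<union> g t ` set x) = g t ` cl (A \<union> set x)" "cl (A \<union> g t ` set y) = g t ` cl (A \<union> set y)"
      using cl_image[OF gt(1) AxV(1)] cl_image[OF gt(1) AxV(2)] gt(2) by (simp_all add: image_Un)
    then have "cl (A \<union> g t ` set x) = cl (A \<union> g t ` set y)" using cl_eq by simp
    moreover have "cl (A' \<union> Z) = cl (A' \<union> cl (A \<union> Z))" if "Z \<subseteq> V" for Z
    proof -
      have "cl (A' \<union> cl (A \<union> Z)) = cl (A' \<union> (A \<union> Z))"
        using cl_Un_cl[of "A \<union> Z" A'] that A A'(3) by (simp add: Un_commute)
      then show ?thesis using A'(2) by (simp add: Un_assoc[symmetric] sup_absorb1)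
    qed
    ultimately have "cl (A' \<union> g t ` set x) = cl (A' \<union> g t ` set y)" using gV by metis
    then show "type_val (?f t) A' = type_val t A'" by (intro type_val_interdefinable) (simp add: st)
  qed
  finally show "type_val y A = osum T (\<lambda>t. type_val t A')" using type_val_interdefinable[OF cl_eq] by simp
qed

text \<open>Induction on the number of elements that closing up with \<open>x\<close> adds to a
  closed base. A new infinity-node \<open>e\<close> with predecessor in the base is put in front of
  \<open>x\<close>; \<open>[e] @ x\<close> is interdefinable with \<open>x\<close>, and over the
  closure of \<open>insert e A\<close> less is missing.\<close>

lemma ext_add_all:
  assumes A: "finite A" "A \<subseteq> V" and x: "set x \<subseteq> V"
  shows "ext_add x A"
proof -
  have "ext_add x A" if "finite A" "cl A = A" for A
    using that
  proof (induction "card (cl (A \<union> set x) - A)" arbitrary: A rule: less_induct)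
    case less
    have AV: "A \<subseteq> V" using less.prems(2) cl_V[of A] by simp
    let ?B = "cl (A \<union> set x)"
    have AB: "A \<union> set x \<subseteq> ?B" by (rule cl_extensive) (use AV x in auto)
    have fB: "finite ?B" using less.prems(1) by (simp add: cl_finite)
    show ?case
    proof (cases "?B = A")
      case True
      then have "set x \<subseteq> cl A" using AB less.prems(2) by auto
      then show ?thesis using ext_add_trivial less.prems(1) AV by blast
    next
      case False
      have "\<exists>e\<in>?B - A. infn e \<and> butlast e \<in> A"
        by (rule cl_generate) (use less.prems(2) AB False in auto)
      then obtain e where e: "e \<in> ?B" "e \<notin> A" "infn e" "butlast e \<in> A" by blast
      have eV: "e \<in> V" using e(1) cl_V by blast
      let ?A1 = "cl (insert e A)"
      have A1: "finite ?A1" "?A1 \<subseteq> V" "insert e A \<subseteq> ?A1"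
        using less.prems(1) cl_finite cl_V cl_extensive[of "insert e A"] AV eV by auto
      have B1: "cl (?A1 \<union> set x) = ?B"
      proof (intro equalityI cl_least)
        have "?A1 \<subseteq> ?B" by (rule cl_least) (use e(1) AB in auto)
        then show "?A1 \<union> set x \<subseteq> ?B" using AB by auto
        have "?A1 \<union> set x \<subseteq> cl (?A1 \<union> set x)" by (rule cl_extensive) (use A1 x in auto)
        then show "A \<union> set x \<subseteq> cl (?A1 \<union> set x)" using A1(3) by blast
      qed
      have "card (?B - ?A1) < card (?B - A)"
        by (rule psubset_card_mono) (use fB e A1 in auto)
      then have "ext_add x ?A1" using less.hyps[of ?A1] A1(1) B1 by simp
      then have "ext_add x (A \<union> set [e])"
        using ext_add_cl[of "insert e A" x] less.prems(1) AV eV x by simp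
      moreover have "ext_add [e] A"
        by (rule ext_add_one) (use less.prems AV eV e in auto)
      ultimately have "ext_add ([e] @ x) A"
        by (intro ext_add_append) (use less.prems AV eV x in auto)
      moreover have "cl (A \<union> set ([e] @ x)) = ?B"
      proof (intro equalityI cl_least)
        show "A \<union> set ([e] @ x) \<subseteq> ?B" using AB e(1) by auto
        have "A \<union> set ([e] @ x) \<subseteq> cl (A \<union> set ([e] @ x))" by (rule cl_extensive) (use AV eV x in auto)
        then show "A \<union> set x \<subseteq> cl (A \<union> set ([e] @ x))" by auto
      qed
      ultimately show ?thesis
        using ext_add_interdefinable[of A "[e] @ x" x] less.prems AV eV x by simp
    qed
  qed
  then show ?thesis using ext_add_cl[OF A x] cl_finite[OF A(1)] by simp
qed

end

section \<open>The global measure\<close>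

context nic_meas
begin

text \<open>Support and transversal are arbitrary choices; \<open>global_val_eq\<close> shows that
  they do not matter for definable sets.\<close>

definition global_val :: "'s node list set \<Rightarrow> nat \<times> real" where
  "global_val X = (let A = (SOME A. finite A \<and> A \<subseteq> V \<and> supports G A X); T = (SOME T. transv G A X T)
     in osum T (\<lambda>t. type_val t A))"

lemma Def_iff: "X \<in> Def_sets L M n \<longleftrightarrow> X \<subseteq> tuples V n \<and> (\<exists>A. finite A \<and> A \<subseteq> V \<and> supports G A X)"
  using ps.Def_sets_iff[of X n] by simp

lemma finite_transv:
  "transv G A X T \<Longrightarrow> X \<subseteq> tuples V n \<Longrightarrow> finite A \<Longrightarrow> A \<subseteq> V \<Longrightarrow> finite T"
  using ps.transv_finite[of A X T n] by simp

text \<open>Splitting each orbit over \<open>A\<close> into orbits over \<open>A'\<close> gives a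
  transversal indexed by pairs, and \<open>ext_add_all\<close> sums up each block.\<close>

lemma transv_refine:
  assumes X: "X \<subseteq> tuples V n" "supports G A X" and A: "finite A" "A \<subseteq> A'" "finite A'" "A' \<subseteq> V"
    and T: "transv G A X T" "transv G A' X T'"
  shows "osum T (\<lambda>t. type_val t A) = osum T' (\<lambda>t. type_val t A')"
proof -
  have AV: "A \<subseteq> V" using A by blast
  have fT: "finite T" by (rule finite_transv[OF T(1) X(1) A(1) AV])
  have TX: "t \<in> X" if "t \<in> T" for t using T(1) that by (auto simp: transv_def)
  have tV: "set t \<subseteq> V" if "t \<in> T" for t using TX[OF that] X(1) by (auto simp: tuples_def)
  have oX: "orb G A t \<subseteq> X" if "t \<in> T" for t by (rule ps.supports_orb_subset[OF X(2) TX[OF that]])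
  have "\<forall>t. \<exists>Q. transv G A' (orb G A t) Q" using ps.transv_ex by blast
  then obtain Q where Q: "\<And>t. transv G A' (orb G A t) (Q t)" by metis
  have fQ: "finite (Q t)" if "t \<in> T" for t
    by (rule finite_transv[OF Q order.trans[OF oX[OF that] X(1)] A(3,4)])
  have neQ: "Q t \<noteq> {}" for t by (rule ps.transv_nonempty[OF Q ps.orb_refl])
  have QX: "q \<in> orb G A t" if "q \<in> Q t" for t q using Q[of t] that by (auto simp: transv_def)
  have sep: "t = s" if "t \<in> T" "s \<in> T" "q \<in> orb G A t" "r \<in> orb G A s" "r \<in> orb G A q" for t s q r
  proof -
    have "r \<in> orb G A t" using ps.orb_trans[OF that(3,5)] .
    then have "s \<in> orb G A t" using ps.orb_trans[OF _ ps.orb_sym[OF that(4)]] by blast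
    then show ?thesis using T(1) that unfolding transv_def by blast
  qed
  have "transv G A' X (snd ` Sigma T Q)"
    unfolding transv_def
  proof (intro conjI ballI impI)
    show "snd ` Sigma T Q \<subseteq> X" using QX oX by fastforce
    show "\<exists>s\<in>snd ` Sigma T Q. s \<in> orb G A' x" if x: "x \<in> X" for x
    proof -
      obtain t where t: "t \<in> T" "t \<in> orb G A x" using T(1) x unfolding transv_def by blast
      then have "x \<in> orb G A t" using ps.orb_sym by blast
      then obtain q where "q \<in> Q t" "q \<in> orb G A' x" using Q[of t] unfolding transv_def by blast
      then show ?thesis using t(1) by force
    qed
    fix s s' assume "s \<in> snd ` Sigma T Q" "s' \<in> snd ` Sigma T Q" and o: "s' \<in> orb G A' s"
    then obtain t t' where t: "t \<in> T" "s \<in> Q t" "t' \<in> T" "s' \<in> Q t'" by auto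
    have "t = t'"
      by (rule sep[OF t(1,3) QX[OF t(2)] QX[OF t(4)]]) (use o ps.orb_mono[OF A(2)] in blast)
    then show "s' = s" using Q[of t] t o unfolding transv_def by blast
  qed
  then have "osum T' (\<lambda>t. type_val t A') = osum (snd ` Sigma T Q) (\<lambda>t. type_val t A')"
    by (rule type_val_transv[OF T(2) _ X(1) A(3,4)])
  also have "\<dots> = osum (Sigma T Q) (\<lambda>p. type_val (snd p) A')"
  proof (rule osum_reindex, rule inj_onI)
    fix p r assume pr: "p \<in> Sigma T Q" "r \<in> Sigma T Q" "snd p = snd r"
    then have "fst p = fst r" using sep[of "fst p" "fst r" "snd p" "snd r"] QX by auto
    then show "p = r" using pr(3) by (simp add: prod_eq_iff)
  qed
  also have "\<dots> = osum T (\<lambda>t. osum (Q t) (\<lambda>q. type_val q A'))"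
    by (subst osum_Sigma) (use fT fQ neQ in auto)
  also have "\<dots> = osum T (\<lambda>t. type_val t A)"
  proof (rule osum_cong[OF refl])
    fix t assume "t \<in> T"
    then have "ext_add t A" using ext_add_all[OF A(1) AV] tV by blast
    then show "osum (Q t) (\<lambda>q. type_val q A') = type_val t A"
      using Q[of t] A unfolding ext_add_def by metis
  qed
  finally show ?thesis by simp
qed

text \<open>Two supports are compared through their union.\<close>

lemma global_val_eq:
  assumes X: "X \<subseteq> tuples V n" "supports G A X" and A: "finite A" "A \<subseteq> V" and T: "transv G A X T"
  shows "global_val X = osum T (\<lambda>t. type_val t A)"
proof -
  define A0 where "A0 = (SOME A. finite A \<and> A \<subseteq> V \<and> supports G A X)"
  have A0: "finite A0 \<and> A0 \<subseteq> V \<and> supports G A0 X"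
    unfolding A0_def by (rule someI[of _ A]) (use assms in blast)
  define T0 where "T0 = (SOME T. transv G A0 X T)"
  have T0: "transv G A0 X T0" unfolding T0_def by (rule someI_ex[OF ps.transv_ex])
  obtain T1 where T1: "transv G (A \<union> A0) X T1" using ps.transv_ex by blast
  have "global_val X = osum T0 (\<lambda>t. type_val t A0)" by (simp add: global_val_def A0_def T0_def Let_def)
  also have "\<dots> = osum T1 (\<lambda>t. type_val t (A \<union> A0))"
    by (rule transv_refine[OF X(1) _ _ _ _ _ T0 T1]) (use A0 A in auto)
  also have "\<dots> = osum T (\<lambda>t. type_val t A)"
    by (rule transv_refine[OF X(1) X(2) _ _ _ _ T T1, symmetric]) (use A0 A in auto)
  finally show ?thesis .
qed

lemma global_val_orb:
  assumes "finite A" "A \<subseteq> V" "set x \<subseteq> V"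
  shows "global_val (orb G A x) = type_val x A"
  using global_val_eq[of "orb G A x" "length x" A "{x}"] assms orb_tuples_V[OF assms(3)]
    ps.supports_orb ps.transv_orb by simp

lemma global_val_image:
  assumes X: "X \<in> Def_sets L M n" and g: "g \<in> G"
  shows "global_val (map g ` X) = global_val X"
proof -
  obtain A where A: "X \<subseteq> tuples V n" "finite A" "A \<subseteq> V" "supports G A X" using X by (auto simp: Def_iff)
  obtain T where T: "transv G A X T" using ps.transv_ex by blast
  have gA: "finite (g ` A)" "g ` A \<subseteq> V" using A g_V[OF g] by auto
  have gX: "map g ` X \<subseteq> tuples V n" using A(1) g_tuples[OF g] by blast
  have "global_val (map g ` X) = osum (map g ` T) (\<lambda>t. type_val t (g ` A))"
    by (rule global_val_eq[OF gX ps.supports_image[OF A(4) g] gA ps.transv_image[OF T g]])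
  also have "\<dots> = osum T (\<lambda>t. type_val (map g t) (g ` A))"
    by (rule osum_reindex) (use ps.map_eq_iff[OF g] in \<open>auto simp: inj_on_def\<close>)
  also have "\<dots> = osum T (\<lambda>t. type_val t A)"
  proof (rule osum_cong[OF refl])
    fix t assume "t \<in> T"
    then have "set t \<subseteq> V" using T A(1) by (auto simp: transv_def tuples_def)
    then show "type_val (map g t) (g ` A) = type_val t A" by (rule type_val_image[OF A(2,3) _ g])
  qed
  also have "\<dots> = global_val X" by (rule global_val_eq[OF A(1,4,2,3) T, symmetric])
  finally show ?thesis .
qed

lemma global_val_positive:
  assumes "X \<in> Def_sets L M n"
  shows "global_val X = (0, 0) \<or> snd (global_val X) > 0"
proof (cases "X = {}")
  case True
  then have "global_val X = osum {} (\<lambda>t. type_val t {})"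
    by (intro global_val_eq[of _ 0]) (auto simp: transv_def supports_def)
  then show ?thesis by simp
next
  case False
  then obtain x where x: "x \<in> X" by blast
  obtain A where A: "X \<subseteq> tuples V n" "finite A" "A \<subseteq> V" "supports G A X" using assms by (auto simp: Def_iff)
  obtain T where T: "transv G A X T" using ps.transv_ex by blast
  have "snd (osum T (\<lambda>t. type_val t A)) > 0"
  proof (rule osum_pos[OF finite_transv[OF T A(1-3)] ps.transv_nonempty[OF T x]])
    fix t assume "t \<in> T"
    then have "set t \<subseteq> V" using T A(1) by (auto simp: transv_def tuples_def)
    then show "snd (type_val t A) > 0" by (rule type_val_dim_pos(2)[OF A(2,3)])
  qed
  then show ?thesis using global_val_eq[OF A(1,4,2,3) T] by simp
qed

text \<open>Each entry inherits a finite orbit from the tuple, by taking one coordinate, and nodes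
  outside the closure have infinite orbits.\<close>

lemma finite_orb_cl:
  assumes A: "finite A" "A \<subseteq> V" and x: "set x \<subseteq> V" "finite (orb G A x)"
  shows "set x \<subseteq> cl A"
proof
  fix a assume a: "a \<in> set x"
  then obtain i where i: "i < length x" "x ! i = a" by (auto simp: in_set_conv_nth)
  have "orb G A [a] \<subseteq> (\<lambda>y. [y ! i]) ` orb G A x"
  proof
    fix y assume "y \<in> orb G A [a]"
    then obtain g where g: "g \<in> G" "\<forall>a\<in>A. g a = a" "y = [g a]" by (auto elim: ps.orbE)
    have "y = [map g x ! i]" using i g(3) by simp
    then show "y \<in> (\<lambda>y. [y ! i]) ` orb G A x" using ps.orbI[OF g(1,2), of x] by blast
  qed
  then have "finite (orb G A [a])" using x(2) finite_subset by blast
  then show "a \<in> cl A" using infinite_orbit[OF A, of a] a x(1) by blast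
qed

text \<open>The points of a finite set lie in the closure of a support, so every orbit in it is a
  single point of value \<open>(0, 1)\<close>.\<close>

lemma global_val_finite:
  assumes "X \<in> Def_sets L M n" "finite X"
  shows "global_val X = (0, real (card X))"
proof -
  obtain A where A: "X \<subseteq> tuples V n" "finite A" "A \<subseteq> V" "supports G A X" using assms(1) by (auto simp: Def_iff)
  have cl: "set x \<subseteq> cl A" if "x \<in> X" for x
  proof (rule finite_orb_cl[OF A(2,3)])
    show "set x \<subseteq> V" using A(1) that by (auto simp: tuples_def)
    show "finite (orb G A x)" using finite_subset[OF ps.supports_orb_subset[OF A(4) that] assms(2)] .
  qed
  have "orb G A x = {x}" if "x \<in> X" for x
    using ps.orb_fixed[OF cl[OF that]] orb_cl[OF A(3)] by simp
  then have "transv G A X X" by (auto simp: transv_def)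
  then have "global_val X = osum X (\<lambda>t. type_val t A)" by (rule global_val_eq[OF A(1,4,2,3)])
  also have "\<dots> = osum X (\<lambda>_. (0, 1))"
    by (rule osum_cong[OF refl]) (use type_val_trivial[OF A(2,3)] cl in blast)
  finally show ?thesis using osum_ones[OF assms(2)] by simp
qed

lemma global_val_solset:
  assumes "\<phi> \<in> formulas L (n + k)" "as \<in> tuples V k" "bs \<in> orb G {} as"
  shows "global_val (solset M n \<phi> bs) = global_val (solset M n \<phi> as)"
proof -
  obtain g where g: "g \<in> G" "bs = map g as" using assms(3) by (auto elim: ps.orbE)
  have "solset M n \<phi> as \<in> Def_sets L M n" using assms by (auto simp: Def_sets_def)
  then show ?thesis using global_val_image[OF _ g(1)] ps.solset_map[OF assms(1) _ g(1), of as] assms(2) g(2) by simp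
qed

text \<open>Conjugate parameters give equal values, and there are finitely many orbits of
  parameters.\<close>

lemma global_val_finite_range:
  assumes "\<phi> \<in> formulas L (n + k)"
  shows "\<exists>D. finite D \<and> (\<forall>as\<in>tuples (univ M) k. global_val (solset M n \<phi> as) \<in> D)"
proof -
  obtain T where T: "transv G {} (tuples V k) T" using ps.transv_ex by blast
  have "finite T" by (rule finite_transv[OF T order_refl]) auto
  moreover have "global_val (solset M n \<phi> as) \<in> (\<lambda>t. global_val (solset M n \<phi> t)) ` T" if as: "as \<in> tuples (univ M) k" for as
  proof -
    obtain t where "t \<in> T" "t \<in> orb G {} as" using T as unfolding transv_def by auto
    then show ?thesis using global_val_solset[OF assms, of as t] as by (intro image_eqI[of _ _ t]) auto
  qed
  ultimately show ?thesis by (intro exI[of _ "(\<lambda>t. global_val (solset M n \<phi> t)) ` T"]) blast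
qed

text \<open>The set of parameters with a given value is invariant under all automorphisms, hence
  definable without parameters.\<close>

lemma global_val_definable:
  assumes "\<phi> \<in> formulas L (n + k)"
  shows "\<exists>\<psi>\<in>formulas L k. {as \<in> tuples (univ M) k. global_val (solset M n \<phi> as) = p} = solset M k \<psi> []"
proof -
  let ?X = "{as \<in> tuples (univ M) k. global_val (solset M n \<phi> as) = p}"
  have "supports G {} ?X"
    unfolding supports_def
  proof (intro ballI impI subsetI)
    fix g bs assume g: "g \<in> G" and "bs \<in> map g ` ?X"
    then obtain as where as: "as \<in> ?X" "bs = map g as" by blast
    then have "bs \<in> orb G {} as" using ps.orbI[OF g, of "{}"] by simp
    then show "bs \<in> ?X" using global_val_solset[OF assms, of as bs] as g_tuples[OF g, of as k] by simp
  qed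
  then have "definable0 L M k ?X" by (intro ps.definable_if_invariant) auto
  then show ?thesis by (auto simp: definable0_def)
qed

text \<open>Over a common support of \<open>X\<close>, \<open>Y\<close> and the graph, a transversal
  of \<open>X\<close> is assembled from one of \<open>Y\<close> and transversals of the fibres over
  it. The value of a point splits as that of its image times its own value over the image.\<close>

lemma global_val_fubini:
  assumes X: "X \<in> Def_sets L M n" and Y: "Y \<in> Def_sets L M k" and fX: "f ` X = Y"
    and graph: "{x @ f x | x. x \<in> X} \<in> Def_sets L M (n + k)"
  shows "global_val X = osum ((\<lambda>b. global_val {x \<in> X. f x = b}) ` Y)
    (\<lambda>p. otimes p (global_val {b \<in> Y. global_val {x \<in> X. f x = b} = p}))"
proof -
  obtain A1 where A1: "X \<subseteq> tuples V n" "finite A1" "A1 \<subseteq> V" "supports G A1 X" using X by (auto simp: Def_iff)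
  obtain A2 where A2: "Y \<subseteq> tuples V k" "finite A2" "A2 \<subseteq> V" "supports G A2 Y" using Y by (auto simp: Def_iff)
  obtain A3 where A3: "finite A3" "A3 \<subseteq> V" "supports G A3 {x @ f x | x. x \<in> X}"
    using graph unfolding Def_iff by blast
  define A where "A = A1 \<union> A2 \<union> A3"
  have A: "finite A" "A \<subseteq> V" using A1 A2 A3 by (auto simp: A_def)
  have sX: "supports G A X" by (rule ps.supports_mono[OF A1(4)]) (auto simp: A_def)
  have sY: "supports G A Y" by (rule ps.supports_mono[OF A2(4)]) (auto simp: A_def)
  have sG: "supports G A {x @ f x | x. x \<in> X}" by (rule ps.supports_mono[OF A3(3)]) (auto simp: A_def)
  have lenX: "length x = n" "set x \<subseteq> V" if "x \<in> X" for x using A1(1) that by (auto simp: tuples_def)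
  have gX: "map g x \<in> X" if "g \<in> G" "\<forall>a\<in>A. g a = a" "x \<in> X" for g x
    using sX that unfolding supports_def by blast
  \<comment> \<open>The graph is supported by \<open>A\<close>, so \<open>f\<close> commutes with
    the automorphisms fixing \<open>A\<close>.\<close>
  have gf: "f (map g x) = map g (f x)" if "g \<in> G" "\<forall>a\<in>A. g a = a" "x \<in> X" for g x
  proof -
    have "map g (x @ f x) \<in> {x @ f x | x. x \<in> X}" using sG that unfolding supports_def by blast
    then obtain x' where x': "map g x @ map g (f x) = x' @ f x'" "x' \<in> X" by auto
    then have "map g x = x' \<and> map g (f x) = f x'" using lenX[OF x'(2)] lenX[OF that(3)] by simp
    then show ?thesis by simp
  qed
  let ?F = "\<lambda>b. {x \<in> X. f x = b}"
  have sF: "supports G (A \<union> set b) (?F b)" for b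
    unfolding supports_def
  proof (intro ballI impI subsetI)
    fix g y assume g: "g \<in> G" "\<forall>a\<in>A \<union> set b. g a = a" and "y \<in> map g ` ?F b"
    then obtain x where x: "x \<in> X" "f x = b" "y = map g x" by blast
    have "map g b = b" using g(2) by (auto intro: map_idI)
    then show "y \<in> ?F b" using gX[OF g(1) _ x(1)] gf[OF g(1) _ x(1)] g(2) x by simp
  qed
  have FV: "?F b \<subseteq> tuples V n" for b using A1(1) by blast
  have bV: "set b \<subseteq> V" if "b \<in> Y" for b using A2(1) that by (auto simp: tuples_def)
  obtain P where P: "transv G A Y P" using ps.transv_ex by blast
  have PY: "P \<subseteq> Y" using P by (simp add: transv_def)
  have fP: "finite P" by (rule finite_transv[OF P A2(1) A])
  define Q where "Q b = (SOME Q. transv G (A \<union> set b) (?F b) Q)" for b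
  have Q: "transv G (A \<union> set b) (?F b) (Q b)" for b
    unfolding Q_def by (rule someI_ex[OF ps.transv_ex])
  have QF: "q \<in> X" "f q = b" if "q \<in> Q b" for b q using Q[of b] that by (auto simp: transv_def)
  have fQ: "finite (Q b)" if "b \<in> P" for b
    by (rule finite_transv[OF Q FV]) (use A bV that PY in auto)
  have neQ: "Q b \<noteq> {}" if b: "b \<in> P" for b
  proof -
    have "b \<in> f ` X" using PY b fX by blast
    then obtain x where "x \<in> ?F b" by blast
    then show ?thesis by (rule ps.transv_nonempty[OF Q])
  qed
  have T: "transv G A X (snd ` Sigma P Q)"
    unfolding transv_def
  proof (intro conjI ballI impI)
    show "snd ` Sigma P Q \<subseteq> X" using QF by auto
    show "\<exists>s\<in>snd ` Sigma P Q. s \<in> orb G A x" if x: "x \<in> X" for x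
    proof -
      have "f x \<in> Y" using x fX by blast
      then obtain b where b: "b \<in> P" "b \<in> orb G A (f x)" using P unfolding transv_def by blast
      then obtain g where g: "g \<in> G" "\<forall>a\<in>A. g a = a" "b = map g (f x)" by (auto elim: ps.orbE)
      have "map g x \<in> ?F b" using gX[OF g(1,2) x] gf[OF g(1,2) x] g(3) by simp
      then obtain q where q: "q \<in> Q b" "q \<in> orb G (A \<union> set b) (map g x)" using Q[of b] unfolding transv_def by blast
      then have "q \<in> orb G A (map g x)" using ps.orb_mono[of A "A \<union> set b"] by blast
      then have "q \<in> orb G A x" using ps.orb_trans[OF ps.orbI[OF g(1,2)]] by blast
      then show ?thesis using b(1) q(1) by force
    qed
    fix s s' assume "s \<in> snd ` Sigma P Q" "s' \<in> snd ` Sigma P Q" and o: "s' \<in> orb G A s"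
    then obtain b b' where b: "b \<in> P" "s \<in> Q b" "b' \<in> P" "s' \<in> Q b'" by auto
    obtain g where g: "g \<in> G" "\<forall>a\<in>A. g a = a" "s' = map g s" using o by (rule ps.orbE)
    have b': "b' = map g b" using gf[OF g(1,2) QF(1)[OF b(2)]] QF(2)[OF b(2)] QF(2)[OF b(4)] g(3) by simp
    then have "b' \<in> orb G A b" using ps.orbI[OF g(1,2)] by blast
    then have "b' = b" using P b unfolding transv_def by blast
    then have "\<forall>a\<in>set b. g a = a" using b' by (metis map_eq_conv map_ident)
    then have "s' \<in> orb G (A \<union> set b) s" unfolding g(3) using g by (intro ps.orbI) auto
    then show "s' = s" using Q[of b] b \<open>b' = b\<close> unfolding transv_def by blast
  qed
  let ?B = "\<lambda>b. global_val (?F b)"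
  have inv: "?B y = ?B b" if b: "b \<in> Y" and y: "y \<in> orb G A b" for b y
  proof -
    obtain g where g: "g \<in> G" "\<forall>a\<in>A. g a = a" "y = map g b" using y by (rule ps.orbE)
    have "?F y = map g ` ?F b"
    proof (intro equalityI subsetI)
      fix x assume x: "x \<in> ?F y"
      have ig: "inv g \<in> G" "\<forall>a\<in>A. inv g a = a" using ps.inv_mem[OF g(1)] ps.inv_fix[OF g(1)] g(2) by auto
      have "map (inv g) x \<in> ?F b"
          using gX[OF ig] gf[OF ig] x ps.map_inv_simps(1)[OF g(1), of b] g(3) by auto
      then have "map g (map (inv g) x) \<in> map g ` ?F b" by (rule imageI)
      then show "x \<in> map g ` ?F b" using ps.map_inv_simps(2)[OF g(1), of x] by simp
    next
      fix x assume "x \<in> map g ` ?F b"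
      then show "x \<in> ?F y" using gX[OF g(1,2)] gf[OF g(1,2)] g(3) by auto
    qed
    moreover have "finite (A \<union> set b)" "A \<union> set b \<subseteq> V" using A bV[OF b] by auto
    then have "?F b \<in> Def_sets L M n" unfolding Def_iff using FV sF[of b] by blast
    ultimately show ?thesis using global_val_image[OF _ g(1)] by simp
  qed
  have "global_val X = osum (snd ` Sigma P Q) (\<lambda>t. type_val t A)" by (rule global_val_eq[OF A1(1) sX A T])
  also have "\<dots> = osum (Sigma P Q) (\<lambda>p. type_val (snd p) A)"
  proof (rule osum_reindex, rule inj_onI)
    fix p r assume "p \<in> Sigma P Q" "r \<in> Sigma P Q" "snd p = snd r"
    then show "p = r" using QF(2)[of "snd p" "fst p"] QF(2)[of "snd r" "fst r"] by (auto simp: prod_eq_iff)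
  qed
  also have "\<dots> = osum P (\<lambda>b. osum (Q b) (\<lambda>t. type_val t A))"
    by (subst osum_Sigma) (use fP fQ neQ in auto)
  also have "\<dots> = osum P (\<lambda>b. otimes (type_val b A) (?B b))"
  proof (rule osum_cong[OF refl])
    fix b assume b: "b \<in> P"
    have bV': "set b \<subseteq> V" using b bV PY by blast
    have "type_val t A = otimes (type_val b A) (type_val t (A \<union> set b))" if t: "t \<in> Q b" for t
    proof -
      have tX: "t \<in> X" "f t = b" using QF[OF t] by auto
      note tV = lenX(2)[OF tX(1)]
      have At: "finite (A \<union> set t)" "A \<union> set t \<subseteq> V" using A tV by auto
      \<comment> \<open>By equivariance \<open>b\<close>, the image of \<open>t\<close> under
        \<open>f\<close>, is fixed once \<open>A\<close> and \<open>t\<close> are; so it lies in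
        their closure, and \<open>t\<close> may be replaced by \<open>b @ t\<close>.\<close>
      have "orb G (A \<union> set t) b \<subseteq> {b}"
      proof
        fix y assume "y \<in> orb G (A \<union> set t) b"
        then obtain g where g: "g \<in> G" "\<forall>a\<in>A \<union> set t. g a = a" "y = map g b" by (rule ps.orbE)
        have "map g t = t" using g(2) by (auto intro: map_idI)
        then show "y \<in> {b}" using gf[OF g(1) _ tX(1)] g(2,3) tX(2) by simp
      qed
      then have "finite (orb G (A \<union> set t) b)" by (rule finite_subset) simp
      then have bt: "set b \<subseteq> cl (A \<union> set t)" by (rule finite_orb_cl[OF At bV'])
      have "cl (A \<union> set t) = cl (A \<union> set (b @ t))"
      proof (intro equalityI cl_least)
        have "A \<union> set (b @ t) \<subseteq> cl (A \<union> set (b @ t))" by (rule cl_extensive) (use A bV' tV in auto)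
        then show "A \<union> set t \<subseteq> cl (A \<union> set (b @ t))" by auto
        show "A \<union> set (b @ t) \<subseteq> cl (A \<union> set t)" using bt cl_extensive[OF At(2)] by auto
      qed
      then have "type_val t A = type_val (b @ t) A" by (rule type_val_interdefinable)
      then show ?thesis using type_val_append[OF A bV' tV] by simp
    qed
    then have "osum (Q b) (\<lambda>t. type_val t A) = osum (Q b) (\<lambda>t. otimes (type_val b A) (type_val t (A \<union> set b)))"
      by (intro osum_cong) auto
    also have "\<dots> = otimes (type_val b A) (osum (Q b) (\<lambda>t. type_val t (A \<union> set b)))"
      by (rule osum_otimes[OF fQ[OF b] neQ[OF b]])
    also have "osum (Q b) (\<lambda>t. type_val t (A \<union> set b)) = ?B b"
      by (rule global_val_eq[OF FV sF _ _ Q, symmetric]) (use A bV' in auto)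
    finally show "osum (Q b) (\<lambda>t. type_val t A) = otimes (type_val b A) (?B b)" .
  qed
  \<comment> \<open>Grouping the representatives by the value of their fibre produces the subsets of
    \<open>Y\<close> that occur in the Fubini clause.\<close>
  also have "\<dots> = osum (?B ` P) (\<lambda>p. osum {b \<in> P. ?B b = p} (\<lambda>b. otimes (type_val b A) (?B b)))"
    by (rule osum_partition[OF fP])
  also have "\<dots> = osum (?B ` P) (\<lambda>p. otimes p (global_val {b \<in> Y. ?B b = p}))"
  proof (rule osum_cong[OF refl])
    fix p assume p: "p \<in> ?B ` P"
    let ?P = "{b \<in> P. ?B b = p}" and ?Y = "{b \<in> Y. ?B b = p}"
    have sYp: "supports G A ?Y"
      unfolding supports_def
    proof (intro ballI impI subsetI)
      fix g y assume g: "g \<in> G" "\<forall>a\<in>A. g a = a" and "y \<in> map g ` ?Y"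
      then obtain b where b: "b \<in> Y" "?B b = p" "y = map g b" by blast
      have "y \<in> orb G A b" unfolding b(3) by (rule ps.orbI[OF g])
      then show "y \<in> ?Y" using inv[OF b(1)] b ps.supports_orb_subset[OF sY b(1)] by auto
    qed
    have "transv G A ?Y ?P"
      unfolding transv_def
    proof (intro conjI ballI impI)
      show "?P \<subseteq> ?Y" using PY by blast
      show "\<exists>t\<in>?P. t \<in> orb G A x" if x: "x \<in> ?Y" for x
      proof -
        obtain t where t: "t \<in> P" "t \<in> orb G A x" using P x unfolding transv_def by blast
        then have "?B t = p" using inv[of x t] x by simp
        then show ?thesis using t by blast
      qed
      show "t' = t" if "t \<in> ?P" "t' \<in> ?P" "t' \<in> orb G A t" for t t'
        using P that unfolding transv_def by blast
    qed
    from global_val_eq[OF _ sYp A this, of k] have h: "global_val ?Y = osum ?P (\<lambda>b. type_val b A)"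
      using A2(1) by blast
    have "osum ?P (\<lambda>b. otimes (type_val b A) (?B b)) = osum ?P (\<lambda>b. otimes p (type_val b A))"
      by (rule osum_cong[OF refl]) (auto simp: otimes_commute)
    also have "\<dots> = otimes p (osum ?P (\<lambda>b. type_val b A))"
      by (rule osum_otimes) (use fP p in auto)
    finally show "osum ?P (\<lambda>b. otimes (type_val b A) (?B b)) = otimes p (global_val ?Y)" using h by simp
  qed
  also have "?B ` P = ?B ` Y"
  proof (intro equalityI subsetI)
    fix p assume "p \<in> ?B ` Y"
    then obtain b where b: "b \<in> Y" "p = ?B b" by blast
    obtain t where t: "t \<in> P" "t \<in> orb G A b" using P b(1) unfolding transv_def by blast
    have "?B t = ?B b" by (rule inv[OF b(1) t(2)])
    then have "p = ?B t" using b(2) by simp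
    then show "p \<in> ?B ` P" by (rule image_eqI) (rule t(1))
  qed (use PY in blast)
  finally show ?thesis .
qed

lemma global_val_MS_measurable: "MS_measurable L M global_val"
  unfolding MS_measurable_iff
proof (intro conjI allI ballI impI)
  show "infinite (univ M)" using cat by (simp add: aleph0_categorical_def)
  show "global_val X = (0, 0) \<or> 0 < snd (global_val X)" if "X \<in> Def_sets L M n" for n X
    using global_val_positive[OF that] .
  show "\<exists>D. finite D \<and> (\<forall>as\<in>tuples (univ M) m. global_val (solset M n \<phi> as) \<in> D)"
    if "\<phi> \<in> formulas L (n + m)" for n m \<phi> using global_val_finite_range[OF that] .
  show "global_val (solset M n \<phi> as) = (0, real (card (solset M n \<phi> as)))"
    if "\<phi> \<in> formulas L (n + m)" "as \<in> tuples (univ M) m" "finite (solset M n \<phi> as)" for n m \<phi> as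
    by (rule global_val_finite[of _ n]) (use that in \<open>auto simp: Def_sets_def\<close>)
  show "\<exists>\<psi>\<in>formulas L m. {as \<in> tuples (univ M) m. global_val (solset M n \<phi> as) = (d, \<mu>)} = solset M m \<psi> []"
    if "\<phi> \<in> formulas L (n + m)" for n m \<phi> d \<mu> using global_val_definable[OF that] .
  show "global_val X = osum ((\<lambda>b. global_val {x \<in> X. f x = b}) ` Y) (\<lambda>p. otimes p (global_val {b \<in> Y. global_val {x \<in> X. f x = b} = p}))"
    if "X \<in> Def_sets L M n" "Y \<in> Def_sets L M k"
      "X \<noteq> {} \<and> f ` X = Y \<and> {x @ f x | x. x \<in> X} \<in> Def_sets L M (n + k)" for n k X Y f
    using global_val_fubini that by blast
qed

section \<open>The dimension and measure formulas for single nodes\<close>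

lemma branch_eq:
  assumes e: "e \<in> V" and B: "finite B" "cl B = B"
  shows "branch \<Gamma> lam S e B \<in> B" "prefix (branch \<Gamma> lam S e B) e"
    "\<And>x. x \<in> B \<Longrightarrow> prefix x e \<Longrightarrow> prefix x (branch \<Gamma> lam S e B)"
proof -
  let ?P = "\<lambda>b. b \<in> B \<and> prefix b e \<and> (\<forall>x\<in>B. prefix x e \<longrightarrow> prefix x b)"
  let ?X = "{b \<in> B. prefix b e}"
  \<comment> \<open>The elements of \<open>B\<close> below \<open>e\<close> form a finite chain
    containing the root, so the longest of them is the maximum that \<open>branch\<close>
    describes.\<close>
  have "[] \<in> ?X" using cl_Nil[of B] B(2) by simp
  then have "Max (length ` ?X) \<in> length ` ?X" using B(1) by (intro Max_in) auto
  then obtain b where b: "b \<in> ?X" "length b = Max (length ` ?X)" by auto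
  have "length x \<le> length b" if "x \<in> ?X" for x
    unfolding b(2) by (rule Max_ge) (use B(1) that in auto)
  then have "?P b" using b(1) by (auto intro: prefix_length_prefix)
  moreover have "b' = b" if "?P b'" for b'
    using that \<open>?P b\<close> prefix_order.antisym by blast
  ultimately have "?P (THE b. ?P b)" by (rule theI)
  then have "?P (branch \<Gamma> lam S e B)" unfolding branch_def B(2) .
  then show "branch \<Gamma> lam S e B \<in> B" "prefix (branch \<Gamma> lam S e B) e"
    "\<And>x. x \<in> B \<Longrightarrow> prefix x e \<Longrightarrow> prefix x (branch \<Gamma> lam S e B)" by blast+
qed

text \<open>The dimension counts the new infinity-nodes. These lie below \<open>e\<close> and
  outside \<open>B\<close>, and a node below \<open>e\<close> is in \<open>B\<close> exactly if it
  is below the branch node.\<close>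

lemma type_dim_global_val:
  assumes e: "e \<in> V" and B: "finite B" "B \<subseteq> V" "cl B = B"
  shows "type_dim L M global_val [e] B =
    card {x \<in> V. infn x \<and> strict_prefix (branch \<Gamma> lam S e B) x \<and> prefix x e}"
proof -
  have "isolated_set L M [e] B = orb G B [e]"
    by (rule ps.isolated_set_eq[of _ _ 1]) (use e B in \<open>auto simp: tuples_def\<close>)
  then have "type_dim L M global_val [e] B = fst (type_val [e] B)"
    using global_val_orb[OF B(1,2), of "[e]"] e by (simp add: type_dim_def)
  also have "\<dots> = card {x \<in> cl (B \<union> set [e]) - cl B. infn x}"
    by (rule type_val_dim_pos(1)[OF B(1,2)]) (use e in simp)
  also have "{x \<in> cl (B \<union> set [e]) - cl B. infn x} =
      {x \<in> V. infn x \<and> strict_prefix (branch \<Gamma> lam S e B) x \<and> prefix x e}"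
  proof (intro equalityI subsetI)
    fix x assume x: "x \<in> {x \<in> cl (B \<union> set [e]) - cl B. infn x}"
    then obtain b where b: "b \<in> insert e B" "prefix x b" using cl_infn[of x "B \<union> set [e]"] by auto
    have "x \<notin> B" using x B(3) by simp
    then have xe: "prefix x e" using b cl_prefix[of b B x] B(3) by auto
    have "\<not> prefix x (branch \<Gamma> lam S e B)"
      using branch_eq(1)[OF e B(1,3)] cl_prefix[of _ B x] B(3) \<open>x \<notin> B\<close> by auto
    then have "strict_prefix (branch \<Gamma> lam S e B) x"
      using prefix_same_cases[OF xe branch_eq(2)[OF e B(1,3)]] by (auto simp: strict_prefix_def)
    then show "x \<in> {x \<in> V. infn x \<and> strict_prefix (branch \<Gamma> lam S e B) x \<and> prefix x e}"
      using x xe prefix_V[OF e] by blast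
  next
    fix x assume x: "x \<in> {x \<in> V. infn x \<and> strict_prefix (branch \<Gamma> lam S e B) x \<and> prefix x e}"
    then have "x \<notin> B" using branch_eq(3)[OF e B(1,3), of x] by (auto simp: strict_prefix_def)
    moreover have "x \<in> cl (B \<union> set [e])" by (rule cl_below[of _ e]) (use x in auto)
    ultimately show "x \<in> {x \<in> cl (B \<union> set [e]) - cl B. infn x}" using x B(3) by simp
  qed
  finally show ?thesis .
qed

text \<open>Adding \<open>butlast e\<close> to \<open>B\<close> brings no further member of the
  component of \<open>e\<close> into the closure: new infinity-nodes lie below
  \<open>butlast e\<close> and are too short. Hence the orbit over the enlarged base is the
  component orbit over the trace of \<open>B\<close>; if \<open>e\<close> is in \<open>B\<close>,
  both measures are 1.\<close>

lemma type_meas_global_val: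
  assumes e: "e \<in> V" "infn e" and B: "finite B" "B \<subseteq> V" "cl B = B"
  shows "type_meas L M global_val [e] (B \<union> {butlast e}) =
    type_meas (LC (proj e)) (C e) (hs (proj e)) [e] (B \<inter> component \<Gamma> lam S e)"
proof -
  let ?u = "butlast e" and ?\<sigma> = "proj e"
  let ?B = "B \<union> {?u}" and ?K = "K ?u ?\<sigma>"
  interpret pc: perm_struct "Hs ?u" "LC ?\<sigma>" "C e" by (rule comp_perm_struct[OF e])
  interpret pm: perm_meas "Hs ?u" "?K" "hs ?\<sigma>" by (rule comp_perm_meas[OF e])
  have eK: "[e] \<in> tuples ?K 1" using e(1) by (simp add: tuples_def K_def)
  have B': "finite ?B" "?B \<subseteq> V" using B butlast_V[OF e(1)] by auto
  have BK: "finite (B \<inter> ?K)" "B \<inter> ?K \<subseteq> ?K" using B(1) by auto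
  have "isolated_set L M [e] ?B = orb G ?B [e]"
    by (rule ps.isolated_set_eq[of _ _ 1]) (use e B' in \<open>auto simp: tuples_def\<close>)
  then have 1: "type_meas L M global_val [e] ?B = snd (type_val [e] ?B)"
    using global_val_orb[OF B', of "[e]"] e(1) by (simp add: type_meas_def)
  have "isolated_set (LC ?\<sigma>) (C e) [e] (B \<inter> ?K) = orb (Hs ?u) (B \<inter> ?K) [e]"
    by (rule pc.isolated_set_eq[of _ _ 1]) (use eK BK in auto)
  then have 2: "type_meas (LC ?\<sigma>) (C e) (hs ?\<sigma>) [e] (B \<inter> component \<Gamma> lam S e) =
      snd (hs ?\<sigma> (orb (Hs ?u) (B \<inter> ?K) [e]))"
    by (simp add: type_meas_def component_eq)
  show ?thesis
  proof (cases "e \<in> B")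
    case True
    then have "type_val [e] ?B = (0, 1)" using type_val_trivial[OF B', of "[e]"] cl_extensive[OF B'(2)] by auto
    moreover have "hs ?\<sigma> (orb (Hs ?u) (B \<inter> ?K) [e]) = (0, 1)"
      by (rule comp_val_trivial[OF pm.perm_meas_axioms BK eK]) (use True e in \<open>simp add: K_def\<close>)
    ultimately show ?thesis using 1 2 by simp
  next
    case False
    have new: "x \<in> B \<or> prefix x ?u" if "x \<in> cl ?B" "infn x" for x
      using cl_infn[OF that] cl_prefix[of _ B x] B(3) by auto
    have short: "\<not> prefix x ?u" if "x \<in> ?K" for x
    proof
      assume "prefix x ?u"
      then have "length x \<le> length ?u" by (rule prefix_length_le)
      moreover have "length x = length e" using that by (metis (mono_tags, lifting) K_def mem_Collect_eq proj_simps(1))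
      ultimately show False using infn_not_Nil[OF e(2)] by (cases e rule: rev_cases) auto
    qed
    have K: "cl ?B \<inter> ?K = B \<inter> ?K"
    proof (intro equalityI subsetI)
      fix x assume x: "x \<in> cl ?B \<inter> ?K"
      then have "infn x" using e(2) by (simp add: K_def)
      then show "x \<in> B \<inter> ?K" using new[of x] short[of x] x by blast
    qed (use cl_extensive[OF B'(2)] in auto)
    have eB: "e \<notin> cl ?B" using K False e(1) by (auto simp: K_def)
    have u: "?u \<in> cl ?B" using cl_extensive[OF B'(2)] by blast
    have "type_val [e] ?B = hs ?\<sigma> (orb G ?B [e])" by (rule type_val_one[OF B' e eB u])
    also have "orb G ?B [e] = orb G (cl ?B) [e]" by (rule orb_cl[OF B'(2), symmetric])
    also have "\<dots> = orb (Hs ?u) (cl ?B \<inter> ?K) [e]"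
      by (rule component_orbit[OF cl_finite[OF B'(1)] cl_idem e eB u])
    finally show ?thesis using 1 2 K by simp
  qed
qed

end

theorem theorem4p1:
  fixes \<Gamma> :: "nat list set" and lam :: "nat list \<Rightarrow> enat" and S :: "'s set"
    and L :: "(tree_fun + 'f, tree_rel + 'r) lang"
    and M :: "(tree_fun + 'f, tree_rel + 'r, 's node) struc"
    and h\<sigma> :: "nat list \<Rightarrow> 's node list set \<Rightarrow> nat \<times> real"
  assumes "tree_plan \<Gamma> lam"
    and "countable S" and "infinite S"
    and "NIC \<Gamma> lam S L M"
    and "\<And>\<sigma>. \<sigma> \<in> inf_nodes \<Gamma> lam \<Longrightarrow>
      MS_measurable_theory (comp_lang \<Gamma> lam S L M \<sigma>)
        {comp_struc \<Gamma> lam S M e | e. e \<in> nodes \<Gamma> lam S \<and> proj e = \<sigma>} (h\<sigma> \<sigma>)"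
    and "\<And>\<sigma> e. \<sigma> \<in> inf_nodes \<Gamma> lam \<Longrightarrow> e \<in> nodes \<Gamma> lam S \<Longrightarrow> proj e = \<sigma> \<Longrightarrow>
      fst (h\<sigma> \<sigma> (solset (comp_struc \<Gamma> lam S M e) 1 (Eq (Var 0) (Var 0)) [])) = 1"
  shows "\<exists>h. MS_measurable L M h \<and>
    (\<forall>e\<in>nodes \<Gamma> lam S. \<forall>\<sigma>\<in>inf_nodes \<Gamma> lam. \<forall>B. proj e = \<sigma> \<and>
       finite B \<and> B \<subseteq> nodes \<Gamma> lam S \<and> tcl \<Gamma> lam S B = B \<longrightarrow>
       type_dim L M h [e] B =
         card {x \<in> nodes \<Gamma> lam S. proj x \<in> inf_nodes \<Gamma> lam \<and>
                 strict_prefix (branch \<Gamma> lam S e B) x \<and> prefix x e} \<and>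
       type_meas L M h [e] (B \<union> {butlast e}) =
         type_meas (comp_lang \<Gamma> lam S L M \<sigma>) (comp_struc \<Gamma> lam S M e) (h\<sigma> \<sigma>) [e]
           (B \<inter> component \<Gamma> lam S e))"
proof -
  interpret nic_meas \<Gamma> lam S L M h\<sigma>
    by unfold_locales (fact assms)+
  show ?thesis
  proof (intro exI[of _ global_val] conjI ballI allI impI)
    show "MS_measurable L M global_val" by (rule global_val_MS_measurable)
  qed (use type_dim_global_val type_meas_global_val in auto)
qed

end
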